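(* There exists a universal constant $c>0$ (not depending on $n,d,G,\mu,\sigma,f$) such that the following holds. Let $n,d\ge 1$ be integers, let $\mu$ be a probability measure on an open set $G\subset\mathbb{R}^n$ satisfying a Poincaré-type inequality with constant $\sigma^2$ (where $\sigma>0$), and let $f\colon G\to\mathbb{R}$ be a $\mathcal{C}^d$-smooth function such that $$\int_G f\,d\mu=0\qquad\text{and}\qquad\int_G\partial_{i_1\ldots i_k}f\,d\mu=0$$ for all $k=1,\ldots,d-1$ and $1\le i_1,\ldots,i_k\le n$. Assume that $$\lVert f^{(d)}\rVert_{\mathrm{HS},2}\le 1\qquad\text{and}\qquad\lVert f^{(d)}\rVert_{\mathrm{Op},\infty}\le 1.$$ Then $$\int_G\exp\Big(\frac{c}{\sigma}\,|f|^{1/d}\Big)\,d\mu\le 2.$$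
   Context: A Borel probability measure $\mu$ on an open set $G\subset\mathbb{R}^n$ satisfies a Poincaré-type inequality with constant $\sigma^2>0$ if for every bounded smooth function $g$ on $G$ with gradient $\nabla g$, $\mathrm{Var}_\mu(g)\le\sigma^2\int|\nabla g|^2\,d\mu$, where $\mathrm{Var}_\mu(g)=\int g^2\,d\mu-(\int g\,d\mu)^2$ and $|\cdot|$ is the Euclidean norm. The number $\sigma$ is always taken positive. For $f\in\mathcal{C}^d(G)$, $f^{(d)}(x)$ is the (hyper-)matrix with entries $f^{(d)}_{i_1\ldots i_d}(x)=\partial_{i_1\ldots i_d}f(x)$, regarded as a symmetric multilinear $d$-form. Its operator norm is $|f^{(d)}(x)|_{\mathrm{Op}}=\sup\{f^{(d)}(x)[v_1,\ldots,v_d]\colon v_i\in\mathbb{R}^n,\ |v_1|=\cdots=|v_d|=1\}$, and its Hilbert--Schmidt norm $|f^{(d)}(x)|_{\mathrm{HS}}$ is the Euclidean norm of $f^{(d)}(x)\in\mathbb{R}^{n^d}$. $\lVert f^{(d)}\rVert_{\mathrm{Op},\infty}$ is the $L^\infty(\mu)$-norm of $|f^{(d)}|_{\mathrm{Op}}$ and $\lVert f^{(d)}\rVert_{\mathrm{HS},2}=\big(\int_G|f^{(d)}|_{\mathrm{HS}}^2\,d\mu\big)^{1/2}$. *)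

theory Defs
  imports "HOL-Probability.Probability"
begin

(* The dimension n has to be a bound variable (the constant must not depend on it), so R^n is
   topspace (Euclidean_space n): the functions nat => real vanishing at all indices >= n.
   Coordinates are numbered 0, ..., n - 1. A function on G is a total function whose values
   outside G are irrelevant: everything below is local on G, which is open in R^n. *)

definition borel_prob_on :: "(nat \<Rightarrow> real) set \<Rightarrow> (nat \<Rightarrow> real) measure \<Rightarrow> bool" where
  "borel_prob_on G \<mu> \<longleftrightarrow> prob_space \<mu> \<and> space \<mu> = G \<and> sets \<mu> = sets (restrict_space borel G)"

(* Here borel comes from the product topology on nat => real; its trace on G is the
   Borel sigma-algebra of the topology that G inherits from R^n. *)
lemma sets_restrict_borel_Euclidean_space:
  assumes "openin (Euclidean_space n) G"
  shows "sets (restrict_space borel G) = sigma_sets G {U. openin (Euclidean_space n) U \<and> U \<subseteq> G}"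
proof -
  let ?R = "{x :: nat \<Rightarrow> real. \<forall>i\<ge>n. x i = 0}"
  have op: "openin (Euclidean_space n) U \<longleftrightarrow> (\<exists>S. open S \<and> U = S \<inter> ?R)" for U
    by (simp add: Euclidean_space_def openin_subtopology euclidean_product_topology)
  have sub: "G \<subseteq> ?R"
    using assms op by auto
  have "{U. openin (Euclidean_space n) U \<and> U \<subseteq> G} = (\<inter>) G ` {S. open S}"
  proof (intro equalityI subsetI)
    fix U assume "U \<in> {U. openin (Euclidean_space n) U \<and> U \<subseteq> G}"
    then obtain S where "open S" "U = S \<inter> ?R" "U \<subseteq> G"
      using op by auto
    with sub have "U = G \<inter> S" by blast
    with \<open>open S\<close> show "U \<in> (\<inter>) G ` {S. open S}" by blast
  next
    fix U assume "U \<in> (\<inter>) G ` {S :: (nat \<Rightarrow> real) set. open S}"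
    then obtain S :: "(nat \<Rightarrow> real) set" where S: "open S" "U = G \<inter> S" by blast
    obtain T where T: "open T" "G = T \<inter> ?R" using assms op by blast
    have "U = (T \<inter> S) \<inter> ?R" "open (T \<inter> S)" using S T by auto
    then show "U \<in> {U. openin (Euclidean_space n) U \<and> U \<subseteq> G}" using S op by blast
  qed
  moreover have "sets (restrict_space borel G) = sigma_sets G ((\<inter>) G ` {S. open S})"
  proof -
    have "(\<inter>) G ` sigma_sets UNIV {S. open S} = {(\<lambda>x. x) -` A \<inter> G |A. A \<in> sigma_sets UNIV {S. open S}}"
      by auto
    also have "\<dots> = sigma_sets G {(\<lambda>x. x) -` A \<inter> G |A. A \<in> {S. open S}}"
      by (rule sigma_sets_vimage_commute) simp
    also have "{(\<lambda>x. x) -` A \<inter> G |A. A \<in> {S. open S}} = (\<inter>) G ` {S. open S}"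
      by auto
    finally show ?thesis
      by (simp add: sets_restrict_space borel_def)
  qed
  ultimately show ?thesis by simp
qed

definition partial :: "nat \<Rightarrow> ((nat \<Rightarrow> real) \<Rightarrow> real) \<Rightarrow> (nat \<Rightarrow> real) \<Rightarrow> real" where
  "partial i f x = deriv (\<lambda>t. f (x(i := t))) (x i)"

fun partials :: "nat list \<Rightarrow> ((nat \<Rightarrow> real) \<Rightarrow> real) \<Rightarrow> (nat \<Rightarrow> real) \<Rightarrow> real" where
  "partials [] f = f"
| "partials (i # is) f = partial i (partials is f)"

definition multi_indices :: "nat \<Rightarrow> nat \<Rightarrow> nat list set" where
  "multi_indices n k = {is. set is \<subseteq> {..<n} \<and> length is = k}"

(* Class C^k: all partial derivatives of order at most k exist and are continuous on G.
   Existence must be required explicitly, since deriv is total. *)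
definition C_on :: "nat \<Rightarrow> nat \<Rightarrow> (nat \<Rightarrow> real) set \<Rightarrow> ((nat \<Rightarrow> real) \<Rightarrow> real) \<Rightarrow> bool" where
  "C_on n k G f \<longleftrightarrow>
     (\<forall>j<k. \<forall>is \<in> multi_indices n j. \<forall>i<n. \<forall>x\<in>G.
        (\<lambda>t. partials is f (x(i := t))) field_differentiable at (x i)) \<and>
     (\<forall>j\<le>k. \<forall>is \<in> multi_indices n j. continuous_on G (partials is f))"

definition smooth_on :: "nat \<Rightarrow> (nat \<Rightarrow> real) set \<Rightarrow> ((nat \<Rightarrow> real) \<Rightarrow> real) \<Rightarrow> bool" where
  "smooth_on n G g \<longleftrightarrow> (\<forall>k. C_on n k G g)"

definition enorm :: "nat \<Rightarrow> (nat \<Rightarrow> real) \<Rightarrow> real" where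
  "enorm n v = L2_set v {..<n}"

definition gradient :: "((nat \<Rightarrow> real) \<Rightarrow> real) \<Rightarrow> (nat \<Rightarrow> real) \<Rightarrow> nat \<Rightarrow> real" where
  "gradient g x = (\<lambda>i. partial i g x)"

definition Var :: "'a measure \<Rightarrow> ('a \<Rightarrow> real) \<Rightarrow> real" where
  "Var \<mu> g = (\<integral>x. (g x)\<^sup>2 \<partial>\<mu>) - (\<integral>x. g x \<partial>\<mu>)\<^sup>2"

(* The right-hand side may be infinite, hence the Lebesgue integral with values in ennreal. *)
definition Poincare_ineq ::
    "nat \<Rightarrow> (nat \<Rightarrow> real) set \<Rightarrow> (nat \<Rightarrow> real) measure \<Rightarrow> real \<Rightarrow> bool" where
  "Poincare_ineq n G \<mu> C \<longleftrightarrow>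
     (\<forall>g. smooth_on n G g \<and> bounded (g ` G) \<longrightarrow>
        ennreal (Var \<mu> g) \<le> ennreal C * (\<integral>\<^sup>+x. ennreal ((enorm n (gradient g x))\<^sup>2) \<partial>\<mu>))"

definition deriv_form ::
    "nat \<Rightarrow> nat \<Rightarrow> ((nat \<Rightarrow> real) \<Rightarrow> real) \<Rightarrow> (nat \<Rightarrow> real) \<Rightarrow> (nat \<Rightarrow> nat \<Rightarrow> real) \<Rightarrow> real" where
  "deriv_form n d f x v = (\<Sum>is \<in> multi_indices n d. partials is f x * (\<Prod>j<d. v j (is ! j)))"

definition op_norm :: "nat \<Rightarrow> nat \<Rightarrow> ((nat \<Rightarrow> real) \<Rightarrow> real) \<Rightarrow> (nat \<Rightarrow> real) \<Rightarrow> real" where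
  "op_norm n d f x =
     Sup {deriv_form n d f x v | v. \<forall>j<d. v j \<in> topspace (Euclidean_space n) \<and> enorm n (v j) = 1}"

definition hs_norm :: "nat \<Rightarrow> nat \<Rightarrow> ((nat \<Rightarrow> real) \<Rightarrow> real) \<Rightarrow> (nat \<Rightarrow> real) \<Rightarrow> real" where
  "hs_norm n d f x = L2_set (\<lambda>is. partials is f x) (multi_indices n d)"

definition Linf_norm :: "'a measure \<Rightarrow> ('a \<Rightarrow> real) \<Rightarrow> ennreal" where
  "Linf_norm \<mu> h = esssup \<mu> (\<lambda>x. ennreal \<bar>h x\<bar>)"

definition L2_norm :: "'a measure \<Rightarrow> ('a \<Rightarrow> real) \<Rightarrow> ennreal" where
  "L2_norm \<mu> h = (let I = \<integral>\<^sup>+x. ennreal ((h x)\<^sup>2) \<partial>\<mu>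
                   in if I = \<infinity> then \<infinity> else ennreal (sqrt (enn2real I)))"

end

theory Submission
  imports Defs
begin

text \<open>Let $F_k$ be the supremum of $|f^{(k)}[v_1,\dots,v_k]|$ over rational vectors of norm at most 1.
  It has $F_{k+1}$ as an upper gradient, so the Poincare inequality applied to powers of (smooth
  surrogates of) $F_k$ gives
  $\|F_k\|_{2q}^2 \le \|F_k\|_q^2 + \<sigma>^2 q^2 \|F_{k+1}\|_{2q}^2$.
  Starting from $F_d \le 1$ and from $\|F_k\|_2 \le \|f^{(k)}\|_{HS,2} \le \<sigma>^{d-k}$, where the last step is the
  Poincare inequality for the centred partial derivatives, one obtains
  $\|F_k\|_q \le (\<sigma> q)^{d-k}$ for $q$ a power of 2; the case $k = 0$ bounds all moments of $|f|^{1/d}/\<sigma>$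
  and hence its exponential moment.  As the Poincare inequality is assumed for bounded smooth
  functions only, it is first extended to bounded $C^1$ functions: these can be approximated
  uniformly on $G$, together with their gradients, by smooth functions.\<close>

section \<open>A smooth step function\<close>

text \<open>At top order the only pointwise hypothesis is a bound on an operator norm, so the
  recursion has to run on suprema of forms; Hilbert-Schmidt norms serve only for the start at
  exponent 2. For k = d - 1 the forms are no better than C^1, and their supremum is not even that,
  which forces both the surrogates and the extension to C^1 functions. The surrogates are also
  bounded: the moment to be estimated occurs on both sides of the inequality, and absorbing it
  requires that it be finite. The bounds do not depend on the surrogate, so Fatou's lemma carries
  them to F_k.

  The recursion closes because, with s = 2 \<sigma> q and m = d - k - 1, the assumed bounds
  (\<sigma> q)^(m+1) for F_k at exponent q and s^m for F_(k+1) at exponent 2q make each term on the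
  right at most s^(2m+2) / 4.

  At k = 0 the moment of order dq of |f|^(1/d) / \<sigma> is at most q^(dq); this growth is the same
  for every d, so one constant serves all d. It is 1/(6e): 2 for rounding an exponent up to a power
  of 2, e from k^k \<le> e^k k!, and 3 so that the resulting geometric series sums to 2.\<close>

primrec diff_times :: "nat \<Rightarrow> (real \<Rightarrow> real) \<Rightarrow> bool" where
  "diff_times 0 f \<longleftrightarrow> True"
| "diff_times (Suc k) f \<longleftrightarrow>
     (\<exists>f'. (\<forall>t. (f has_real_derivative f' t) (at t)) \<and> diff_times k f')"

lemma diff_times_SucI:
  "(\<And>t. (f has_real_derivative f' t) (at t)) \<Longrightarrow> diff_times k f' \<Longrightarrow> diff_times (Suc k) f"
  by auto

lemma diff_times_Suc_D: "diff_times (Suc k) f \<Longrightarrow> diff_times k f"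
proof (induction k arbitrary: f)
  case (Suc k)
  then obtain f' where "\<forall>t. (f has_real_derivative f' t) (at t)" "diff_times (Suc k) f'"
    by auto
  with Suc.IH[of f'] show ?case by auto
qed simp

lemma diff_times_const: "diff_times k (\<lambda>_. a)"
proof (induction k arbitrary: a)
  case (Suc k)
  have "\<forall>t. ((\<lambda>_. a) has_real_derivative 0) (at t)" by simp
  with Suc[of 0] show ?case by (auto intro!: exI[of _ "\<lambda>_. 0"])
qed simp

lemma diff_times_add: "diff_times k f \<Longrightarrow> diff_times k g \<Longrightarrow> diff_times k (\<lambda>t. f t + g t)"
proof (induction k arbitrary: f g)
  case (Suc k)
  from Suc.prems obtain f' g' where
    d: "\<And>t. (f has_real_derivative f' t) (at t)" "diff_times k f'"
       "\<And>t. (g has_real_derivative g' t) (at t)" "diff_times k g'" by auto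
  have "((\<lambda>t. f t + g t) has_real_derivative f' t + g' t) (at t)" for t
    by (intro derivative_intros d)
  with Suc.IH[OF d(2,4)] show ?case by (intro diff_times_SucI)
qed simp

lemma diff_times_mult: "diff_times k f \<Longrightarrow> diff_times k g \<Longrightarrow> diff_times k (\<lambda>t. f t * g t)"
proof (induction k arbitrary: f g)
  case (Suc k)
  from Suc.prems obtain f' g' where
    d: "\<And>t. (f has_real_derivative f' t) (at t)" "diff_times k f'"
       "\<And>t. (g has_real_derivative g' t) (at t)" "diff_times k g'" by auto
  have "((\<lambda>t. f t * g t) has_real_derivative f' t * g t + g' t * f t) (at t)" for t
    by (intro DERIV_mult d)
  moreover have "diff_times k (\<lambda>t. f' t * g t + g' t * f t)"
    using Suc.prems[THEN diff_times_Suc_D] by (intro diff_times_add Suc.IH d)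
  ultimately show ?case by (rule diff_times_SucI)
qed simp

lemma diff_times_inverse:
  assumes "\<And>t. f t \<noteq> 0"
  shows "diff_times k f \<Longrightarrow> diff_times k (\<lambda>t. inverse (f t))"
proof (induction k)
  case (Suc k)
  from Suc.prems obtain f' where
    d: "\<And>t. (f has_real_derivative f' t) (at t)" "diff_times k f'" by auto
  have "((\<lambda>t. inverse (f t)) has_real_derivative
          (-1) * (f' t * (inverse (f t) * inverse (f t)))) (at t)" for t
    using DERIV_inverse'[OF d(1) assms] by (simp add: algebra_simps)
  moreover have "diff_times k (\<lambda>t. (-1) * (f' t * (inverse (f t) * inverse (f t))))"
    using Suc.prems[THEN diff_times_Suc_D] by (intro diff_times_mult diff_times_const Suc.IH d)
  ultimately show ?case by (rule diff_times_SucI)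
qed simp

lemma diff_times_affine: "diff_times k f \<Longrightarrow> diff_times k (\<lambda>t. f (a * t + b))"
proof (induction k arbitrary: f)
  case (Suc k)
  from Suc.prems obtain f' where
    d: "\<And>t. (f has_real_derivative f' t) (at t)" "diff_times k f'" by auto
  have "((\<lambda>t. f (a * t + b)) has_real_derivative f' (a * t + b) * a) (at t)" for t
    by (rule DERIV_chain2[OF d(1)]) (auto intro!: derivative_eq_intros)
  moreover have "diff_times k (\<lambda>t. f' (a * t + b) * a)"
    by (intro diff_times_mult diff_times_const Suc.IH d)
  ultimately show ?case by (rule diff_times_SucI)
qed simp

text \<open>Up to linear combinations this family is closed under differentiation, so the smoothness
  of exp (-1/t) at 0 can be proved without general polynomials in 1/t.\<close>

definition exp_recip :: "nat \<Rightarrow> real \<Rightarrow> real" where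
  "exp_recip k t = (if t > 0 then (1 / t) ^ k * exp (- (1 / t)) else 0)"

text \<open>The substitution s = 1/t turns this into the limit of s^k / exp s at infinity.\<close>

lemma exp_recip_at_right: "(exp_recip k \<longlongrightarrow> 0) (at_right 0)"
proof -
  have "((\<lambda>x::real. x ^ k / exp x) \<longlongrightarrow> 0) at_top"
    by (rule tendsto_power_div_exp_0)
  then have "((\<lambda>t::real. (inverse t) ^ k / exp (inverse t)) \<longlongrightarrow> 0) (at_right 0)"
    by (rule filterlim_compose) (rule filterlim_inverse_at_top_right)
  moreover have "eventually (\<lambda>t::real. (inverse t) ^ k / exp (inverse t) = exp_recip k t) (at_right 0)"
    using eventually_at_right_less[of "0::real"]
    by eventually_elim (simp add: exp_recip_def exp_minus inverse_eq_divide)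
  ultimately show ?thesis by (rule Lim_transform_eventually)
qed

lemma has_real_derivative_exp_recip:
  "(exp_recip k has_real_derivative exp_recip (k + 2) t - real k * exp_recip (k + 1) t) (at t)"
proof -
  consider "t > 0" | "t < 0" | "t = 0" by linarith
  then show ?thesis
  proof cases
    case 1
    have "((\<lambda>t. (1 / t) ^ k * exp (- (1 / t))) has_real_derivative
            (1 / t) ^ (k + 2) * exp (- (1 / t)) - real k * ((1 / t) ^ (k + 1) * exp (- (1 / t)))) (at t)"
    proof -
      have r: "((\<lambda>t. 1 / t) has_real_derivative - (1 / t)\<^sup>2) (at t)"
        using 1 by (auto intro!: derivative_eq_intros simp: power2_eq_square)
      have "((\<lambda>t. (1 / t) ^ k * exp (- (1 / t))) has_real_derivative
          (real k * (- (1 / t)\<^sup>2 * (1 / t) ^ (k - Suc 0))) * exp (- (1 / t))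
            + (exp (- (1 / t)) * - (- (1 / t)\<^sup>2)) * (1 / t) ^ k) (at t)"
        by (intro DERIV_mult DERIV_power DERIV_fun_exp DERIV_minus r)
      moreover have "real k * (- (1 / t)\<^sup>2 * (1 / t) ^ (k - Suc 0)) = - (real k * (1 / t) ^ (k + 1))"
        by (cases k) (simp_all add: power2_eq_square)
      ultimately have "((\<lambda>t. (1 / t) ^ k * exp (- (1 / t))) has_real_derivative
          - (real k * (1 / t) ^ (k + 1)) * exp (- (1 / t))
            + (exp (- (1 / t)) * - (- (1 / t)\<^sup>2)) * (1 / t) ^ k) (at t)"
        by (simp only:)
      then show ?thesis by (simp add: power2_eq_square algebra_simps)
    qed
    then have "(exp_recip k has_real_derivative
            (1 / t) ^ (k + 2) * exp (- (1 / t)) - real k * ((1 / t) ^ (k + 1) * exp (- (1 / t)))) (at t)"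
      by (rule has_field_derivative_transform_within_open[where S = "{0<..}"])
         (use 1 in \<open>auto simp: exp_recip_def\<close>)
    with 1 show ?thesis by (simp add: exp_recip_def)
  next
    case 2
    have "((\<lambda>t. 0) has_real_derivative 0) (at t)" by simp
    then have "(exp_recip k has_real_derivative 0) (at t)"
      by (rule has_field_derivative_transform_within_open[where S = "{..<0}"])
         (use 2 in \<open>auto simp: exp_recip_def\<close>)
    with 2 show ?thesis by (simp add: exp_recip_def)
  next
    \<comment> \<open>The difference quotient at 0 is \<open>exp_recip (Suc k)\<close> from the
      right and 0 from the left.\<close>
    case 3
    have "((\<lambda>h. (exp_recip k h) / h) \<longlongrightarrow> 0) (at_right 0)"
    proof (rule Lim_transform_eventually[OF exp_recip_at_right[of "Suc k"]])
      show "\<forall>\<^sub>F h in at_right 0. exp_recip (Suc k) h = exp_recip k h / h"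
        using eventually_at_right_less[of "0::real"]
        by eventually_elim (simp add: exp_recip_def)
    qed
    moreover have "((\<lambda>h. (exp_recip k h) / h) \<longlongrightarrow> 0) (at_left 0)"
    proof (rule Lim_transform_eventually[OF tendsto_const])
      show "\<forall>\<^sub>F h in at_left 0. 0 = exp_recip k h / h"
        unfolding eventually_at_left_field by (auto simp: exp_recip_def intro!: exI[of _ "-1"])
    qed
    ultimately have "((\<lambda>h. (exp_recip k h) / h) \<longlongrightarrow> 0) (at 0)"
      by (simp add: filterlim_split_at)
    with 3 show ?thesis by (simp add: DERIV_def exp_recip_def)
  qed
qed

lemma diff_times_exp_recip: "diff_times n (exp_recip k)"
proof (induction n arbitrary: k)
  case (Suc n)
  have "diff_times n (\<lambda>t. exp_recip (k + 2) t + (- real k) * exp_recip (k + 1) t)"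
    by (intro diff_times_add diff_times_mult diff_times_const Suc)
  then show ?case
    by (intro diff_times_SucI[OF has_real_derivative_exp_recip]) simp
qed simp

text \<open>The witness is e(t) / (e(t) + e(1 - t)) with e = \<open>exp_recip 0\<close>; the
  denominator is positive because t and 1 - t are never both nonpositive.\<close>

lemma smooth_step_exists:
  obtains s :: "real \<Rightarrow> real" where
    "\<And>k. diff_times k s" "\<And>t. t \<le> 0 \<Longrightarrow> s t = 0" "\<And>t. t \<ge> 1 \<Longrightarrow> s t = 1" "\<And>t. 0 \<le> s t" "\<And>t. s t \<le> 1"
proof
  let ?e = "exp_recip 0"
  let ?D = "\<lambda>t. ?e t + ?e ((-1) * t + 1)"
  let ?s = "\<lambda>t. ?e t * inverse (?D t)"
  have nonneg: "?e t \<ge> 0" for t by (simp add: exp_recip_def)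
  have pos: "?D t > 0" for t
    by (cases "t > 0"; cases "t < 1") (auto simp: exp_recip_def add_pos_pos)
  show "diff_times k ?s" for k
    by (intro diff_times_mult diff_times_inverse diff_times_add diff_times_exp_recip
          diff_times_affine pos[THEN less_imp_neq, THEN not_sym])
  show "?s t = 0" if "t \<le> 0" for t using that by (simp add: exp_recip_def)
  show "?s t = 1" if "t \<ge> 1" for t using that by (simp add: exp_recip_def)
  show "0 \<le> ?s t" for t using nonneg[of t] pos[of t] by auto
  show "?s t \<le> 1" for t
  proof -
    have "?s t \<le> ?D t * inverse (?D t)"
      by (rule mult_right_mono) (use nonneg pos[of t] in auto)
    with pos[of t] show ?thesis by simp
  qed
qed

section \<open>Partial derivatives and the classes $C^k$\<close>

definition box_around :: "nat \<Rightarrow> (nat \<Rightarrow> real) \<Rightarrow> real \<Rightarrow> (nat \<Rightarrow> real) set" where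
  "box_around n a r = {x \<in> topspace (Euclidean_space n). \<forall>i<n. \<bar>x i - a i\<bar> < r}"

text \<open>Boxes are preferred to balls because passing from one point to another by changing one
  coordinate at a time never leaves a box.\<close>

definition cbox_around :: "nat \<Rightarrow> (nat \<Rightarrow> real) \<Rightarrow> real \<Rightarrow> (nat \<Rightarrow> real) set" where
  "cbox_around n a r = {x \<in> topspace (Euclidean_space n). \<forall>i<n. \<bar>x i - a i\<bar> \<le> r}"

lemma continuous_on_coordinate: "continuous_on S (\<lambda>x :: nat \<Rightarrow> real. x i)"
  by (rule continuous_on_subset[OF continuous_on_product_coordinates]) auto

lemma openin_Euclidean_space_iff:
  "openin (Euclidean_space n) U \<longleftrightarrow> (\<exists>S. open S \<and> U = S \<inter> topspace (Euclidean_space n))"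
  by (simp add: Euclidean_space_def openin_subtopology euclidean_product_topology)

lemma openin_box_around: "openin (Euclidean_space n) (box_around n a r)"
proof -
  have "open (\<Inter>i\<in>{..<n}. {x :: nat \<Rightarrow> real. \<bar>x i - a i\<bar> < r})"
    by (intro open_INT finite_lessThan ballI open_Collect_less continuous_intros continuous_on_coordinate)
  then show ?thesis
    unfolding openin_Euclidean_space_iff box_around_def by (intro exI conjI) auto
qed

text \<open>Coordinates from n on vanish throughout, so only the first n factors of a basic open
  product set restrict the radius.\<close>

lemma openin_contains_cbox:
  assumes "openin (Euclidean_space n) G" "x \<in> G"
  obtains r where "r > 0" "cbox_around n x r \<subseteq> G"
proof -
  let ?E = "topspace (Euclidean_space n)"
  obtain S where S: "open S" "G = S \<inter> ?E"
    using assms openin_Euclidean_space_iff by auto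
  have "openin (product_topology (\<lambda>_. euclidean) UNIV) S"
    using S by (simp add: open_fun_def)
  then obtain X where X: "x \<in> (\<Pi>\<^sub>E i\<in>UNIV. X i)" "\<And>i. open (X i)" "(\<Pi>\<^sub>E i\<in>UNIV. X i) \<subseteq> S"
    using product_topology_open_contains_basis[of "\<lambda>_. euclidean" UNIV S x] assms S by auto
  have "\<exists>e>0. cball (x i) e \<subseteq> X i" for i
    using X by (intro iffD1[OF open_contains_cball, rule_format]) auto
  then obtain e where e: "\<And>i. e i > 0" "\<And>i. cball (x i) (e i) \<subseteq> X i" by metis
  \<comment> \<open>The inserted 1 keeps the set nonempty when n = 0.\<close>
  define r where "r = Min (insert 1 (e ` {..<n}))"
  have r: "r > 0" "\<And>i. i < n \<Longrightarrow> r \<le> e i"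
    using e unfolding r_def by auto
  have "cbox_around n x r \<subseteq> G"
  proof
    fix y assume y: "y \<in> cbox_around n x r"
    have "y i \<in> X i" for i
    proof (cases "i < n")
      case True
      then have "\<bar>y i - x i\<bar> \<le> e i" using y r(2)[of i] by (force simp: cbox_around_def)
      then show ?thesis using e(2)[of i] by (auto simp: dist_real_def abs_minus_commute subset_iff)
    next
      case False
      then have "y i = x i" using y assms(2) S(2) by (simp add: cbox_around_def topspace_Euclidean_space)
      then show ?thesis using X(1) by auto
    qed
    then show "y \<in> G" using X(3) S(2) y by (auto simp: cbox_around_def)
  qed
  with r(1) show thesis by (rule that)
qed

text \<open>This is why partial derivatives at points of G depend only on the values on G.\<close>

lemma eventually_fun_upd_in:
  assumes "openin (Euclidean_space n) G" "x \<in> G" "i < n"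
  shows "\<forall>\<^sub>F t in nhds (x i). x(i := t) \<in> G"
proof -
  obtain r where r: "r > 0" "cbox_around n x r \<subseteq> G"
    using openin_contains_cbox[OF assms(1,2)] .
  have "x \<in> topspace (Euclidean_space n)" using assms openin_subset by blast
  then have "x(i := t) \<in> G" if "dist t (x i) < r" for t
    using that r assms(3) by (intro subsetD[OF r(2)])
      (auto simp: cbox_around_def topspace_Euclidean_space dist_real_def)
  with r(1) show ?thesis unfolding eventually_nhds_metric by auto
qed

text \<open>The box is a product of n intervals and infinitely many singletons {0}, so Tychonoff's
  theorem applies.\<close>

lemma compact_cbox_around: "compact (cbox_around n a r)"
proof -
  let ?S = "\<lambda>i. if i < n then {a i - r..a i + r} else {0}"
  have "cbox_around n a r = (\<Pi>\<^sub>E i\<in>UNIV. ?S i)"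
  proof (intro set_eqI iffI)
    fix x assume "x \<in> (\<Pi>\<^sub>E i\<in>UNIV. ?S i)"
    then have "x i \<in> ?S i" for i by (rule PiE_mem) simp
    then have "\<And>i. i < n \<Longrightarrow> x i \<in> {a i - r..a i + r}" "\<And>i. i \<ge> n \<Longrightarrow> x i = 0"
      by (metis, metis linorder_not_le singletonD)
    then show "x \<in> cbox_around n a r"
      by (auto simp: cbox_around_def topspace_Euclidean_space abs_le_iff) force+
  qed (auto simp: cbox_around_def topspace_Euclidean_space abs_le_iff; force)
  moreover have "compactin (product_topology (\<lambda>_. euclidean) UNIV) (\<Pi>\<^sub>E i\<in>UNIV. ?S i)"
    by (subst compactin_PiE) auto
  ultimately show ?thesis by (simp add: euclidean_product_topology)
qed

text \<open>The metric on \<open>nat \<Rightarrow> real\<close> is a sum over an enumeration of the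
  coordinates with weights (1/2)^m, of total weight 2. A coordinatewise distance of at most
  \<delta>/3 therefore gives distance at most 2 \<delta>/3 < \<delta>.\<close>

lemma uniformly_continuous_on_cbox_around:
  assumes "continuous_on (cbox_around n a r) h" "e > 0"
  obtains \<eta> where "\<eta> > 0"
    "\<And>x y. x \<in> cbox_around n a r \<Longrightarrow> y \<in> cbox_around n a r \<Longrightarrow> (\<And>i. i < n \<Longrightarrow> \<bar>x i - y i\<bar> \<le> \<eta>)
        \<Longrightarrow> \<bar>h x - (h y :: real)\<bar> < e"
proof -
  have "uniformly_continuous_on (cbox_around n a r) h"
    using assms(1) compact_cbox_around by (rule compact_uniformly_continuous)
  then obtain \<delta> where \<delta>: "\<delta> > 0"
    "\<And>x y. x \<in> cbox_around n a r \<Longrightarrow> y \<in> cbox_around n a r \<Longrightarrow> dist y x < \<delta> \<Longrightarrow> dist (h y) (h x) < e"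
    using assms(2) unfolding uniformly_continuous_on_def by metis
  have *: "\<bar>h x - h y\<bar> < e"
    if "x \<in> cbox_around n a r" "y \<in> cbox_around n a r" "\<And>i. i < n \<Longrightarrow> \<bar>x i - y i\<bar> \<le> \<delta> / 3" for x y
  proof -
    have le: "dist (x i) (y i) \<le> \<delta> / 3" for i
      using that \<delta>(1) by (cases "i < n") (auto simp: cbox_around_def topspace_Euclidean_space dist_real_def)
    have "dist x y \<le> (\<Sum>m. (1 / 2) ^ m * (\<delta> / 3))"
      unfolding dist_fun_def
    proof (rule suminf_le)
      show "(1 / 2) ^ m * min (dist (x (from_nat m)) (y (from_nat m))) 1 \<le> (1 / 2) ^ m * (\<delta> / 3)" for m
        using le[of "from_nat m"] by (intro mult_left_mono) auto
      show "summable (\<lambda>m. (1 / 2 :: real) ^ m * min (dist (x (from_nat m)) (y (from_nat m))) 1)"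
        by (rule summable_comparison_test'[of "\<lambda>n. (1/2)^n"]) (auto simp: summable_geometric_iff)
      show "summable (\<lambda>m. (1 / 2 :: real) ^ m * (\<delta> / 3))"
        by (intro summable_mult2) (auto simp: summable_geometric_iff)
    qed
    also have "\<dots> = 2 * (\<delta> / 3)"
      by (subst suminf_mult2[symmetric]) (auto simp: summable_geometric_iff suminf_geometric)
    also have "\<dots> < \<delta>" using \<delta>(1) by simp
    finally show ?thesis using \<delta>(2)[OF that(2,1)] by (simp add: dist_real_def)
  qed
  show thesis by (rule that[of "\<delta> / 3"]) (use \<delta>(1) * in auto)
qed

section \<open>Calculus of partial derivatives\<close>

definition has_partials ::
    "nat \<Rightarrow> (nat \<Rightarrow> real) set \<Rightarrow> ((nat \<Rightarrow> real) \<Rightarrow> real) \<Rightarrow> (nat \<Rightarrow> (nat \<Rightarrow> real) \<Rightarrow> real) \<Rightarrow> bool" where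
  "has_partials n G f D \<longleftrightarrow>
     (\<forall>i<n. \<forall>x\<in>G. ((\<lambda>t. f (x(i := t))) has_real_derivative D i x) (at (x i)))"

lemma has_partialsD:
  "has_partials n G f D \<Longrightarrow> i < n \<Longrightarrow> x \<in> G
    \<Longrightarrow> ((\<lambda>t. f (x(i := t))) has_real_derivative D i x) (at (x i))"
  by (simp add: has_partials_def)

text \<open>The closure rules carry the derivatives as data D; this lemma returns from the data to
  the total function \<open>partial\<close>, so \<open>deriv\<close> is not unfolded in each
  rule.\<close>

lemma partial_eq: "has_partials n G f D \<Longrightarrow> i < n \<Longrightarrow> x \<in> G \<Longrightarrow> partial i f x = D i x"
  unfolding partial_def by (rule DERIV_imp_deriv) (rule has_partialsD)

lemma has_partials_cong:
  assumes "openin (Euclidean_space n) G" "\<And>x. x \<in> G \<Longrightarrow> f x = g x" "has_partials n G f D"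
  shows "has_partials n G g D"
  unfolding has_partials_def
proof (intro allI impI ballI)
  fix i x assume i: "i < n" and x: "x \<in> G"
  have ev: "\<forall>\<^sub>F t in nhds (x i). f (x(i := t)) = g (x(i := t))"
    using eventually_fun_upd_in[OF assms(1) x i] by eventually_elim (rule assms(2))
  show "((\<lambda>t. g (x(i := t))) has_real_derivative D i x) (at (x i))"
    using DERIV_cong_ev[OF refl ev refl] has_partialsD[OF assms(3) i x] by blast
qed

lemma has_partials_subset: "has_partials n G f D \<Longrightarrow> U \<subseteq> G \<Longrightarrow> has_partials n U f D"
  by (auto simp: has_partials_def)

lemma has_partials_const: "has_partials n G (\<lambda>_. a) (\<lambda>_ _. 0)"
  by (simp add: has_partials_def)

lemma has_partials_add:
  "has_partials n G f D \<Longrightarrow> has_partials n G g E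
    \<Longrightarrow> has_partials n G (\<lambda>x. f x + g x) (\<lambda>i x. D i x + E i x)"
  unfolding has_partials_def by (auto intro!: DERIV_add)

lemma has_partials_mult:
  assumes "has_partials n G f D" "has_partials n G g E"
  shows "has_partials n G (\<lambda>x. f x * g x) (\<lambda>i x. D i x * g x + f x * E i x)"
  unfolding has_partials_def
proof (intro allI impI ballI)
  fix i x assume "i < n" "x \<in> G"
  from DERIV_mult[OF assms[THEN has_partialsD, OF this]]
  show "((\<lambda>t. f (x(i := t)) * g (x(i := t))) has_real_derivative D i x * g x + f x * E i x) (at (x i))"
    by (simp add: algebra_simps)
qed

lemma has_partials_sum:
  assumes "\<And>k. k \<in> I \<Longrightarrow> has_partials n G (f k) (D k)"
  shows "has_partials n G (\<lambda>x. \<Sum>k\<in>I. f k x) (\<lambda>i x. \<Sum>k\<in>I. D k i x)"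
  using assms unfolding has_partials_def by (auto intro!: DERIV_sum)

lemma has_partials_chain:
  assumes "has_partials n G f D" "\<And>t. t \<in> f ` G \<Longrightarrow> (T has_real_derivative T' t) (at t)"
  shows "has_partials n G (\<lambda>x. T (f x)) (\<lambda>i x. T' (f x) * D i x)"
  unfolding has_partials_def
proof (intro allI impI ballI)
  fix i x assume ix: "i < n" "x \<in> G"
  have "(T has_real_derivative T' (f x)) (at (f (x(i := x i))))"
    using assms(2)[of "f x"] ix by simp
  from DERIV_chain2[OF this has_partialsD[OF assms(1) ix]]
  show "((\<lambda>t. T (f (x(i := t)))) has_real_derivative T' (f x) * D i x) (at (x i))" .
qed

lemma has_partials_coordinate:
  assumes "\<And>t. (s has_real_derivative s' t) (at t)"
  shows "has_partials n G (\<lambda>x. s (x j)) (\<lambda>i x. if i = j then s' (x j) else 0)"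
  using assms unfolding has_partials_def by auto

section \<open>A recursive description of C^k and its closure properties\<close>

lemma partials_snoc: "partials (is @ [i]) f = partials is (partial i f)"
  by (induction "is") auto

lemma multi_indices_Suc: "multi_indices n (Suc k) = (\<lambda>(i, is). i # is) ` ({..<n} \<times> multi_indices n k)"
proof (intro equalityI subsetI)
  fix js assume js: "js \<in> multi_indices n (Suc k)"
  then obtain i "is" where "js = i # is" by (cases js) (auto simp: multi_indices_def)
  with js show "js \<in> (\<lambda>(i, is). i # is) ` ({..<n} \<times> multi_indices n k)"
    by (auto simp: multi_indices_def image_iff)
qed (auto simp: multi_indices_def)

text \<open>The definition of \<open>C_on\<close> lists all multi-indices at once, while closure
  proofs go by induction on the order. The derivative taken first is the last entry of the list, and
  splitting it off turns one form into the other.\<close>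

lemma C_on_Suc:
  "C_on n (Suc k) G f \<longleftrightarrow>
     continuous_on G f \<and> has_partials n G f (\<lambda>i. partial i f) \<and> (\<forall>i<n. C_on n k G (partial i f))"
  (is "?L \<longleftrightarrow> ?R")
proof -
  have hp: "has_partials n G g (\<lambda>i. partial i g) \<longleftrightarrow>
      (\<forall>i<n. \<forall>x\<in>G. (\<lambda>t. g (x(i := t))) field_differentiable at (x i))" for g
    by (simp add: has_partials_def partial_def DERIV_deriv_iff_field_differentiable)
  have mi0: "is \<in> multi_indices n 0 \<longleftrightarrow> is = []" for "is" by (auto simp: multi_indices_def)
  have miS: "js \<in> multi_indices n (Suc j) \<longleftrightarrow> (\<exists>i<n. \<exists>is\<in>multi_indices n j. js = is @ [i])" for js j
  proof
    assume js: "js \<in> multi_indices n (Suc j)"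
    then have "js \<noteq> []" by (auto simp: multi_indices_def)
    then have "js = butlast js @ [last js]" by simp
    with js show "\<exists>i<n. \<exists>is\<in>multi_indices n j. js = is @ [i]"
      by (intro exI[of _ "last js"] conjI bexI[of _ "butlast js"])
         (use last_in_set[OF \<open>js \<noteq> []\<close>] in \<open>auto simp: multi_indices_def dest: in_set_butlastD\<close>)
  qed (auto simp: multi_indices_def)
  have all_less: "(\<forall>j<Suc k. P j) \<longleftrightarrow> P 0 \<and> (\<forall>j<k. P (Suc j))" for P
    by (auto simp: less_Suc_eq_0_disj)
  have all_le: "(\<forall>j\<le>Suc k. P j) \<longleftrightarrow> P 0 \<and> (\<forall>j\<le>k. P (Suc j))" for P
    by (metis Suc_le_mono le0 not0_implies_Suc)
  have allS: "(\<forall>js\<in>multi_indices n (Suc j). P js) \<longleftrightarrow> (\<forall>i<n. \<forall>is\<in>multi_indices n j. P (is @ [i]))" for P j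
    unfolding Ball_def miS by metis
  have all0: "(\<forall>js\<in>multi_indices n 0. P js) \<longleftrightarrow> P []" for P
    unfolding Ball_def mi0 by simp
  show ?thesis
    unfolding C_on_def all_less all_le hp allS all0 partials_snoc partials.simps
    by (rule iffI; clarsimp)
qed

lemma C_on_0: "C_on n 0 G f \<longleftrightarrow> continuous_on G f"
  by (auto simp: C_on_def multi_indices_def)

lemma C_on_continuous: "C_on n k G f \<Longrightarrow> continuous_on G f"
  by (cases k) (auto simp: C_on_0 C_on_Suc)

lemma C_on_Suc_D: "C_on n (Suc k) G f \<Longrightarrow> C_on n k G f"
  unfolding C_on_def by (meson le_SucI less_SucI)

lemma C_on_cong:
  assumes "openin (Euclidean_space n) G"
  shows "(\<And>x. x \<in> G \<Longrightarrow> f x = g x) \<Longrightarrow> C_on n k G f \<Longrightarrow> C_on n k G g"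
proof (induction k arbitrary: f g)
  case 0
  then show ?case using continuous_on_cong[OF refl, of G f g] by (simp add: C_on_0)
next
  case (Suc k)
  have hp: "has_partials n G g (\<lambda>i. partial i f)"
    by (rule has_partials_cong[OF assms Suc.prems(1)]) (use Suc.prems(2) in \<open>auto simp: C_on_Suc\<close>)
  then have eq: "i < n \<Longrightarrow> x \<in> G \<Longrightarrow> partial i g x = partial i f x" for i x
    by (rule partial_eq)
  have "has_partials n G g (\<lambda>i. partial i g)" using hp eq by (simp add: has_partials_def)
  moreover have "C_on n k G (partial i g)" if "i < n" for i
    using Suc.IH[of "partial i f" "partial i g"] Suc.prems(2) eq that by (simp add: C_on_Suc)
  moreover have "continuous_on G g"
    using Suc.prems continuous_on_cong[OF refl, of G f g] by (simp add: C_on_Suc)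
  ultimately show ?case by (simp add: C_on_Suc)
qed

lemma C_on_SucI:
  assumes G: "openin (Euclidean_space n) G" and "continuous_on G f"
    and hp: "has_partials n G f D" and D: "\<And>i. i < n \<Longrightarrow> C_on n k G (D i)"
  shows "C_on n (Suc k) G f"
proof -
  have "has_partials n G f (\<lambda>i. partial i f)"
    using hp partial_eq[OF hp] by (simp add: has_partials_def)
  moreover have "C_on n k G (partial i f)" if "i < n" for i
    using C_on_cong[OF G _ D[OF that], of "partial i f"] partial_eq[OF hp that] by simp
  ultimately show ?thesis using assms by (simp add: C_on_Suc)
qed

context
  fixes n :: nat and G :: "(nat \<Rightarrow> real) set"
  assumes G: "openin (Euclidean_space n) G"
begin

lemma C_on_const: "C_on n k G (\<lambda>_. a)"
proof (induction k arbitrary: a)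
  case (Suc k)
  show ?case by (rule C_on_SucI[OF G _ has_partials_const Suc]) simp
qed (simp add: C_on_0)

lemma C_on_add: "C_on n k G f \<Longrightarrow> C_on n k G g \<Longrightarrow> C_on n k G (\<lambda>x. f x + g x)"
proof (induction k arbitrary: f g)
  case (Suc k)
  then show ?case
    by (intro C_on_SucI[OF G _ has_partials_add[of n G f "\<lambda>i. partial i f" g "\<lambda>i. partial i g"]]
          Suc.IH continuous_on_add) (auto simp: C_on_Suc)
qed (simp add: C_on_0 continuous_on_add)

lemma C_on_mult: "C_on n k G f \<Longrightarrow> C_on n k G g \<Longrightarrow> C_on n k G (\<lambda>x. f x * g x)"
proof (induction k arbitrary: f g)
  case (Suc k)
  note k = Suc.prems[THEN C_on_Suc_D]
  from Suc show ?case
    by (intro C_on_SucI[OF G _ has_partials_mult[of n G f "\<lambda>i. partial i f" g "\<lambda>i. partial i g"]]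
          Suc.IH C_on_add continuous_on_mult k) (auto simp: C_on_Suc)
qed (simp add: C_on_0 continuous_on_mult)

lemma C_on_sum: "(\<And>j. j \<in> I \<Longrightarrow> C_on n k G (f j)) \<Longrightarrow> C_on n k G (\<lambda>x. \<Sum>j\<in>I. f j x)"
  by (induction I rule: infinite_finite_induct) (auto intro!: C_on_const C_on_add)

lemma C_on_prod: "(\<And>j. j \<in> I \<Longrightarrow> C_on n k G (f j)) \<Longrightarrow> C_on n k G (\<lambda>x. \<Prod>j\<in>I. f j x)"
  by (induction I rule: infinite_finite_induct) (auto intro!: C_on_const C_on_mult)

text \<open>One order is spent: \<open>diff_times k\<close> does not include continuity of the k-th
  derivative, while \<open>C_on\<close> does.\<close>

lemma C_on_coordinate: "diff_times (Suc k) s \<Longrightarrow> C_on n k G (\<lambda>x. s (x j))"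
proof (induction k arbitrary: s)
  case 0
  then obtain s' where "\<And>t. (s has_real_derivative s' t) (at t)" by auto
  then have "continuous_on UNIV s" by (meson DERIV_isCont continuous_at_imp_continuous_on)
  then show ?case
    unfolding C_on_0 by (rule continuous_on_compose2[OF _ continuous_on_coordinate]) auto
next
  case (Suc k)
  then obtain s' where s': "\<And>t. (s has_real_derivative s' t) (at t)" "diff_times (Suc k) s'"
    by auto
  then have "continuous_on UNIV s" by (meson DERIV_isCont continuous_at_imp_continuous_on)
  then have "continuous_on G (\<lambda>x. s (x j))"
    by (rule continuous_on_compose2[OF _ continuous_on_coordinate]) auto
  moreover have "C_on n k G (\<lambda>x. if i = j then s' (x j) else 0)" for i
    using Suc.IH[OF s'(2)] C_on_const by (cases "i = j") auto
  ultimately show ?case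
    by (intro C_on_SucI[OF G _ has_partials_coordinate[OF s'(1)]])
qed

text \<open>Differentiability in \<open>C_on\<close> is a pointwise condition on globally defined
  functions, so only continuity has to be transferred. As U is open in R^n and contained in G, the
  neighbourhood filters of x within U and within G agree.\<close>

lemma C_on_local:
  assumes "\<And>x. x \<in> G \<Longrightarrow> \<exists>U. openin (Euclidean_space n) U \<and> x \<in> U \<and> U \<subseteq> G \<and> C_on n k U f"
  shows "C_on n k G f"
proof -
  have at_eq: "at x within U = at x within G"
    if U: "openin (Euclidean_space n) U" "x \<in> U" "U \<subseteq> G" for x U
  proof -
    obtain S where S: "open S" "U = S \<inter> topspace (Euclidean_space n)"
      using U openin_Euclidean_space_iff by blast
    with U openin_subset[OF G] have "U \<inter> S - {x} = G \<inter> S - {x}" by blast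
    with S U show ?thesis by (intro at_within_nhd[of x S]) auto
  qed
  show ?thesis
    unfolding C_on_def continuous_on_eq_continuous_within
  proof (intro conjI allI impI ballI)
    fix j "is" i x assume H: "j < k" "is \<in> multi_indices n j" "i < n" "x \<in> G"
    with assms[of x] show "(\<lambda>t. partials is f (x(i := t))) field_differentiable at (x i)"
      unfolding C_on_def by blast
  next
    fix j "is" x assume H: "j \<le> k" "is \<in> multi_indices n j" "x \<in> G"
    from assms[OF H(3)] obtain U where
      U: "openin (Euclidean_space n) U" "x \<in> U" "U \<subseteq> G" "C_on n k U f" by blast
    with H have "continuous_on U (partials is f)" unfolding C_on_def by blast
    with U have "continuous (at x within U) (partials is f)"
      by (simp add: continuous_on_eq_continuous_within)
    then show "continuous (at x within G) (partials is f)"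
      by (simp add: continuous_within at_eq[OF U(1-3)])
  qed
qed

end

lemma C_on_subset: "C_on n k G f \<Longrightarrow> U \<subseteq> G \<Longrightarrow> C_on n k U f"
  unfolding C_on_def by (meson continuous_on_subset subsetD)

section \<open>Smooth approximation of $C^1$ functions\<close>

lemma diff_times_linear: "diff_times k (\<lambda>t. a * t + b)"
proof (cases k)
  case (Suc m)
  have "((\<lambda>t. a * t + b) has_real_derivative a) (at t)" for t
    by (auto intro!: derivative_eq_intros)
  then show ?thesis unfolding Suc by (rule diff_times_SucI[OF _ diff_times_const])
qed simp

text \<open>With a smooth step s, the bump is \<psi>(t) = s(t + 1) - s(t), so its integer translates
  telescope: the sum is s(u + 1) - s(u + 1 - N) = 1 - 0.\<close>

lemma bump_exists:
  obtains \<psi> \<psi>' :: "real \<Rightarrow> real" and B where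
    "\<And>k. diff_times k \<psi>" "\<And>t. (\<psi> has_real_derivative \<psi>' t) (at t)"
    "\<And>t. \<bar>t\<bar> > 1 \<Longrightarrow> \<psi> t = 0" "\<And>t. \<bar>t\<bar> > 1 \<Longrightarrow> \<psi>' t = 0"
    "\<And>t. \<bar>\<psi> t\<bar> \<le> B" "\<And>t. \<bar>\<psi>' t\<bar> \<le> B" "B \<ge> 1"
    "\<And>N u. 0 \<le> u \<Longrightarrow> u + 1 \<le> real N \<Longrightarrow> (\<Sum>k<N. \<psi> (u - real k)) = 1"
proof -
  obtain s :: "real \<Rightarrow> real" where s: "\<And>k. diff_times k s" "\<And>t. t \<le> 0 \<Longrightarrow> s t = 0"
    "\<And>t. t \<ge> 1 \<Longrightarrow> s t = 1" "\<And>t. 0 \<le> s t" "\<And>t. s t \<le> 1"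
    using smooth_step_exists by blast
  define \<psi> where "\<psi> t = s (1 * t + 1) + (-1) * s t" for t
  have smooth: "diff_times k \<psi>" for k
    unfolding \<psi>_def by (intro diff_times_add diff_times_mult diff_times_const diff_times_affine s)
  \<comment> \<open>The second derivative only serves to make \<psi>' continuous, hence bounded on
    [-1, 1].\<close>
  from smooth[of 2] obtain \<psi>' \<psi>'' where
    d: "\<And>t. (\<psi> has_real_derivative \<psi>' t) (at t)" "\<And>t. (\<psi>' has_real_derivative \<psi>'' t) (at t)"
    by (auto simp: numeral_2_eq_2)
  have z: "\<psi> t = 0" if "\<bar>t\<bar> > 1" for t
    using that s(2,3)[of t] s(2,3)[of "t + 1"] by (cases "t > 0") (auto simp: \<psi>_def)
  have z': "\<psi>' t = 0" if "\<bar>t\<bar> > 1" for t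
  proof -
    have "open {t::real. 1 < \<bar>t\<bar>}" by (intro open_Collect_less continuous_intros)
    then have "(\<psi> has_real_derivative 0) (at t)"
      by (rule has_field_derivative_transform_within_open[OF DERIV_const[of 0]]) (use that z in auto)
    with d(1) show ?thesis by (rule DERIV_unique)
  qed
  have "continuous_on {-1..1} \<psi>'"
    using d(2) by (meson DERIV_isCont continuous_at_imp_continuous_on)
  then have "bounded (\<psi>' ` {-1..1})"
    by (intro compact_imp_bounded compact_continuous_image) auto
  then obtain B where B: "\<And>t. t \<in> {-1..1} \<Longrightarrow> \<bar>\<psi>' t\<bar> \<le> B"
    unfolding bounded_iff by (metis imageI real_norm_def)
  show thesis
  proof (rule that[OF smooth d(1) z z'])
    show "\<bar>\<psi> t\<bar> \<le> max 1 B" for t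
      using s(4,5)[of t] s(4,5)[of "t + 1"] by (simp add: \<psi>_def)
    show "\<bar>\<psi>' t\<bar> \<le> max 1 B" for t
    proof (cases "\<bar>t\<bar> > 1")
      case False
      then have "t \<in> {-1..1}" by auto
      from B[OF this] show ?thesis by linarith
    qed (use z'[of t] in auto)
    show "(\<Sum>k<N. \<psi> (u - real k)) = 1" if "0 \<le> u" "u + 1 \<le> real N" for N u
    proof -
      have "(\<Sum>k<N. \<psi> (u - real k)) = (\<Sum>k<N. s (u + 1 - real k) - s (u + 1 - real (Suc k)))"
        by (intro sum.cong refl) (simp add: \<psi>_def algebra_simps)
      also have "\<dots> = s (u + 1 - real 0) - s (u + 1 - real N)"
        by (rule sum_lessThan_telescope')
      also have "\<dots> = 1" using that s(2)[of "u + 1 - real N"] s(3)[of "u + 1"] by simp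
      finally show ?thesis .
    qed
  qed auto
qed

text \<open>The mean value inequality for f(t) - c t.\<close>

lemma real_increment_bound:
  assumes "\<And>t. t \<in> closed_segment a b \<Longrightarrow> (f has_real_derivative f' t) (at t)"
    and "\<And>t. t \<in> closed_segment a b \<Longrightarrow> \<bar>f' t - c\<bar> \<le> \<omega>"
  shows "\<bar>f b - f a - c * (b - a)\<bar> \<le> \<omega> * \<bar>b - a\<bar>"
proof -
  have "norm ((f b - c * b) - (f a - c * a)) \<le> \<omega> * norm (b - a)"
  proof (rule field_differentiable_bound[where S = "closed_segment a b" and f' = "\<lambda>t. f' t - c"])
    fix t assume t: "t \<in> closed_segment a b"
    have "((\<lambda>t. f t - c * t) has_real_derivative f' t - c * 1) (at t)"
      by (intro DERIV_diff DERIV_cmult DERIV_ident assms(1) t)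
    then show "((\<lambda>t. f t - c * t) has_real_derivative f' t - c) (at t within closed_segment a b)"
      by (simp add: has_field_derivative_at_within)
  qed (use assms(2) in auto)
  then show ?thesis by (simp add: algebra_simps)
qed

text \<open>The path from y to x changes one coordinate at a time: \<open>z m\<close> has the first
  m coordinates of x and the others of y. Each of the n legs stays in the box within \<eta> of y and
  costs at most \<omega> \<eta> by the one-dimensional estimate, so total differentiability is never
  invoked.\<close>

lemma first_order_bound:
  assumes hp: "has_partials n G h D" and sub: "cbox_around n a R \<subseteq> G"
    and mod: "\<And>i x y. i < n \<Longrightarrow> x \<in> cbox_around n a R \<Longrightarrow> y \<in> cbox_around n a R
      \<Longrightarrow> (\<And>j. j < n \<Longrightarrow> \<bar>x j - y j\<bar> \<le> \<eta>) \<Longrightarrow> \<bar>D i x - D i y\<bar> \<le> \<omega>"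
    and x: "x \<in> cbox_around n a R" and y: "y \<in> cbox_around n a R"
    and xy: "\<And>j. j < n \<Longrightarrow> \<bar>x j - y j\<bar> \<le> \<eta>" and "\<omega> \<ge> 0" "\<eta> \<ge> 0"
  shows "\<bar>h y + (\<Sum>i<n. D i y * (x i - y i)) - h x\<bar> \<le> real n * \<omega> * \<eta>"
proof -
  define z where "z m = (\<lambda>i. if i < m then x i else y i)" for m
  have z0: "z 0 = y" by (auto simp: z_def)
  have zn: "z n = x"
    using x y by (auto simp: z_def cbox_around_def topspace_Euclidean_space fun_eq_iff)
  have step: "\<bar>h (z (Suc m)) - h (z m) - D m y * (x m - y m)\<bar> \<le> \<omega> * \<eta>" if m: "m < n" for m
  proof -
    let ?z = "\<lambda>t. (z m)(m := t)"
    have in_box: "?z t \<in> cbox_around n a R" if "t \<in> closed_segment (y m) (x m)" for t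
    proof -
      have "\<bar>t - a m\<bar> \<le> R"
        using that x y m by (auto simp: cbox_around_def closed_segment_eq_real_ivl abs_le_iff split: if_splits; force)
      with x y m show ?thesis
        by (auto simp: cbox_around_def topspace_Euclidean_space z_def)
    qed
    have near: "\<bar>D m (?z t) - D m y\<bar> \<le> \<omega>" if t: "t \<in> closed_segment (y m) (x m)" for t
    proof (rule mod[OF m in_box[OF t] y])
      fix j assume j: "j < n"
      have "\<bar>t - y m\<bar> \<le> \<bar>x m - y m\<bar>"
        using t by (auto simp: closed_segment_eq_real_ivl split: if_splits)
      with xy[OF j] \<open>\<eta> \<ge> 0\<close> show "\<bar>?z t j - y j\<bar> \<le> \<eta>" by (auto simp: z_def)
    qed
    have "\<bar>h (?z (x m)) - h (?z (y m)) - D m y * (x m - y m)\<bar> \<le> \<omega> * \<bar>x m - y m\<bar>"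
    proof (rule real_increment_bound[where f' = "\<lambda>t. D m (?z t)"])
      fix t assume "t \<in> closed_segment (y m) (x m)"
      with in_box sub have "?z t \<in> G" by blast
      from has_partialsD[OF hp m this]
      show "((\<lambda>t. h (?z t)) has_real_derivative D m (?z t)) (at t)" by simp
    qed (rule near)
    also have "\<omega> * \<bar>x m - y m\<bar> \<le> \<omega> * \<eta>"
      using xy[OF m] \<open>\<omega> \<ge> 0\<close> by (rule mult_left_mono)
    also have "?z (x m) = z (Suc m)" by (auto simp: z_def fun_eq_iff)
    also have "?z (y m) = z m" by (auto simp: z_def fun_eq_iff)
    finally show ?thesis .
  qed
  have "h x - h y - (\<Sum>i<n. D i y * (x i - y i))
      = (\<Sum>m<n. h (z (Suc m)) - h (z m) - D m y * (x m - y m))"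
    using sum_lessThan_telescope[of "\<lambda>m. h (z m)" n] by (simp add: sum_subtractf z0 zn)
  also have "\<bar>\<dots>\<bar> \<le> (\<Sum>m<n. \<bar>h (z (Suc m)) - h (z m) - D m y * (x m - y m)\<bar>)"
    by (rule sum_abs)
  also have "\<dots> \<le> (\<Sum>m<n. \<omega> * \<eta>)" by (intro sum_mono step) auto
  finally show ?thesis by (simp add: abs_minus_commute algebra_simps)
qed

lemma has_partials_prod_coordinate:
  assumes "\<And>j t. j < n \<Longrightarrow> (q j has_real_derivative q' j t) (at t)"
  shows "has_partials n G (\<lambda>x. \<Prod>j<n. q j (x j)) (\<lambda>i x. q' i (x i) * (\<Prod>j\<in>{..<n} - {i}. q j (x j)))"
  unfolding has_partials_def
proof (intro allI impI ballI)
  fix i x assume i: "i < n" "x \<in> G"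
  have eq: "(\<Prod>j<n. q j ((x(i := t)) j)) = q i t * (\<Prod>j\<in>{..<n} - {i}. q j (x j))" for t
    using i(1) by (subst prod.remove[of _ i]) (auto intro!: arg_cong2[of _ _ _ _ "(*)"] prod.cong)
  have "((\<lambda>t. q i t * (\<Prod>j\<in>{..<n} - {i}. q j (x j)))
      has_real_derivative q' i (x i) * (\<Prod>j\<in>{..<n} - {i}. q j (x j))) (at (x i))"
    using assms[OF i(1), of "x i"] by (rule DERIV_cmult_right)
  then show "((\<lambda>t. \<Prod>j<n. q j ((x(i := t)) j))
      has_real_derivative q' i (x i) * (\<Prod>j\<in>{..<n} - {i}. q j (x j))) (at (x i))"
    by (simp only: eq)
qed

text \<open>Bounds the overlap of the lattice cut-offs: at most 3 per coordinate, hence at most 3^n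
  at a point.\<close>

lemma card_nat_near: "card {k::nat. \<bar>u - real k\<bar> \<le> 1} \<le> 3" "finite {k::nat. \<bar>u - real k\<bar> \<le> 1}"
proof -
  let ?m = "nat \<lceil>u - 1\<rceil>"
  have sub: "{k::nat. \<bar>u - real k\<bar> \<le> 1} \<subseteq> {?m..?m + 2}"
  proof
    fix k assume "k \<in> {k::nat. \<bar>u - real k\<bar> \<le> 1}"
    then have "u - 1 \<le> real k" "real k \<le> u + 1" by auto
    moreover have "u - 1 \<le> real ?m" by linarith
    ultimately show "k \<in> {?m..?m + 2}" by (auto simp: nat_le_iff ceiling_le_iff) linarith
  qed
  from card_mono[OF _ this] show "card {k::nat. \<bar>u - real k\<bar> \<le> 1} \<le> 3" by simp
  from finite_subset[OF sub] show "finite {k::nat. \<bar>u - real k\<bar> \<le> 1}" by simp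
qed

text \<open>Quasi-interpolation: the first-order Taylor polynomials at the nodes of a lattice of mesh
  $\<eta>$ are glued by a lattice partition of unity.  The Taylor error is $o(\<eta>)$ and the gradients of
  the cut-offs are $O(1/\<eta>)$, so the gradients converge as well.  Nodes outside the box are
  projected onto it, so that the cut-offs sum to 1 in a neighbourhood of the box.\<close>

lemma local_smooth_approx:
  assumes G: "openin (Euclidean_space n) G" and sub: "cbox_around n a R \<subseteq> G" and R: "R > 0"
    and hp: "has_partials n G h D" and cont: "\<And>i. i < n \<Longrightarrow> continuous_on G (D i)" and \<delta>: "\<delta> > 0"
  obtains P where "\<And>k. C_on n k G P"
    "\<And>x. x \<in> cbox_around n a R \<Longrightarrow> \<bar>P x - h x\<bar> \<le> \<delta>"
    "\<And>i x. i < n \<Longrightarrow> x \<in> cbox_around n a R \<Longrightarrow> \<bar>partial i P x - D i x\<bar> \<le> \<delta>"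
proof -
  let ?K = "cbox_around n a R"
  obtain \<psi> \<psi>' B where \<psi>: "\<And>k. diff_times k \<psi>" "\<And>t. (\<psi> has_real_derivative \<psi>' t) (at t)"
    "\<And>t. \<bar>t\<bar> > 1 \<Longrightarrow> \<psi> t = 0" "\<And>t. \<bar>t\<bar> > 1 \<Longrightarrow> \<psi>' t = 0"
    "\<And>t. \<bar>\<psi> t\<bar> \<le> B" "\<And>t. \<bar>\<psi>' t\<bar> \<le> B" "B \<ge> 1"
    "\<And>N u. 0 \<le> u \<Longrightarrow> u + 1 \<le> real N \<Longrightarrow> (\<Sum>k<N. \<psi> (u - real k)) = 1"
    using bump_exists by blast
  \<comment> \<open>At most 3^n active nodes, cut-offs bounded by B^n, and n + 1 errors of size
    \<omega>: n from the Taylor polynomial and one from the variation of the gradient.\<close>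
  define C where "C = 3 ^ n * B ^ n * (real n + 1)"
  have Bn: "B ^ n \<ge> 1" using \<psi>(7) by simp
  have C: "C > 0" using Bn unfolding C_def by (intro mult_pos_pos) auto
  define \<omega> where "\<omega> = \<delta> / C"
  have "C * \<omega> = \<delta>" using C by (simp add: \<omega>_def)
  then have total: "3 ^ n * (B ^ n * ((real n + 1) * \<omega>)) = \<delta>"
    unfolding C_def by (simp only: mult.assoc)
  have \<omega>: "\<omega> > 0" using \<delta> C by (simp add: \<omega>_def)
  have "\<exists>\<eta>>0. \<forall>x\<in>?K. \<forall>y\<in>?K. (\<forall>j<n. \<bar>x j - y j\<bar> \<le> \<eta>) \<longrightarrow> \<bar>D i x - D i y\<bar> < \<omega>" if "i < n" for i
    using uniformly_continuous_on_cbox_around[OF continuous_on_subset[OF cont[OF that] sub] \<omega>] by metis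
  then obtain e where e: "\<And>i. i < n \<Longrightarrow> e i > 0"
    "\<And>i x y. i < n \<Longrightarrow> x \<in> ?K \<Longrightarrow> y \<in> ?K \<Longrightarrow> (\<And>j. j < n \<Longrightarrow> \<bar>x j - y j\<bar> \<le> e i) \<Longrightarrow> \<bar>D i x - D i y\<bar> < \<omega>"
    by metis
  define \<eta> where "\<eta> = Min (insert 1 (e ` {..<n}))"
  have \<eta>: "\<eta> > 0" "\<eta> \<le> 1" "\<And>i. i < n \<Longrightarrow> \<eta> \<le> e i"
    using e(1) unfolding \<eta>_def by auto
  have mod: "\<bar>D i x - D i y\<bar> \<le> \<omega>"
    if "i < n" "x \<in> ?K" "y \<in> ?K" "\<And>j. j < n \<Longrightarrow> \<bar>x j - y j\<bar> \<le> \<eta>" for i x y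
    using e(2)[OF that(1-3)] that(4) \<eta>(3)[OF that(1)] by (meson less_imp_le order_trans)
  \<comment> \<open>On the box u lies between 1 and N - 3, whereas the cut-offs already sum to 1 for
    u between 0 and N - 1. The slack makes the sum constant in a neighbourhood, so that it can be
    differentiated.\<close>
  define N where "N = nat \<lceil>2 * R / \<eta>\<rceil> + 4"
  have N: "2 * R / \<eta> + 4 \<le> real N" unfolding N_def by linarith
  define I where "I = ({..<n} \<rightarrow>\<^sub>E {..<N})"
  have finI: "finite I" unfolding I_def by (intro finite_PiE) auto
  \<comment> \<open>Coordinate i in units of the mesh, with the left face of the box at 1. The point
    with mesh coordinates k, clamped to the box, is \<open>node k\<close>.\<close>
  define u where "u i t = (t - a i + R) / \<eta> + 1" for i t
  define node where "node k = (\<lambda>i. if i < n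
      then max (a i - R) (min (a i + R) (a i - R + \<eta> * (real (k i) - 1))) else 0)" for k :: "nat \<Rightarrow> nat"
  define q where "q k i t = \<psi> (u i t - real (k i))" for k :: "nat \<Rightarrow> nat" and i t
  define q' where "q' k i t = \<psi>' (u i t - real (k i)) / \<eta>" for k :: "nat \<Rightarrow> nat" and i t
  define \<Psi> where "\<Psi> k x = (\<Prod>i<n. q k i (x i))" for k :: "nat \<Rightarrow> nat" and x :: "nat \<Rightarrow> real"
  define \<Psi>' where "\<Psi>' k i x = q' k i (x i) * (\<Prod>j\<in>{..<n} - {i}. q k j (x j))"
    for k :: "nat \<Rightarrow> nat" and i and x :: "nat \<Rightarrow> real"
  define T where "T k x = h (node k) + (\<Sum>i<n. D i (node k) * (x i - node k i))" for k and x :: "nat \<Rightarrow> real"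
  define P where "P x = (\<Sum>k\<in>I. \<Psi> k x * T k x)" for x
  have node_K: "node k \<in> ?K" for k
    using R by (auto simp: node_def cbox_around_def topspace_Euclidean_space)
  have dq: "(q k i has_real_derivative q' k i t) (at t)" for k i t
  proof -
    have "((\<lambda>t. u i t - real (k i)) has_real_derivative 1 / \<eta>) (at t)"
      unfolding u_def using \<eta>(1) by (auto intro!: derivative_eq_intros)
    from DERIV_chain2[OF \<psi>(2) this] show ?thesis unfolding q_def q'_def by simp
  qed
  have hp\<Psi>: "has_partials n G (\<Psi> k) (\<Psi>' k)" for k
    unfolding \<Psi>_def \<Psi>'_def by (rule has_partials_prod_coordinate) (rule dq)
  have hpT: "has_partials n G (T k) (\<lambda>i x. D i (node k))" for k
    unfolding has_partials_def
  proof (intro allI impI ballI)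
    fix i x assume i: "i < n" "x \<in> G"
    have eq: "T k (x(i := t)) = h (node k) + (\<Sum>j\<in>{..<n} - {i}. D j (node k) * (x j - node k j))
        + D i (node k) * (t - node k i)" for t
      unfolding T_def using i(1) by (subst sum.remove[of _ i]) (auto intro!: sum.cong)
    show "((\<lambda>t. T k (x(i := t))) has_real_derivative D i (node k)) (at (x i))"
      unfolding eq by (auto intro!: derivative_eq_intros)
  qed
  have hpP: "has_partials n G P (\<lambda>i x. \<Sum>k\<in>I. \<Psi>' k i x * T k x + \<Psi> k x * D i (node k))"
    unfolding P_def by (intro has_partials_sum has_partials_mult hp\<Psi> hpT)
  have smooth: "C_on n m G P" for m
    unfolding P_def
  proof (intro C_on_sum[OF G] C_on_mult[OF G])
    fix k
    show "C_on n m G (\<Psi> k)"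
      unfolding \<Psi>_def
    proof (intro C_on_prod[OF G])
      fix i
      have "q k i = (\<lambda>t. \<psi> (1 / \<eta> * t + ((R - a i) / \<eta> + 1 - real (k i))))"
        by (simp add: q_def u_def fun_eq_iff diff_divide_distrib add_divide_distrib algebra_simps)
      then show "C_on n m G (\<lambda>x. q k i (x i))"
        by (intro C_on_coordinate[OF G]) (simp only: diff_times_affine[OF \<psi>(1)])
    qed
    have "C_on n m G (\<lambda>x. 1 * x i + (- node k i))" for i
      by (intro C_on_coordinate[OF G, where s = "\<lambda>t. 1 * t + (- node k i)"] diff_times_linear)
    then show "C_on n m G (T k)"
      unfolding T_def by (intro C_on_add[OF G] C_on_const[OF G] C_on_sum[OF G] C_on_mult[OF G]) simp
  qed
  have sum1: "(\<Sum>k\<in>I. \<Psi> k x) = 1" if "\<And>i. i < n \<Longrightarrow> 0 \<le> u i (x i) \<and> u i (x i) + 1 \<le> real N" for x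
  proof -
    have "(\<Sum>k\<in>I. \<Psi> k x) = (\<Prod>i<n. \<Sum>m<N. \<psi> (u i (x i) - real m))"
      unfolding I_def \<Psi>_def q_def by (rule prod_sum_PiE[symmetric]) auto
    also have "\<dots> = 1" using that by (intro prod.neutral) (auto intro!: \<psi>(8))
    finally show ?thesis .
  qed
  have u_range: "1 \<le> u i (x i) \<and> u i (x i) + 3 \<le> real N" if "x \<in> ?K" "i < n" for x i
  proof -
    have "\<bar>x i - a i\<bar> \<le> R" using that by (simp add: cbox_around_def)
    then have "0 \<le> (x i - a i + R) / \<eta>" "(x i - a i + R) / \<eta> \<le> 2 * R / \<eta>"
      using \<eta>(1) by (auto intro!: divide_right_mono)
    with N show ?thesis by (simp add: u_def)
  qed
  \<comment> \<open>The sum of the cut-offs is constant near x, so its derivative vanishes; this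
    allows h x to be subtracted from the Taylor polynomials in the gradient.\<close>
  have sum0: "(\<Sum>k\<in>I. \<Psi>' k i x) = 0" if x: "x \<in> ?K" and i: "i < n" for x i
  proof -
    have "((\<lambda>t. \<Sum>k\<in>I. \<Psi> k (x(i := t))) has_real_derivative (\<Sum>k\<in>I. \<Psi>' k i x)) (at (x i))"
      by (rule has_partialsD[OF has_partials_sum[OF hp\<Psi>] i]) (use x sub in auto)
    moreover have "((\<lambda>t. \<Sum>k\<in>I. \<Psi> k (x(i := t))) has_real_derivative 0) (at (x i))"
    proof (rule has_field_derivative_transform_within_open[OF DERIV_const[of 1]])
      show "open {t. 0 < u i t \<and> u i t + 1 < real N}"
        unfolding u_def by (intro open_Collect_conj open_Collect_less continuous_intros) (use \<eta> in auto)
      show "x i \<in> {t. 0 < u i t \<and> u i t + 1 < real N}" using u_range[OF x i] by auto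
      fix t assume t: "t \<in> {t. 0 < u i t \<and> u i t + 1 < real N}"
      show "1 = (\<Sum>k\<in>I. \<Psi> k (x(i := t)))"
      proof (rule sum1[symmetric])
        fix j assume "j < n"
        with t u_range[OF x, of j]
        show "0 \<le> u j ((x(i := t)) j) \<and> u j ((x(i := t)) j) + 1 \<le> real N" by auto
      qed
    qed
    ultimately show ?thesis by (rule DERIV_unique)
  qed
  \<comment> \<open>The nodes active at x: for all others some factor of the cut-off, and of its
    derivative, is evaluated beyond distance 1, where \<psi> and \<psi>' vanish.\<close>
  define W where "W x = {k \<in> I. \<forall>i<n. \<bar>u i (x i) - real (k i)\<bar> \<le> 1}" for x
  have finW: "finite (W x)" for x using finI by (simp add: W_def)
  have cardW: "real (card (W x)) \<le> 3 ^ n" for x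
  proof -
    let ?S = "\<lambda>i. {m::nat. \<bar>u i (x i) - real m\<bar> \<le> 1}"
    have "W x \<subseteq> Pi\<^sub>E {..<n} ?S" by (auto simp: W_def I_def PiE_iff extensional_def)
    then have "card (W x) \<le> card (Pi\<^sub>E {..<n} ?S)"
      by (intro card_mono finite_PiE card_nat_near) auto
    also have "\<dots> = (\<Prod>i<n. card (?S i))" by (intro card_PiE) auto
    also have "\<dots> \<le> (\<Prod>i<n. 3)" by (intro prod_mono) (auto intro: card_nat_near)
    finally have "card (W x) \<le> 3 ^ n" by simp
    then show ?thesis by (metis of_nat_le_iff of_nat_numeral of_nat_power)
  qed
  \<comment> \<open>Clamping a node to an interval that contains x i does not increase its distance
    from x i.\<close>
  have near: "\<bar>x i - node k i\<bar> \<le> \<eta>" if "x \<in> ?K" "k \<in> W x" "i < n" for x k i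
  proof -
    have "\<bar>u i (x i) - real (k i)\<bar> \<le> 1" using that by (simp add: W_def)
    moreover have "u i (x i) - real (k i) = (x i - (a i - R + \<eta> * (real (k i) - 1))) / \<eta>"
      using \<eta>(1) by (simp add: u_def field_simps)
    ultimately have "\<bar>x i - (a i - R + \<eta> * (real (k i) - 1))\<bar> \<le> \<eta>"
      using \<eta>(1) by (simp add: abs_divide)
    moreover have "\<bar>x i - a i\<bar> \<le> R" using that by (simp add: cbox_around_def)
    ultimately show ?thesis using that(3) by (auto simp: node_def min_def max_def abs_le_iff)
  qed
  have T_err: "\<bar>T k x - h x\<bar> \<le> real n * \<omega> * \<eta>" if "x \<in> ?K" "k \<in> W x" for x k
    unfolding T_def
    by (rule first_order_bound[OF hp sub mod that(1) node_K near[OF that]]) (use \<omega> \<eta> in auto)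
  have q_bd: "\<bar>q k i t\<bar> \<le> B" for k i t using \<psi>(5) by (simp add: q_def)
  have \<Psi>_bd: "\<bar>\<Psi> k x\<bar> \<le> B ^ n" for k x
  proof -
    have "\<bar>\<Psi> k x\<bar> \<le> (\<Prod>i<n. B)" unfolding \<Psi>_def abs_prod by (intro prod_mono) (use q_bd in auto)
    then show ?thesis by simp
  qed
  have \<Psi>'_bd: "\<bar>\<Psi>' k i x\<bar> \<le> B ^ n / \<eta>" if i: "i < n" for k i x
  proof -
    have "\<bar>\<Prod>j\<in>{..<n} - {i}. q k j (x j)\<bar> \<le> (\<Prod>j\<in>{..<n} - {i}. B)"
      unfolding abs_prod by (intro prod_mono) (use q_bd in auto)
    moreover have "\<bar>q' k i (x i)\<bar> \<le> B / \<eta>"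
      using \<psi>(6) \<eta>(1) by (simp add: q'_def abs_divide divide_right_mono)
    ultimately have "\<bar>\<Psi>' k i x\<bar> \<le> (B / \<eta>) * (\<Prod>j\<in>{..<n} - {i}. B)"
      unfolding \<Psi>'_def abs_mult using \<psi>(7) \<eta>(1) by (intro mult_mono) auto
    also have "\<dots> = (\<Prod>j<n. B) / \<eta>" using i by (subst (2) prod.remove[of _ i]) auto
    finally show ?thesis by simp
  qed
  have \<Psi>_0: "\<Psi> k x = 0" if "k \<in> I - W x" for k x
  proof -
    from that obtain i where "i < n" "\<bar>u i (x i) - real (k i)\<bar> > 1"
      by (auto simp: W_def not_le)
    then show ?thesis unfolding \<Psi>_def q_def using \<psi>(3) by (intro prod_zero) auto
  qed
  have \<Psi>'_0: "\<Psi>' k i x = 0" if k: "k \<in> I - W x" for k i x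
  proof -
    from that obtain j where j: "j < n" "\<bar>u j (x j) - real (k j)\<bar> > 1"
      by (auto simp: W_def not_le)
    show ?thesis
    proof (cases "j = i")
      case True
      with j \<psi>(4) show ?thesis by (simp add: \<Psi>'_def q'_def)
    next
      case False
      with j \<psi>(3) have "(\<Prod>j\<in>{..<n} - {i}. q k j (x j)) = 0"
        by (intro prod_zero) (auto simp: q_def intro!: bexI[of _ j])
      then show ?thesis by (simp add: \<Psi>'_def)
    qed
  qed
  show thesis
  proof (rule that[OF smooth])
    fix x assume x: "x \<in> ?K"
    have one: "(\<Sum>k\<in>I. \<Psi> k x) = 1"
      by (rule sum1) (use u_range[OF x] in fastforce)
    have "P x - h x = (\<Sum>k\<in>I. \<Psi> k x * T k x) - (\<Sum>k\<in>I. \<Psi> k x) * h x"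
      by (simp add: P_def one)
    also have "\<dots> = (\<Sum>k\<in>I. \<Psi> k x * (T k x - h x))"
      by (simp add: sum_distrib_right sum_subtractf right_diff_distrib)
    also have "\<dots> = (\<Sum>k\<in>W x. \<Psi> k x * (T k x - h x))"
      using finI \<Psi>_0 by (intro sum.mono_neutral_right) (auto simp: W_def)
    also have "\<bar>\<dots>\<bar> \<le> (\<Sum>k\<in>W x. \<bar>\<Psi> k x * (T k x - h x)\<bar>)" by (rule sum_abs)
    also have "\<dots> \<le> (\<Sum>k\<in>W x. B ^ n * (real n * \<omega> * \<eta>))"
      unfolding abs_mult using Bn by (intro sum_mono mult_mono \<Psi>_bd T_err x) auto
    also have "\<dots> = real (card (W x)) * (B ^ n * (real n * \<omega> * \<eta>))" by simp
    also have "\<dots> \<le> 3 ^ n * (B ^ n * ((real n + 1) * \<omega> * 1))"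
      using cardW Bn \<omega> \<eta> by (intro mult_mono) auto
    also have "\<dots> = \<delta>" by (simp only: mult_1_right total)
    finally show "\<bar>P x - h x\<bar> \<le> \<delta>" .
    fix i assume i: "i < n"
    \<comment> \<open>The subtracted terms are 0 times h x and 1 times D i x. They leave the
      differences \<open>T k x - h x\<close>, of order \<omega> \<eta>, against derivatives of order
      1/\<eta>.\<close>
    have "partial i P x - D i x = (\<Sum>k\<in>I. \<Psi>' k i x * T k x + \<Psi> k x * D i (node k))
        - (\<Sum>k\<in>I. \<Psi>' k i x) * h x - (\<Sum>k\<in>I. \<Psi> k x) * D i x"
      using partial_eq[OF hpP i, of x] x sub by (simp add: one sum0[OF x i] subset_iff)
    also have "\<dots> = (\<Sum>k\<in>I. \<Psi>' k i x * (T k x - h x) + \<Psi> k x * (D i (node k) - D i x))"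
      unfolding sum_distrib_right sum_subtractf[symmetric]
      by (intro sum.cong refl) (simp add: ring_distribs)
    also have "\<dots> = (\<Sum>k\<in>W x. \<Psi>' k i x * (T k x - h x) + \<Psi> k x * (D i (node k) - D i x))"
      using finI \<Psi>_0 \<Psi>'_0 by (intro sum.mono_neutral_right) (auto simp: W_def)
    finally have eq: "partial i P x - D i x
        = (\<Sum>k\<in>W x. \<Psi>' k i x * (T k x - h x) + \<Psi> k x * (D i (node k) - D i x))" .
    have "\<bar>partial i P x - D i x\<bar> \<le> (\<Sum>k\<in>W x. \<bar>\<Psi>' k i x * (T k x - h x) + \<Psi> k x * (D i (node k) - D i x)\<bar>)"
      unfolding eq by (rule sum_abs)
    also have "\<dots> \<le> (\<Sum>k\<in>W x. B ^ n / \<eta> * (real n * \<omega> * \<eta>) + B ^ n * \<omega>)"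
    proof (rule sum_mono)
      fix k assume k: "k \<in> W x"
      have "\<bar>\<Psi>' k i x * (T k x - h x)\<bar> \<le> B ^ n / \<eta> * (real n * \<omega> * \<eta>)"
        unfolding abs_mult using Bn \<eta> \<omega> by (intro mult_mono \<Psi>'_bd T_err x k i) auto
      moreover have "\<bar>D i (node k) - D i x\<bar> \<le> \<omega>"
        using mod[OF i x node_K near[OF x k]] by (simp add: abs_minus_commute)
      then have "\<bar>\<Psi> k x * (D i (node k) - D i x)\<bar> \<le> B ^ n * \<omega>"
        unfolding abs_mult using Bn by (intro mult_mono \<Psi>_bd) auto
      ultimately show "\<bar>\<Psi>' k i x * (T k x - h x) + \<Psi> k x * (D i (node k) - D i x)\<bar>
          \<le> B ^ n / \<eta> * (real n * \<omega> * \<eta>) + B ^ n * \<omega>" by linarith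
    qed
    \<comment> \<open>The mesh cancels here, so \<eta> enters only through the modulus
      \<omega>.\<close>
    also have "\<dots> = real (card (W x)) * (B ^ n * ((real n + 1) * \<omega>))"
      using \<eta>(1) by (simp add: field_simps)
    also have "\<dots> \<le> 3 ^ n * (B ^ n * ((real n + 1) * \<omega>))"
      using cardW Bn \<omega> by (intro mult_right_mono) auto
    also have "\<dots> = \<delta>" by (simp only: mult_1_right total)
    finally show "\<bar>partial i P x - D i x\<bar> \<le> \<delta>" .
  qed
qed

section \<open>Gluing the local approximations over all of G\<close>

lemma plateau_exists:
  obtains b :: "real \<Rightarrow> real" where
    "\<And>k. diff_times k b" "\<And>t. \<bar>t\<bar> \<le> 1 \<Longrightarrow> b t = 1" "\<And>t. \<bar>t\<bar> \<ge> 2 \<Longrightarrow> b t = 0"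
    "\<And>t. 0 \<le> b t" "\<And>t. b t \<le> 1"
proof -
  obtain s :: "real \<Rightarrow> real" where s: "\<And>k. diff_times k s" "\<And>t. t \<le> 0 \<Longrightarrow> s t = 0"
    "\<And>t. t \<ge> 1 \<Longrightarrow> s t = 1" "\<And>t. 0 \<le> s t" "\<And>t. s t \<le> 1"
    using smooth_step_exists by blast
  show thesis
  proof
    let ?b = "\<lambda>t. s (1 * t + 2) * s ((-1) * t + 2)"
    show "diff_times k ?b" for k by (intro diff_times_mult diff_times_affine s)
    show "?b t = 1" if "\<bar>t\<bar> \<le> 1" for t using that s(3) by simp
    show "?b t = 0" if "\<bar>t\<bar> \<ge> 2" for t using that s(2) by (cases "t \<ge> 0") auto
    show "0 \<le> ?b t" for t by (simp add: s)
    show "?b t \<le> 1" for t by (intro mult_le_one) (simp_all add: s)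
  qed
qed

text \<open>Lindelof's theorem for the cover by one small box around each point. The doubled closed
  box leaves room for a cut-off that is 1 on the small box and vanishes outside the doubled
  one.\<close>

lemma countable_box_cover:
  assumes G: "openin (Euclidean_space n) G" and "G \<noteq> {}"
  obtains a :: "nat \<Rightarrow> nat \<Rightarrow> real" and r :: "nat \<Rightarrow> real" where
    "\<And>j. r j > 0" "\<And>j. cbox_around n (a j) (2 * r j) \<subseteq> G" "G = (\<Union>j. box_around n (a j) (r j))"
proof -
  have "\<exists>r>0. cbox_around n x (2 * r) \<subseteq> G" if "x \<in> G" for x
  proof -
    obtain r where "r > 0" "cbox_around n x r \<subseteq> G" using openin_contains_cbox[OF G \<open>x \<in> G\<close>] .
    then show ?thesis by (intro exI[of _ "r / 2"]) auto
  qed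
  then obtain \<rho> where \<rho>: "\<And>x. x \<in> G \<Longrightarrow> \<rho> x > 0" "\<And>x. x \<in> G \<Longrightarrow> cbox_around n x (2 * \<rho> x) \<subseteq> G"
    by metis
  let ?B = "\<lambda>x. box_around n x (\<rho> x)"
  have in_box: "x \<in> ?B x" if "x \<in> G" for x
    using \<rho>(1)[OF that] that openin_subset[OF G] by (auto simp: box_around_def)
  have box_sub: "?B x \<subseteq> G" if "x \<in> G" for x
  proof -
    have "?B x \<subseteq> cbox_around n x (2 * \<rho> x)"
    proof
      fix y assume y: "y \<in> ?B x"
      have "\<bar>y i - x i\<bar> \<le> 2 * \<rho> x" if "i < n" for i
      proof -
        have "\<bar>y i - x i\<bar> < \<rho> x" using y that by (simp add: box_around_def)
        with \<rho>(1)[OF \<open>x \<in> G\<close>] show ?thesis by linarith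
      qed
      with y show "y \<in> cbox_around n x (2 * \<rho> x)" by (simp add: box_around_def cbox_around_def)
    qed
    also note \<rho>(2)[OF that]
    finally show ?thesis .
  qed
  have "openin (top_of_set (topspace (Euclidean_space n))) S" if "S \<in> ?B ` G" for S
  proof -
    from that have "openin (Euclidean_space n) S" using openin_box_around by blast
    then show ?thesis unfolding openin_Euclidean_space_iff openin_open by (metis Int_commute)
  qed
  from Lindelof_openin[OF this, of "?B ` G"]
  obtain F where F: "F \<subseteq> ?B ` G" "countable F" "\<Union>F = \<Union>(?B ` G)"
    by metis
  then obtain X where X: "countable X" "X \<subseteq> G" "F = ?B ` X"
    using countable_subset_image[of F ?B G] by metis
  have cover: "G = (\<Union>x\<in>X. ?B x)"
  proof -
    have "(\<Union>x\<in>X. ?B x) = (\<Union>x\<in>G. ?B x)" using F(3) X(3) by simp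
    also have "\<dots> = G" using in_box box_sub by (intro equalityI subsetI) auto
    finally show ?thesis ..
  qed
  with assms(2) have "X \<noteq> {}" by auto
  show thesis
  proof (rule that[of "\<lambda>j. \<rho> (from_nat_into X j)" "from_nat_into X"])
    have mem: "from_nat_into X j \<in> G" for j
      using from_nat_into[OF \<open>X \<noteq> {}\<close>] X(2) by blast
    show "\<rho> (from_nat_into X j) > 0" "cbox_around n (from_nat_into X j) (2 * \<rho> (from_nat_into X j)) \<subseteq> G" for j
      using \<rho> mem by blast+
    show "G = (\<Union>j. ?B (from_nat_into X j))"
    proof -
      have "(\<Union>j. ?B (from_nat_into X j)) = (\<Union>x\<in>range (from_nat_into X). ?B x)" by simp
      then show ?thesis using cover unfolding range_from_nat_into[OF \<open>X \<noteq> {}\<close> X(1)] by simp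
    qed
  qed
qed

text \<open>With \<beta> read as probabilities of independent events, the decomposition of "some
  event occurs" according to the first one that does.\<close>

lemma sum_mult_prod_compl:
  fixes \<beta> :: "nat \<Rightarrow> real"
  shows "(\<Sum>j<m. \<beta> j * (\<Prod>l<j. 1 - \<beta> l)) = 1 - (\<Prod>l<m. 1 - \<beta> l)"
  by (induction m) (auto simp: algebra_simps)

lemma has_partials_of_C_on:
  "C_on n (Suc k) G f \<Longrightarrow> has_partials n G f (\<lambda>i. partial i f)"
  by (simp add: C_on_Suc)

text \<open>The cut-offs $\<phi>_j = \<beta>_j \prod_{l<j} (1 - \<beta>_l)$ form a locally finite partition of unity, since
  $\<phi>_j$ vanishes on the $m$-th box for $j > m$.\<close>

lemma global_smooth_approx:
  assumes G: "openin (Euclidean_space n) G"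
    and hp: "has_partials n G h D" and cont: "\<And>i. i < n \<Longrightarrow> continuous_on G (D i)" and \<epsilon>: "\<epsilon> > 0"
  obtains g where "smooth_on n G g"
    "\<And>x. x \<in> G \<Longrightarrow> \<bar>g x - h x\<bar> \<le> \<epsilon>"
    "\<And>i x. i < n \<Longrightarrow> x \<in> G \<Longrightarrow> \<bar>partial i g x - D i x\<bar> \<le> \<epsilon>"
proof (cases "G = {}")
  case True
  show thesis by (rule that[of h]) (simp_all add: True smooth_on_def C_on_def)
next
  case False
  obtain a r where r: "\<And>j. r j > 0" and sub: "\<And>j. cbox_around n (a j) (2 * r j) \<subseteq> G"
    and cover: "G = (\<Union>j::nat. box_around n (a j) (r j))"
    by (rule countable_box_cover[OF G False]) (rule that)
  let ?U = "\<lambda>m. box_around n (a m) (r m)" and ?K = "\<lambda>j. cbox_around n (a j) (2 * r j)"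
  have U_sub: "?U m \<subseteq> G" for m using cover by blast
  have U_open: "openin (Euclidean_space n) (?U m)" for m by (rule openin_box_around)
  have GE: "G \<subseteq> topspace (Euclidean_space n)" using openin_subset[OF G] .
  obtain b :: "real \<Rightarrow> real" where b: "\<And>k. diff_times k b" "\<And>t. \<bar>t\<bar> \<le> 1 \<Longrightarrow> b t = 1"
    "\<And>t. \<bar>t\<bar> \<ge> 2 \<Longrightarrow> b t = 0" "\<And>t. 0 \<le> b t" "\<And>t. b t \<le> 1"
    using plateau_exists by blast
  define \<beta> where "\<beta> j x = (\<Prod>i<n. b (1 / r j * x i + (- a j i / r j)))" for j and x :: "nat \<Rightarrow> real"
  have scale: "1 / r j * t + (- a j i / r j) = (t - a j i) / r j" for j i t
    by (simp add: diff_divide_distrib)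
  have \<beta>_01: "0 \<le> \<beta> j x" "\<beta> j x \<le> 1" for j x
    unfolding \<beta>_def by (auto intro!: prod_nonneg prod_le_1 b)
  have \<beta>_1: "\<beta> j x = 1" if "x \<in> ?U j" for j x
    unfolding \<beta>_def scale
  proof (intro prod.neutral ballI b(2))
    fix i assume "i \<in> {..<n}"
    then have "\<bar>x i - a j i\<bar> < r j" using that by (simp add: box_around_def)
    then show "\<bar>(x i - a j i) / r j\<bar> \<le> 1" using r[of j] by (simp add: abs_divide)
  qed
  have \<beta>_0: "\<beta> j x = 0" if x: "x \<in> G" "x \<notin> ?K j" for j x
  proof -
    obtain i where i: "i < n" "\<bar>x i - a j i\<bar> > 2 * r j"
      using x GE by (auto simp: cbox_around_def not_le)
    then have "\<bar>(x i - a j i) / r j\<bar> \<ge> 2" using r[of j] by (simp add: abs_divide field_simps)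
    then have "b ((x i - a j i) / r j) = 0" by (rule b(3))
    with i(1) show ?thesis
      unfolding \<beta>_def scale by (intro prod_zero bexI[of _ i]) auto
  qed
  have \<beta>_smooth: "C_on n k G (\<beta> j)" for k j
    unfolding \<beta>_def
    by (intro C_on_prod[OF G] C_on_coordinate[OF G, where s = "\<lambda>t. b (1 / r j * t + c)" for c]
          diff_times_affine b)
  define \<phi> where "\<phi> j x = \<beta> j x * (\<Prod>l<j. 1 + (-1) * \<beta> l x)" for j x
  have \<phi>_smooth: "C_on n k G (\<phi> j)" for k j
    unfolding \<phi>_def
    by (intro C_on_mult[OF G] C_on_prod[OF G] C_on_add[OF G] C_on_const[OF G] \<beta>_smooth)
  have \<phi>_nonneg: "0 \<le> \<phi> j x" for j x
    unfolding \<phi>_def using \<beta>_01 by (auto intro!: mult_nonneg_nonneg prod_nonneg)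
  have \<phi>_0: "\<phi> j x = 0" if "x \<in> G" "x \<notin> ?K j" for j x
    using \<beta>_0[OF that] by (simp add: \<phi>_def)
  have \<phi>_late: "\<phi> j x = 0" if "x \<in> ?U m" "m < j" for j m x
    unfolding \<phi>_def using \<beta>_1[OF that(1)] that(2) by (auto intro!: prod_zero bexI[of _ m])
  have \<phi>_sum: "(\<Sum>j<Suc m. \<phi> j x) = 1" if "x \<in> ?U m" for m x
    unfolding \<phi>_def using sum_mult_prod_compl[of "\<lambda>j. \<beta> j x" "Suc m"] \<beta>_1[OF that] by simp
  have \<phi>_hp: "has_partials n G (\<phi> j) (\<lambda>i. partial i (\<phi> j))" for j
    by (rule has_partials_of_C_on[OF \<phi>_smooth[of 1, unfolded One_nat_def]])
  \<comment> \<open>The doubled box is compact, hence closed, so \<phi> j vanishes identically near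
    x within G.\<close>
  have \<phi>'_0: "partial i (\<phi> j) x = 0" if x: "x \<in> G" "x \<notin> ?K j" and i: "i < n" for i j x
  proof -
    have "openin (Euclidean_space n) (G - ?K j)"
    proof (rule openin_diff[OF G])
      show "closedin (Euclidean_space n) (?K j)"
        using compact_imp_closed[OF compact_cbox_around[of n "a j" "2 * r j"]]
        by (auto simp: closedin_Euclidean_space_iff cbox_around_def)
    qed
    then have "has_partials n (G - ?K j) (\<phi> j) (\<lambda>_ _. 0)"
      by (rule has_partials_cong[OF _ _ has_partials_const[where a = 0]]) (use \<phi>_0 in auto)
    from partial_eq[OF this i] x show ?thesis by simp
  qed
  have "\<exists>A\<ge>0. \<forall>i<n. \<forall>x\<in>?K j. \<bar>partial i (\<phi> j) x\<bar> \<le> A" for j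
  proof -
    have "\<exists>A. \<forall>x\<in>?K j. \<bar>partial i (\<phi> j) x\<bar> \<le> A" if "i < n" for i
    proof -
      have "continuous_on G (partial i (\<phi> j))"
        using \<phi>_smooth[of 1 j] that by (simp add: C_on_Suc C_on_0)
      then have "bounded (partial i (\<phi> j) ` ?K j)"
        by (intro compact_imp_bounded compact_continuous_image compact_cbox_around)
           (rule continuous_on_subset[OF _ sub])
      then show ?thesis unfolding bounded_iff by (metis imageI real_norm_def)
    qed
    then obtain A where A: "\<And>i x. i < n \<Longrightarrow> x \<in> ?K j \<Longrightarrow> \<bar>partial i (\<phi> j) x\<bar> \<le> A i" by metis
    have "\<bar>partial i (\<phi> j) x\<bar> \<le> (\<Sum>i<n. \<bar>A i\<bar>)" if "i < n" "x \<in> ?K j" for i x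
      using A[OF that] member_le_sum[of i "{..<n}" "\<lambda>i. \<bar>A i\<bar>"] that(1) by fastforce
    then show ?thesis by (intro exI[of _ "\<Sum>i<n. \<bar>A i\<bar>"]) (auto intro!: sum_nonneg)
  qed
  then obtain A where A: "\<And>j. A j \<ge> 0" "\<And>i j x. i < n \<Longrightarrow> x \<in> ?K j \<Longrightarrow> \<bar>partial i (\<phi> j) x\<bar> \<le> A j"
    by metis
  \<comment> \<open>Half of \<epsilon> pays for the gradients of the cut-offs: A j * \<delta> j is
    at most \<epsilon>/2 times (1/2)^(j+1), which is summable. The other half bounds the averaged
    gradient error. The 1 in the denominator covers A j = 0.\<close>
  define \<delta> where "\<delta> j = \<epsilon> / 2 * (1 / 2) ^ Suc j / (1 + A j)" for j
  have \<delta>: "\<delta> j > 0" for j using A(1)[of j] \<epsilon> by (simp add: \<delta>_def)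
  have \<delta>_le: "\<delta> j \<le> \<epsilon> / 2" for j
  proof -
    have "(1 / 2 :: real) ^ Suc j \<le> 1" by (rule power_le_one) auto
    then have "\<epsilon> / 2 * (1 / 2) ^ Suc j \<le> \<epsilon> / 2 * (1 + A j)"
      using \<epsilon> A(1)[of j] by (intro mult_left_mono) auto
    moreover have "0 < 1 + A j" using A(1)[of j] by linarith
    ultimately show ?thesis unfolding \<delta>_def by (meson pos_divide_le_eq)
  qed
  have A\<delta>: "A j * \<delta> j \<le> \<epsilon> / 2 * (1 / 2) ^ Suc j" for j
  proof -
    have "A j * (\<epsilon> / 2 * (1 / 2) ^ Suc j) \<le> (\<epsilon> / 2 * (1 / 2) ^ Suc j) * (1 + A j)"
      using \<epsilon> by (simp add: algebra_simps)
    moreover have "0 < 1 + A j" using A(1)[of j] by linarith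
    ultimately show ?thesis unfolding \<delta>_def times_divide_eq_right by (meson pos_divide_le_eq)
  qed
  have "\<exists>P. (\<forall>k. C_on n k G P) \<and> (\<forall>x\<in>?K j. \<bar>P x - h x\<bar> \<le> \<delta> j)
      \<and> (\<forall>i<n. \<forall>x\<in>?K j. \<bar>partial i P x - D i x\<bar> \<le> \<delta> j)" for j
    using local_smooth_approx[OF G sub _ hp cont \<delta>[of j], of j] r[of j] by (metis mult_pos_pos zero_less_numeral)
  then obtain P where P: "\<And>j k. C_on n k G (P j)" "\<And>j x. x \<in> ?K j \<Longrightarrow> \<bar>P j x - h x\<bar> \<le> \<delta> j"
      "\<And>j i x. i < n \<Longrightarrow> x \<in> ?K j \<Longrightarrow> \<bar>partial i (P j) x - D i x\<bar> \<le> \<delta> j"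
    by metis
  define S where "S m x = (\<Sum>j<Suc m. \<phi> j x * P j x)" for m x
  \<comment> \<open>On box m every term of index above m vanishes, so the partial sum up to any such
    m gives the same value. Choosing the least m stands in for the infinite sum, and on each box g
    is a fixed finite sum.\<close>
  define J where "J x = (LEAST m. x \<in> ?U m)" for x
  define g where "g x = S (J x) x" for x
  have g_eq: "g x = S m x" if "x \<in> ?U m" for m x
  proof -
    have J: "x \<in> ?U (J x)" "J x \<le> m"
      unfolding J_def using that by (auto intro: LeastI Least_le)
    show ?thesis
      unfolding g_def S_def using J \<phi>_late[OF J(1)]
      by (intro sum.mono_neutral_left) auto
  qed
  have S_smooth: "C_on n k G (S m)" for k m
    unfolding S_def by (intro C_on_sum[OF G] C_on_mult[OF G] \<phi>_smooth P)
  have P_hp: "has_partials n G (P j) (\<lambda>i. partial i (P j))" for j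
    by (rule has_partials_of_C_on[OF P(1)[of 1, unfolded One_nat_def]])
  have smooth: "smooth_on n G g"
      unfolding smooth_on_def
    proof (intro allI C_on_local[OF G])
      fix k x assume "x \<in> G"
      then obtain m where m: "x \<in> ?U m" using cover by blast
      have "C_on n k (?U m) g"
        by (rule C_on_cong[OF U_open g_eq[symmetric] C_on_subset[OF S_smooth U_sub]])
      with m U_open U_sub show "\<exists>U. openin (Euclidean_space n) U \<and> x \<in> U \<and> U \<subseteq> G \<and> C_on n k U g"
        by blast
    qed
  have err0: "\<bar>g x - h x\<bar> \<le> \<epsilon>" if x: "x \<in> G" for x
  proof -
    obtain m where m: "x \<in> ?U m" using x cover by blast
    note one = \<phi>_sum[OF m]
    have h_err: "\<bar>\<phi> j x * (P j x - h x)\<bar> \<le> \<phi> j x * \<epsilon>" for j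
    proof (cases "x \<in> ?K j")
      case True
      then have "\<bar>P j x - h x\<bar> \<le> \<epsilon>" using P(2)[OF True] \<delta>_le[of j] \<epsilon> by linarith
      with \<phi>_nonneg[of j x] show ?thesis by (simp add: abs_mult mult_left_mono)
    qed (use \<phi>_0[OF x] in simp)
    have "g x - h x = (\<Sum>j<Suc m. \<phi> j x * P j x) - (\<Sum>j<Suc m. \<phi> j x) * h x"
      unfolding one using g_eq[OF m] by (simp add: S_def)
    also have "\<dots> = (\<Sum>j<Suc m. \<phi> j x * (P j x - h x))"
      by (simp only: sum_distrib_right sum_subtractf right_diff_distrib)
    also have "\<bar>\<dots>\<bar> \<le> (\<Sum>j<Suc m. \<bar>\<phi> j x * (P j x - h x)\<bar>)" by (rule sum_abs)
    also have "\<dots> \<le> (\<Sum>j<Suc m. \<phi> j x * \<epsilon>)" by (intro sum_mono h_err)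
    also have "\<dots> = (\<Sum>j<Suc m. \<phi> j x) * \<epsilon>" by (rule sum_distrib_right[symmetric])
    also have "\<dots> = \<epsilon>" by (simp only: one mult_1_left)
    finally show ?thesis .
  qed
  have err1: "\<bar>partial i g x - D i x\<bar> \<le> \<epsilon>" if i: "i < n" and x: "x \<in> G" for i x
  proof -
    obtain m where m: "x \<in> ?U m" using x cover by blast
    note one = \<phi>_sum[OF m]
    have hpS: "has_partials n (?U m) g
        (\<lambda>i x. \<Sum>j<Suc m. partial i (\<phi> j) x * P j x + \<phi> j x * partial i (P j) x)"
    proof (rule has_partials_cong[OF U_open g_eq[symmetric]])
      show "has_partials n (?U m) (S m)
          (\<lambda>i x. \<Sum>j<Suc m. partial i (\<phi> j) x * P j x + \<phi> j x * partial i (P j) x)"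
        unfolding S_def
        by (intro has_partials_sum has_partials_mult has_partials_subset[OF \<phi>_hp U_sub]
              has_partials_subset[OF P_hp U_sub])
    qed
    \<comment> \<open>The derivative of the sum of the cut-offs is computed twice, termwise and as
      that of the constant 1 on the open box.\<close>
    have "has_partials n (?U m) (\<lambda>x. \<Sum>j<Suc m. \<phi> j x) (\<lambda>i x. \<Sum>j<Suc m. partial i (\<phi> j) x)"
      by (intro has_partials_sum has_partials_subset[OF \<phi>_hp U_sub])
    then have "partial i (\<lambda>x. \<Sum>j<Suc m. \<phi> j x) x = (\<Sum>j<Suc m. partial i (\<phi> j) x)"
      using i m by (rule partial_eq)
    moreover have "has_partials n (?U m) (\<lambda>x. \<Sum>j<Suc m. \<phi> j x) (\<lambda>_ _. 0)"
      by (rule has_partials_cong[OF U_open _ has_partials_const[where a = 1]]) (rule \<phi>_sum[symmetric])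
    then have "partial i (\<lambda>x. \<Sum>j<Suc m. \<phi> j x) x = 0"
      using i m by (rule partial_eq)
    ultimately have zero: "(\<Sum>j<Suc m. partial i (\<phi> j) x) = 0" by simp
    have err: "\<bar>partial i (\<phi> j) x * (P j x - h x) + \<phi> j x * (partial i (P j) x - D i x)\<bar>
        \<le> \<epsilon> / 2 * (1 / 2) ^ Suc j + \<phi> j x * (\<epsilon> / 2)" for j
    proof (cases "x \<in> ?K j")
      case True
      have "\<bar>partial i (\<phi> j) x * (P j x - h x)\<bar> \<le> A j * \<delta> j"
        unfolding abs_mult using A(1) by (intro mult_mono A(2) P(2) i True) auto
      moreover have "\<bar>\<phi> j x * (partial i (P j) x - D i x)\<bar> \<le> \<phi> j x * (\<epsilon> / 2)"
        unfolding abs_mult using P(3)[OF i True] \<delta>_le[of j] \<phi>_nonneg[of j x]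
        by (intro mult_mono) auto
      ultimately show ?thesis using A\<delta>[of j] by linarith
    next
      case False
      then show ?thesis using \<phi>_0[OF x] \<phi>'_0[OF x _ i] \<epsilon> by simp
    qed
    have geo: "(\<Sum>j<Suc m. (1 / 2 :: real) ^ Suc j) \<le> 1"
    proof -
      have "(\<Sum>j<k. (1 / 2 :: real) ^ Suc j) = 1 - (1 / 2) ^ k" for k
        by (induction k) simp_all
      then show ?thesis by simp
    qed
    have "partial i g x - D i x
        = (\<Sum>j<Suc m. partial i (\<phi> j) x * P j x + \<phi> j x * partial i (P j) x)
          - (\<Sum>j<Suc m. partial i (\<phi> j) x) * h x - (\<Sum>j<Suc m. \<phi> j x) * D i x"
      unfolding zero one using partial_eq[OF hpS i m] by simp
    also have "\<dots> = (\<Sum>j<Suc m. partial i (\<phi> j) x * (P j x - h x) + \<phi> j x * (partial i (P j) x - D i x))"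
      unfolding sum_distrib_right sum_subtractf[symmetric]
      by (intro sum.cong refl) (simp add: ring_distribs)
    finally have eq: "partial i g x - D i x
        = (\<Sum>j<Suc m. partial i (\<phi> j) x * (P j x - h x) + \<phi> j x * (partial i (P j) x - D i x))" .
    have "\<bar>partial i g x - D i x\<bar> \<le> (\<Sum>j<Suc m. \<bar>partial i (\<phi> j) x * (P j x - h x)
        + \<phi> j x * (partial i (P j) x - D i x)\<bar>)"
      unfolding eq by (rule sum_abs)
    also have "\<dots> \<le> (\<Sum>j<Suc m. \<epsilon> / 2 * (1 / 2) ^ Suc j + \<phi> j x * (\<epsilon> / 2))"
      by (intro sum_mono err)
    finally have bound: "\<bar>partial i g x - D i x\<bar>
        \<le> (\<Sum>j<Suc m. \<epsilon> / 2 * (1 / 2) ^ Suc j + \<phi> j x * (\<epsilon> / 2))" .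
    have "(\<Sum>j<Suc m. \<phi> j x * (\<epsilon> / 2)) = (\<Sum>j<Suc m. \<phi> j x) * (\<epsilon> / 2)"
      by (rule sum_distrib_right[symmetric])
    then have "(\<Sum>j<Suc m. \<phi> j x * (\<epsilon> / 2)) = \<epsilon> / 2" by (simp only: one mult_1_left)
    moreover have "(\<Sum>j<Suc m. \<epsilon> / 2 * (1 / 2) ^ Suc j) = \<epsilon> / 2 * (\<Sum>j<Suc m. (1 / 2) ^ Suc j)"
      by (rule sum_distrib_left[symmetric])
    moreover have "\<epsilon> / 2 * (\<Sum>j<Suc m. (1 / 2) ^ Suc j) \<le> \<epsilon> / 2 * 1"
      using geo \<epsilon> by (intro mult_left_mono) auto
    ultimately show ?thesis using bound unfolding sum.distrib by linarith
  qed
  show thesis by (rule that[OF smooth err0 err1])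
qed

section \<open>Poincare inequalities for $C^1$ functions\<close>

lemma borel_measurable_continuous_on_prob:
  assumes "borel_prob_on G \<mu>" "continuous_on G f"
  shows "f \<in> borel_measurable \<mu>"
proof -
  have "f \<in> borel_measurable (restrict_space borel G)"
    using assms(2) by (rule borel_measurable_continuous_on_restrict)
  moreover have "sets \<mu> = sets (restrict_space borel G)"
    using assms(1) by (simp add: borel_prob_on_def)
  ultimately show ?thesis using measurable_cong_sets by blast
qed

lemma enorm_gradient_sq: "(enorm n (gradient g x))\<^sup>2 = (\<Sum>i<n. (partial i g x)\<^sup>2)"
  by (simp add: enorm_def L2_set_def gradient_def sum_nonneg)

text \<open>The second moment and the squared mean each move by at most \<epsilon> (2B + 1), since
  |a^2 - b^2| = |a - b| |a + b| with one of the two numbers bounded by B and the other by B +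
  1.\<close>

lemma Var_perturb:
  assumes "prob_space M" and [measurable]: "g \<in> borel_measurable M" "h \<in> borel_measurable M"
    and bd: "\<And>x. x \<in> space M \<Longrightarrow> \<bar>h x\<bar> \<le> B" and close: "\<And>x. x \<in> space M \<Longrightarrow> \<bar>g x - h x\<bar> \<le> \<epsilon>"
    and \<epsilon>: "0 \<le> \<epsilon>" "\<epsilon> \<le> 1" and B: "0 \<le> B"
  shows "Var M h \<le> Var M g + \<epsilon> * (4 * B + 2)"
proof -
  interpret prob_space M by fact
  have sq: "a\<^sup>2 \<le> b\<^sup>2 + \<epsilon> * (2 * B + 1)" if "\<bar>a - b\<bar> \<le> \<epsilon>" "\<bar>a\<bar> \<le> B \<or> \<bar>b\<bar> \<le> B" for a b :: real
  proof -
    have "\<bar>a\<bar> + \<bar>b\<bar> \<le> 2 * B + 1" using that \<epsilon> by linarith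
    then have "\<bar>a + b\<bar> \<le> 2 * B + 1" by linarith
    then have "\<bar>a - b\<bar> * \<bar>a + b\<bar> \<le> \<epsilon> * (2 * B + 1)"
      using that(1) \<epsilon> by (intro mult_mono) auto
    moreover have "a\<^sup>2 - b\<^sup>2 = (a - b) * (a + b)" by (simp add: power2_eq_square algebra_simps)
    ultimately show ?thesis by (metis abs_mult abs_ge_self add.commute diff_le_eq order_trans)
  qed
  have gB: "\<bar>g x\<bar> \<le> B + 1" if "x \<in> space M" for x
    using bd[OF that] close[OF that] \<epsilon> by linarith
  have int: "integrable M h" "integrable M g"
    by (rule integrable_const_bound[of _ B] integrable_const_bound[of _ "B + 1"]; use bd gB in auto)+
  have int2: "integrable M (\<lambda>x. (h x)\<^sup>2)" "integrable M (\<lambda>x. (g x)\<^sup>2)"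
    by (rule integrable_const_bound[of _ "B\<^sup>2"] integrable_const_bound[of _ "(B + 1)\<^sup>2"];
        use bd gB in \<open>auto simp: abs_le_square_iff[symmetric]\<close>; fastforce)+
  have "(\<integral>x. (h x)\<^sup>2 \<partial>M) \<le> (\<integral>x. (g x)\<^sup>2 + \<epsilon> * (2 * B + 1) \<partial>M)"
    using bd close by (intro integral_mono int2 Bochner_Integration.integrable_add sq)
      (auto simp: abs_minus_commute)
  then have 1: "(\<integral>x. (h x)\<^sup>2 \<partial>M) \<le> (\<integral>x. (g x)\<^sup>2 \<partial>M) + \<epsilon> * (2 * B + 1)"
    using int2 by (simp add: prob_space)
  have "\<bar>\<integral>x. h x \<partial>M\<bar> \<le> B"
  proof -
    have "\<bar>\<integral>x. h x \<partial>M\<bar> \<le> (\<integral>x. \<bar>h x\<bar> \<partial>M)" by (rule integral_abs_bound)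
    also have "\<dots> \<le> (\<integral>x. B \<partial>M)" using bd int by (intro integral_mono) auto
    finally show ?thesis by (simp add: prob_space)
  qed
  moreover have "\<bar>(\<integral>x. g x \<partial>M) - (\<integral>x. h x \<partial>M)\<bar> \<le> \<epsilon>"
  proof -
    have "(\<integral>x. g x \<partial>M) - (\<integral>x. h x \<partial>M) = (\<integral>x. g x - h x \<partial>M)" using int by simp
    also have "\<bar>\<dots>\<bar> \<le> (\<integral>x. \<bar>g x - h x\<bar> \<partial>M)" by (rule integral_abs_bound)
    also have "\<dots> \<le> (\<integral>x. \<epsilon> \<partial>M)" using close int by (intro integral_mono) auto
    finally show ?thesis by (simp add: prob_space)
  qed
  ultimately have "(\<integral>x. g x \<partial>M)\<^sup>2 \<le> (\<integral>x. h x \<partial>M)\<^sup>2 + \<epsilon> * (2 * B + 1)" by (intro sq) auto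
  with 1 show ?thesis unfolding Var_def by (simp add: algebra_simps)
qed

text \<open>A smooth g uniformly close to the bounded h is bounded itself, so the assumed inequality
  applies to g. Uniform errors in function and gradient integrate to errors of order \<epsilon>
  because \<mu> has total mass 1.\<close>

lemma Poincare_ineq_C1:
  assumes G: "openin (Euclidean_space n) G" and \<mu>: "borel_prob_on G \<mu>"
    and P: "Poincare_ineq n G \<mu> C" and C: "C > 0"
    and cont: "continuous_on G h" and hp: "has_partials n G h D"
    and contD: "\<And>i. i < n \<Longrightarrow> continuous_on G (D i)" and bd: "bounded (h ` G)"
  shows "ennreal (Var \<mu> h) \<le> ennreal C * (\<integral>\<^sup>+x. ennreal (\<Sum>i<n. (D i x)\<^sup>2) \<partial>\<mu>)"
proof (cases "(\<integral>\<^sup>+x. ennreal (\<Sum>i<n. (D i x)\<^sup>2) \<partial>\<mu>) = \<infinity>")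
  case True
  with C show ?thesis by (simp add: ennreal_mult_top)
next
  case False
  interpret prob_space \<mu> using \<mu> by (simp add: borel_prob_on_def)
  have sp: "space \<mu> = G" using \<mu> by (simp add: borel_prob_on_def)
  define I where "I = enn2real (\<integral>\<^sup>+x. ennreal (\<Sum>i<n. (D i x)\<^sup>2) \<partial>\<mu>)"
  have I: "(\<integral>\<^sup>+x. ennreal (\<Sum>i<n. (D i x)\<^sup>2) \<partial>\<mu>) = ennreal I" "I \<ge> 0"
    using False by (simp_all add: I_def less_top)
  have [measurable]: "h \<in> borel_measurable \<mu>" "i < n \<Longrightarrow> D i \<in> borel_measurable \<mu>" for i
    by (intro borel_measurable_continuous_on_prob[OF \<mu>] cont contD; assumption)+
  obtain B where B: "\<And>x. x \<in> G \<Longrightarrow> \<bar>h x\<bar> \<le> B" "B \<ge> 0"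
    using bd unfolding bounded_pos by (auto intro: less_imp_le)
  \<comment> \<open>The coefficient of \<epsilon>: 4B + 2 from the variance and C (I + 2n) from the
    gradient.\<close>
  define K where "K = (4 * B + 2) + C * (I + 2 * real n)"
  have K: "K > 0" using B(2) C I(2) by (simp add: K_def add_pos_nonneg)
  have step: "Var \<mu> h \<le> C * I + \<epsilon> * K" if \<epsilon>: "0 < \<epsilon>" "\<epsilon> \<le> 1" for \<epsilon>
  proof -
    obtain g where g: "smooth_on n G g" "\<And>x. x \<in> G \<Longrightarrow> \<bar>g x - h x\<bar> \<le> \<epsilon>"
      "\<And>i x. i < n \<Longrightarrow> x \<in> G \<Longrightarrow> \<bar>partial i g x - D i x\<bar> \<le> \<epsilon>"
      using global_smooth_approx[OF G hp contD \<epsilon>(1)] by metis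
    have gc: "continuous_on G g" using g(1) C_on_continuous unfolding smooth_on_def by blast
    then have [measurable]: "g \<in> borel_measurable \<mu>" by (rule borel_measurable_continuous_on_prob[OF \<mu>])
    have "\<bar>g x\<bar> \<le> B + 1" if "x \<in> G" for x
      using B(1)[OF that] g(2)[OF that] \<epsilon> by linarith
    then have "bounded (g ` G)" unfolding bounded_iff by auto
    with P g(1) have Pg: "ennreal (Var \<mu> g) \<le> ennreal C * (\<integral>\<^sup>+x. ennreal ((enorm n (gradient g x))\<^sup>2) \<partial>\<mu>)"
      unfolding Poincare_ineq_def by blast
    have "(\<integral>\<^sup>+x. ennreal ((enorm n (gradient g x))\<^sup>2) \<partial>\<mu>)
        \<le> (\<integral>\<^sup>+x. ennreal ((1 + \<epsilon>) * (\<Sum>i<n. (D i x)\<^sup>2) + 2 * \<epsilon> * real n) \<partial>\<mu>)"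
    proof (intro nn_integral_mono ennreal_leI)
      fix x assume "x \<in> space \<mu>"
      then have x: "x \<in> G" by (simp add: sp)
      have "(enorm n (gradient g x))\<^sup>2 \<le> (\<Sum>i<n. (1 + \<epsilon>) * (D i x)\<^sup>2 + 2 * \<epsilon>)"
        unfolding enorm_gradient_sq
      proof (rule sum_mono)
        fix i assume "i \<in> {..<n}"
        then have "\<bar>partial i g x - D i x\<bar> \<le> \<epsilon>" using g(3) x by simp
        then have "\<bar>partial i g x\<bar> \<le> \<bar>D i x\<bar> + \<epsilon>" by linarith
        then have "(partial i g x)\<^sup>2 \<le> (\<bar>D i x\<bar> + \<epsilon>)\<^sup>2" by (metis abs_ge_zero power2_abs power_mono)
        also have "\<dots> = (D i x)\<^sup>2 + \<epsilon> * (2 * \<bar>D i x\<bar>) + \<epsilon> * \<epsilon>"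
          by (simp add: power2_sum power2_eq_square algebra_simps)
        \<comment> \<open>The bound 2 |D| \<le> D^2 + 1 removes the cross term, so only the integral
          of the squares is needed.\<close>
        also have "\<dots> \<le> (D i x)\<^sup>2 + \<epsilon> * ((D i x)\<^sup>2 + 1) + \<epsilon> * 1"
        proof (intro add_mono mult_left_mono order_refl)
          show "2 * \<bar>D i x\<bar> \<le> (D i x)\<^sup>2 + 1"
            using zero_le_power2[of "\<bar>D i x\<bar> - 1"] by (simp add: power2_diff)
        qed (use \<epsilon> in auto)
        finally show "(partial i g x)\<^sup>2 \<le> (1 + \<epsilon>) * (D i x)\<^sup>2 + 2 * \<epsilon>" by (simp add: algebra_simps)
      qed
      also have "\<dots> = (1 + \<epsilon>) * (\<Sum>i<n. (D i x)\<^sup>2) + 2 * \<epsilon> * real n"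
        by (simp add: sum.distrib sum_distrib_left)
      finally show "(enorm n (gradient g x))\<^sup>2 \<le> (1 + \<epsilon>) * (\<Sum>i<n. (D i x)\<^sup>2) + 2 * \<epsilon> * real n" .
    qed
    also have "\<dots> = (\<integral>\<^sup>+x. ennreal (1 + \<epsilon>) * ennreal (\<Sum>i<n. (D i x)\<^sup>2) + ennreal (2 * \<epsilon> * real n) \<partial>\<mu>)"
      using \<epsilon> by (intro nn_integral_cong) (simp add: ennreal_plus[symmetric] ennreal_mult[symmetric] sum_nonneg del: ennreal_plus)
    also have "\<dots> = ennreal (1 + \<epsilon>) * ennreal I + ennreal (2 * \<epsilon> * real n)"
      by (subst nn_integral_add) (auto simp: nn_integral_cmult I emeasure_space_1)
    also have "\<dots> = ennreal ((1 + \<epsilon>) * I + 2 * \<epsilon> * real n)"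
      using \<epsilon> I(2) by (simp add: ennreal_plus[symmetric] ennreal_mult[symmetric] del: ennreal_plus)
    finally have "ennreal C * (\<integral>\<^sup>+x. ennreal ((enorm n (gradient g x))\<^sup>2) \<partial>\<mu>)
        \<le> ennreal C * ennreal ((1 + \<epsilon>) * I + 2 * \<epsilon> * real n)"
      by (intro mult_left_mono) auto
    also have "\<dots> = ennreal (C * ((1 + \<epsilon>) * I + 2 * \<epsilon> * real n))"
      using C \<epsilon> I(2) by (simp add: ennreal_mult)
    finally have "ennreal (Var \<mu> g) \<le> ennreal (C * ((1 + \<epsilon>) * I + 2 * \<epsilon> * real n))"
      using Pg by (rule order_trans[rotated])
    then have "Var \<mu> g \<le> C * ((1 + \<epsilon>) * I + 2 * \<epsilon> * real n)"
      using C \<epsilon> I(2) by (subst (asm) ennreal_le_iff) (auto intro!: mult_nonneg_nonneg add_nonneg_nonneg)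
    moreover have "Var \<mu> h \<le> Var \<mu> g + \<epsilon> * (4 * B + 2)"
      by (rule Var_perturb) (use B g(2) \<epsilon> sp prob_space_axioms in auto)
    ultimately show ?thesis by (simp add: K_def algebra_simps)
  qed
  have "Var \<mu> h \<le> C * I"
  proof (rule field_le_epsilon)
    fix e :: real assume e: "e > 0"
    have "Var \<mu> h \<le> C * I + min 1 (e / K) * K" by (rule step) (use e K in auto)
    also have "min 1 (e / K) * K \<le> e / K * K" using K by (intro mult_right_mono) auto
    also have "e / K * K = e" using K by simp
    finally show "Var \<mu> h \<le> C * I + e" by simp
  qed
  then show ?thesis using C I by (simp add: ennreal_mult[symmetric] ennreal_leI)
qed

text \<open>Young's inequality for the exponents q / (q - 1) and q, multiplied by q. For s > 0 it is
  Bernoulli's inequality at t / s, multiplied by s^q.\<close>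

lemma young_power:
  fixes s t :: real
  assumes "s \<ge> 0" "t \<ge> 0" "q \<ge> 1"
  shows "real q * (s ^ (q - 1) * t) \<le> (real q - 1) * s ^ q + t ^ q"
proof (cases "s = 0")
  case True
  with assms show ?thesis by (cases "q = 1") (auto simp: zero_power)
next
  case False
  with assms(1) have s: "s > 0" by simp
  have "1 + real q * (t / s - 1) \<le> (1 + (t / s - 1)) ^ q"
    by (rule Bernoulli_inequality) (use s assms(2) in simp)
  then have "(1 + real q * (t / s - 1)) * s ^ q \<le> (t / s) ^ q * s ^ q"
    using s by (intro mult_right_mono) auto
  also have "(t / s) ^ q * s ^ q = t ^ q" using s by (simp add: power_divide)
  also have "(1 + real q * (t / s - 1)) * s ^ q = (1 - real q) * s ^ q + real q * (t * (s ^ q / s))"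
    by (simp add: algebra_simps)
  also have "s ^ q / s = s ^ (q - 1)" using s assms(3) by (simp add: power_diff)
  finally show ?thesis by (simp add: algebra_simps)
qed

text \<open>The coefficient of X on the right is w = u - u/q < 1, and the remaining constant 1 - u +
  u/q is exactly 1 - w, so X (1 - w) \<le> 1 - w.\<close>

lemma sub_unit_from_young:
  fixes X u :: real
  assumes q: "q \<ge> 1" and u: "0 \<le> u" "u \<le> 1" and X: "X \<le> (1 - u) + u / real q * ((real q - 1) * X + 1)"
  shows "X \<le> 1"
proof -
  define w where "w = u * ((real q - 1) / real q)"
  have frac: "0 \<le> (real q - 1) / real q" "(real q - 1) / real q < 1" using q by auto
  have "w \<le> 1 * ((real q - 1) / real q)"
    unfolding w_def using u frac by (intro mult_right_mono) auto
  with frac have "w < 1" by simp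
  moreover have "X * (1 - w) \<le> 1 * (1 - w)"
  proof -
    have "u / real q * ((real q - 1) * X + 1) = w * X + u / real q"
      using q by (simp add: w_def field_simps)
    moreover have "w = u - u / real q" using q by (simp add: w_def field_simps)
    ultimately have "X \<le> 1 - w + w * X" using X by linarith
    then show ?thesis by (simp add: algebra_simps)
  qed
  ultimately show ?thesis by (simp add: mult_le_cancel_right)
qed

text \<open>The Poincare inequality for $h^q$ bounds $\int h^{2q}$ in terms of $\int h^{2q-2} \<phi>^2$, which Young's
  inequality, scaled by the expected bounds $A$ and $b$, reduces to the moments of order $2q$.\<close>

lemma moment_step:
  assumes G: "openin (Euclidean_space n) G" and \<mu>: "borel_prob_on G \<mu>"
    and P: "Poincare_ineq n G \<mu> (\<sigma>\<^sup>2)" and \<sigma>: "\<sigma> > 0"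
    and cont: "continuous_on G h" and hp: "has_partials n G h D"
    and contD: "\<And>i. i < n \<Longrightarrow> continuous_on G (D i)"
    and h: "\<And>x. x \<in> G \<Longrightarrow> 0 \<le> h x" "\<And>x. x \<in> G \<Longrightarrow> h x \<le> H"
    and \<phi>[measurable]: "\<phi> \<in> borel_measurable \<mu>" and D: "\<And>x. x \<in> G \<Longrightarrow> (\<Sum>i<n. (D i x)\<^sup>2) \<le> (\<phi> x)\<^sup>2"
    and q: "q \<ge> 1" and b: "b > 0" and A: "A > 0" and A0: "A0 \<ge> 0"
    and \<phi>_int: "(\<integral>\<^sup>+x. ennreal (\<phi> x ^ (2 * q)) \<partial>\<mu>) \<le> ennreal (b ^ (2 * q))"
    and h_int: "(\<integral>x. h x ^ q \<partial>\<mu>) \<le> A0 ^ q"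
    and rec: "A0\<^sup>2 + \<sigma>\<^sup>2 * (real q)\<^sup>2 * b\<^sup>2 \<le> A\<^sup>2"
  shows "(\<integral>x. h x ^ (2 * q) \<partial>\<mu>) \<le> A ^ (2 * q)"
proof -
  interpret prob_space \<mu> using \<mu> by (simp add: borel_prob_on_def)
  have sp: "space \<mu> = G" using \<mu> by (simp add: borel_prob_on_def)
  have [measurable]: "h \<in> borel_measurable \<mu>" by (rule borel_measurable_continuous_on_prob[OF \<mu> cont])
  \<comment> \<open>Normalised moments: the claim is X \<le> 1 and the hypothesis on \<phi> is Y
    \<le> 1. Since h is bounded, the integral in X is a genuine finite moment and can later be
    absorbed.\<close>
  define X where "X = (\<integral>x. h x ^ (2 * q) \<partial>\<mu>) / A ^ (2 * q)"
  define Y where "Y = (\<integral>x. \<phi> x ^ (2 * q) \<partial>\<mu>) / b ^ (2 * q)"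
  have int_h: "integrable \<mu> (\<lambda>x. h x ^ m)" for m
    using h sp by (intro integrable_const_bound[of _ "H ^ m"]) (auto intro!: AE_I2 power_mono)
  have \<phi>_nonneg: "0 \<le> \<phi> x ^ (2 * q)" for x by (simp add: zero_le_even_power)
  have int_\<phi>: "integrable \<mu> (\<lambda>x. \<phi> x ^ (2 * q))"
    using \<phi>_int \<phi>_nonneg by (intro integrableI_nonneg) (auto simp: less_top[symmetric] top_unique)
  have Y: "Y \<le> 1"
  proof -
    have "ennreal (\<integral>x. \<phi> x ^ (2 * q) \<partial>\<mu>) \<le> ennreal (b ^ (2 * q))"
      using \<phi>_int \<phi>_nonneg by (subst nn_integral_eq_integral[OF int_\<phi>, symmetric]) auto
    then have "(\<integral>x. \<phi> x ^ (2 * q) \<partial>\<mu>) \<le> b ^ (2 * q)" using b by (simp add: ennreal_le_iff)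
    with b show ?thesis by (simp add: Y_def)
  qed
  \<comment> \<open>Majorant of the squared gradient of h^q: the factor q h^(2q-2) \<phi>^2 is
    rescaled to s = h^2 / A^2 and t = \<phi>^2 / b^2 before \<open>young_power\<close> is
    applied.\<close>
  define R where "R x = real q * A ^ (2 * q - 2) * b\<^sup>2 *
      ((real q - 1) * (h x ^ (2 * q) / A ^ (2 * q)) + \<phi> x ^ (2 * q) / b ^ (2 * q))" for x
  have int_R: "integrable \<mu> R"
    unfolding R_def by (intro integrable_mult_right Bochner_Integration.integrable_add integrable_divide int_h int_\<phi>)
  have R_int: "(\<integral>x. R x \<partial>\<mu>) = real q * A ^ (2 * q - 2) * b\<^sup>2 * ((real q - 1) * X + Y)"
    unfolding R_def X_def Y_def using int_h int_\<phi> by simp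
  have R_nonneg: "0 \<le> R x" if "x \<in> G" for x
    unfolding R_def using q A b h(1)[OF that] \<phi>_nonneg[of x]
    by (intro mult_nonneg_nonneg add_nonneg_nonneg divide_nonneg_nonneg) auto
  have hpq: "has_partials n G (\<lambda>x. h x ^ q) (\<lambda>i x. real q * h x ^ (q - 1) * D i x)"
    by (rule has_partials_chain[OF hp, where T' = "\<lambda>t. real q * t ^ (q - 1)"])
       (auto intro!: derivative_eq_intros)
  have grad: "(\<Sum>i<n. (real q * h x ^ (q - 1) * D i x)\<^sup>2) \<le> R x" if x: "x \<in> G" for x
  proof -
    have "(\<Sum>i<n. (real q * h x ^ (q - 1) * D i x)\<^sup>2) = (real q)\<^sup>2 * (h x ^ (q - 1))\<^sup>2 * (\<Sum>i<n. (D i x)\<^sup>2)"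
      by (simp add: power_mult_distrib sum_distrib_left)
    also have "\<dots> \<le> (real q)\<^sup>2 * (h x ^ (q - 1))\<^sup>2 * (\<phi> x)\<^sup>2"
      using D[OF x] by (intro mult_left_mono) auto
    also have "\<dots> = real q * A ^ (2 * q - 2) * b\<^sup>2 *
        (real q * (((h x)\<^sup>2 / A\<^sup>2) ^ (q - 1) * ((\<phi> x)\<^sup>2 / b\<^sup>2)))"
    proof -
      have "A ^ (2 * q - 2) = (A\<^sup>2) ^ (q - 1)" by (simp add: power_mult[symmetric] right_diff_distrib')
      moreover have "(h x ^ (q - 1))\<^sup>2 = ((h x)\<^sup>2) ^ (q - 1)" by (simp add: power_mult[symmetric] mult.commute)
      ultimately show ?thesis using A b by (simp add: power_divide power2_eq_square)
    qed
    also have "\<dots> \<le> real q * A ^ (2 * q - 2) * b\<^sup>2 *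
        ((real q - 1) * ((h x)\<^sup>2 / A\<^sup>2) ^ q + ((\<phi> x)\<^sup>2 / b\<^sup>2) ^ q)"
      using A b q by (intro mult_left_mono young_power) auto
    also have "\<dots> = R x" by (simp add: R_def power_divide power_mult)
    finally show ?thesis .
  qed
  have "ennreal (Var \<mu> (\<lambda>x. h x ^ q)) \<le> ennreal (\<sigma>\<^sup>2) * (\<integral>\<^sup>+x. ennreal (\<Sum>i<n. (real q * h x ^ (q - 1) * D i x)\<^sup>2) \<partial>\<mu>)"
  proof (rule Poincare_ineq_C1[OF G \<mu> P _ _ hpq])
    show "bounded ((\<lambda>x. h x ^ q) ` G)"
      unfolding bounded_iff using h by (auto intro!: exI[of _ "H ^ q"] power_mono)
  qed (use \<sigma> in \<open>auto intro!: continuous_intros cont contD\<close>)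
  also have "\<dots> \<le> ennreal (\<sigma>\<^sup>2) * (\<integral>\<^sup>+x. ennreal (R x) \<partial>\<mu>)"
    using grad sp by (intro mult_left_mono nn_integral_mono ennreal_leI) auto
  also have "(\<integral>\<^sup>+x. ennreal (R x) \<partial>\<mu>) = ennreal (\<integral>x. R x \<partial>\<mu>)"
    using int_R R_nonneg sp by (intro nn_integral_eq_integral) auto
  also have "ennreal (\<sigma>\<^sup>2) * ennreal (\<integral>x. R x \<partial>\<mu>) = ennreal (\<sigma>\<^sup>2 * (\<integral>x. R x \<partial>\<mu>))"
    using R_nonneg sp by (intro ennreal_mult[symmetric] integral_nonneg_AE) auto
  finally have "Var \<mu> (\<lambda>x. h x ^ q) \<le> \<sigma>\<^sup>2 * (\<integral>x. R x \<partial>\<mu>)"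
    using R_nonneg sp
    by (subst (asm) ennreal_le_iff) (auto intro!: mult_nonneg_nonneg integral_nonneg_AE)
  moreover have "(\<integral>x. h x ^ q \<partial>\<mu>)\<^sup>2 \<le> (A0 ^ q)\<^sup>2"
    using h_int h sp by (intro power_mono integral_nonneg_AE) auto
  moreover have "(\<lambda>x. (h x ^ q)\<^sup>2) = (\<lambda>x. h x ^ (2 * q))"
    by (simp add: power_mult[symmetric] mult.commute)
  ultimately have main: "X * A ^ (2 * q)
      \<le> (A0\<^sup>2) ^ q + \<sigma>\<^sup>2 * (real q * A ^ (2 * q - 2) * b\<^sup>2 * ((real q - 1) * X + Y))"
    using A by (simp add: Var_def R_int X_def power_mult[symmetric] mult.commute)
  \<comment> \<open>The share of A^2 taken by the gradient term; by \<open>rec\<close> the share of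
    A0^2 is at most 1 - u.\<close>
  define u where "u = \<sigma>\<^sup>2 * (real q)\<^sup>2 * b\<^sup>2 / A\<^sup>2"
  have u: "A0\<^sup>2 / A\<^sup>2 \<le> 1 - u" "0 \<le> u" "u \<le> 1"
  proof -
    have "A0\<^sup>2 / A\<^sup>2 + u = (A0\<^sup>2 + \<sigma>\<^sup>2 * (real q)\<^sup>2 * b\<^sup>2) / A\<^sup>2" by (simp add: u_def add_divide_distrib)
    also have "\<dots> \<le> 1" using rec A by simp
    finally show "A0\<^sup>2 / A\<^sup>2 \<le> 1 - u" by simp
    moreover have "0 \<le> A0\<^sup>2 / A\<^sup>2" by simp
    ultimately show "u \<le> 1" by linarith
    show "0 \<le> u" by (simp add: u_def)
  qed
  have A2: "A ^ (2 * q) = (A\<^sup>2) ^ q" by (simp add: power_mult)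
  have A2': "A ^ (2 * q) = A ^ (2 * q - 2) * A\<^sup>2"
  proof -
    have "2 * q = 2 * q - 2 + 2" using q by simp
    then show ?thesis by (metis power_add)
  qed
  have "X = X * A ^ (2 * q) / A ^ (2 * q)" using A by simp
  also have "\<dots> \<le> ((A0\<^sup>2) ^ q + \<sigma>\<^sup>2 * (real q * A ^ (2 * q - 2) * b\<^sup>2 * ((real q - 1) * X + Y))) / A ^ (2 * q)"
    using A by (intro divide_right_mono main) auto
  also have "\<dots> = (A0\<^sup>2 / A\<^sup>2) ^ q + u / real q * ((real q - 1) * X + Y)"
  proof -
    have "(A0\<^sup>2) ^ q / A ^ (2 * q) = (A0\<^sup>2 / A\<^sup>2) ^ q" unfolding A2 by (simp add: power_divide)
    moreover have "\<sigma>\<^sup>2 * (real q * A ^ (2 * q - 2) * b\<^sup>2 * ((real q - 1) * X + Y)) / A ^ (2 * q)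
        = u / real q * ((real q - 1) * X + Y)"
      unfolding A2' u_def using A q by (simp add: power2_eq_square)
    ultimately show ?thesis by (simp add: add_divide_distrib)
  qed
  also have "\<dots> \<le> (1 - u) + u / real q * ((real q - 1) * X + 1)"
  proof (rule add_mono)
    have "(A0\<^sup>2 / A\<^sup>2) ^ q \<le> (1 - u) ^ q" using u by (intro power_mono) auto
    \<comment> \<open>Lossy for q > 1, but the absorption lemma needs a bound linear in u.\<close>
    also have "\<dots> \<le> (1 - u) ^ 1" using u q by (intro power_decreasing) auto
    finally show "(A0\<^sup>2 / A\<^sup>2) ^ q \<le> 1 - u" by simp
    show "u / real q * ((real q - 1) * X + Y) \<le> u / real q * ((real q - 1) * X + 1)"
      using u q Y by (intro mult_left_mono) auto
  qed
  finally have "X \<le> 1" by (rule sub_unit_from_young[OF q u(2,3)])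
  then show ?thesis using A by (simp add: X_def)
qed

text \<open>As h is merely integrable, the bounded case is applied to T_N(h) with T_N(t) = t / (1 +
  t^2 / (N + 1)), which is C^1, bounded, and satisfies |T_N'| \<le> 1, so gradients do not grow. The
  means of T_N(h) tend to 0 by dominated convergence with majorant |h|, and Fatou's lemma gives the
  claim without prior square integrability of h.\<close>

lemma Poincare_ineq_mean_zero:
  assumes G: "openin (Euclidean_space n) G" and \<mu>: "borel_prob_on G \<mu>"
    and P: "Poincare_ineq n G \<mu> C" and C: "C > 0"
    and cont: "continuous_on G h" and hp: "has_partials n G h D"
    and contD: "\<And>i. i < n \<Longrightarrow> continuous_on G (D i)" and mean: "has_bochner_integral \<mu> h 0"
  shows "(\<integral>\<^sup>+x. ennreal ((h x)\<^sup>2) \<partial>\<mu>) \<le> ennreal C * (\<integral>\<^sup>+x. ennreal (\<Sum>i<n. (D i x)\<^sup>2) \<partial>\<mu>)"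
proof -
  interpret prob_space \<mu> using \<mu> by (simp add: borel_prob_on_def)
  have [measurable]: "h \<in> borel_measurable \<mu>" by (rule borel_measurable_continuous_on_prob[OF \<mu> cont])
  let ?R = "ennreal C * (\<integral>\<^sup>+x. ennreal (\<Sum>i<n. (D i x)\<^sup>2) \<partial>\<mu>)"
  define c where "c N = 1 / real (Suc N)" for N
  have c: "c N > 0" "c N \<le> 1" for N by (simp_all add: c_def)
  have den: "1 + c N * t\<^sup>2 \<ge> 1" for N t using c(1)[of N] by simp
  define T where "T N t = t / (1 + c N * t\<^sup>2)" for N t
  define T' where "T' N t = (1 - c N * t\<^sup>2) / (1 + c N * t\<^sup>2)\<^sup>2" for N t
  have dT: "(T N has_real_derivative T' N t) (at t)" for N t
    unfolding T_def[abs_def] T'_def using den[of N t]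
    by (auto intro!: derivative_eq_intros simp: power2_eq_square algebra_simps)
  have T'_le: "\<bar>T' N t\<bar> \<le> 1" for N t
  proof -
    have "\<bar>1 - c N * t\<^sup>2\<bar> \<le> 1 + c N * t\<^sup>2" using den[of N t] by linarith
    also have "\<dots> \<le> (1 + c N * t\<^sup>2)\<^sup>2"
      using den[of N t] by (intro self_le_power) auto
    finally show ?thesis unfolding T'_def abs_divide using den[of N t] by (simp add: divide_le_eq_1)
  qed
  have T_le: "\<bar>T N t\<bar> \<le> \<bar>t\<bar>" for N t
    unfolding T_def abs_divide using den[of N t] by (simp add: divide_le_eq mult_le_cancel_left1)
  have T_bd: "\<bar>T N t\<bar> \<le> 1 / c N" for N t
  proof -
    have "\<bar>t\<bar> \<le> 1 + t\<^sup>2"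
      using zero_le_power2[of "\<bar>t\<bar> - 1"] zero_le_power2[of t] by (simp add: power2_diff)
    then have "c N * \<bar>t\<bar> \<le> c N * (1 + t\<^sup>2)" using c(1)[of N] by (intro mult_left_mono) auto
    also have "\<dots> \<le> 1 + c N * t\<^sup>2" using c(2)[of N] by (simp add: algebra_simps)
    finally have "\<bar>t\<bar> \<le> 1 / c N * (1 + c N * t\<^sup>2)" using c(1)[of N] by (simp add: field_simps)
    moreover have "0 < 1 + c N * t\<^sup>2" "\<bar>1 + c N * t\<^sup>2\<bar> = 1 + c N * t\<^sup>2"
      using den[of N t] by linarith+
    ultimately show ?thesis unfolding T_def abs_divide by (metis pos_divide_le_eq)
  qed
  have T_lim: "(\<lambda>N. T N t) \<longlonglongrightarrow> t" for t
  proof -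
    have "(\<lambda>N. c N) \<longlonglongrightarrow> 0" unfolding c_def by (rule LIMSEQ_Suc[OF lim_1_over_n])
    then have "(\<lambda>N. t / (1 + c N * t\<^sup>2)) \<longlonglongrightarrow> t / (1 + 0 * t\<^sup>2)"
      by (intro tendsto_intros) auto
    then show ?thesis by (simp add: T_def)
  qed
  have cT: "continuous_on UNIV (T N)" "continuous_on UNIV (T' N)" for N
    unfolding T_def[abs_def] T'_def[abs_def] using den[of N]
    by (intro continuous_intros; metis add_le_same_cancel1 not_one_le_zero power_eq_0_iff zero_neq_one)+
  have [measurable]: "T N \<in> borel_measurable borel" for N
    using cT(1) by (rule borel_measurable_continuous_onI)
  define e where "e N = (\<integral>x. T N (h x) \<partial>\<mu>)" for N
  have e_lim: "e \<longlonglongrightarrow> 0"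
  proof -
    have "(\<lambda>N. \<integral>x. T N (h x) \<partial>\<mu>) \<longlonglongrightarrow> (\<integral>x. h x \<partial>\<mu>)"
      using mean T_le T_lim
      by (intro integral_dominated_convergence[where w = "\<lambda>x. \<bar>h x\<bar>"])
         (auto intro: integrable_abs simp: has_bochner_integral_iff)
    then show ?thesis using mean by (simp add: e_def[abs_def] has_bochner_integral_iff)
  qed
  have bound: "(\<integral>\<^sup>+x. ennreal ((T N (h x))\<^sup>2) \<partial>\<mu>) \<le> ?R + ennreal ((e N)\<^sup>2)" for N
  proof -
    have "integrable \<mu> (\<lambda>x. (T N (h x))\<^sup>2)"
      using T_bd[of N] c(1)[of N]
      by (intro integrable_const_bound[of _ "(1 / c N)\<^sup>2"]) (auto intro!: abs_le_square_iff[THEN iffD1] simp del: power_divide power_one_over)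
    then have "(\<integral>\<^sup>+x. ennreal ((T N (h x))\<^sup>2) \<partial>\<mu>) = ennreal (\<integral>x. (T N (h x))\<^sup>2 \<partial>\<mu>)"
      by (rule nn_integral_eq_integral) simp
    also have "(\<integral>x. (T N (h x))\<^sup>2 \<partial>\<mu>) = Var \<mu> (\<lambda>x. T N (h x)) + (e N)\<^sup>2"
      by (simp add: Var_def e_def)
    \<comment> \<open>Only an inequality, because \<open>ennreal\<close> sends negative reals to 0
      and the sign of the variance is not at hand.\<close>
    also have "ennreal \<dots> \<le> ennreal (Var \<mu> (\<lambda>x. T N (h x))) + ennreal ((e N)\<^sup>2)"
      by (cases "Var \<mu> (\<lambda>x. T N (h x)) \<ge> 0") (auto simp: ennreal_neg intro!: ennreal_leI)
    also have "ennreal (Var \<mu> (\<lambda>x. T N (h x))) \<le> ?R"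
    proof -
      have "ennreal (Var \<mu> (\<lambda>x. T N (h x)))
          \<le> ennreal C * (\<integral>\<^sup>+x. ennreal (\<Sum>i<n. (T' N (h x) * D i x)\<^sup>2) \<partial>\<mu>)"
      proof (rule Poincare_ineq_C1[OF G \<mu> P C _ has_partials_chain[OF hp dT]])
        show "continuous_on G (\<lambda>x. T N (h x))"
          by (rule continuous_on_compose2[OF cT(1) cont]) auto
        show "continuous_on G (\<lambda>x. T' N (h x) * D i x)" if "i < n" for i
          by (intro continuous_on_mult contD that continuous_on_compose2[OF cT(2) cont]) auto
        show "bounded ((\<lambda>x. T N (h x)) ` G)"
          unfolding bounded_iff using T_bd[of N] by auto
      qed
      also have "\<dots> \<le> ?R"
      proof (intro mult_left_mono nn_integral_mono ennreal_leI sum_mono)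
        fix x i
        have "(T' N (h x) * D i x)\<^sup>2 = (T' N (h x))\<^sup>2 * (D i x)\<^sup>2" by (rule power_mult_distrib)
        also have "\<dots> \<le> 1 * (D i x)\<^sup>2"
          using T'_le[of N "h x"] by (intro mult_right_mono) (auto simp: abs_square_le_1)
        finally show "(T' N (h x) * D i x)\<^sup>2 \<le> (D i x)\<^sup>2" by simp
      qed auto
      finally show ?thesis .
    qed
    finally show ?thesis by (simp add: add_right_mono)
  qed
  have "(\<integral>\<^sup>+x. ennreal ((h x)\<^sup>2) \<partial>\<mu>) = (\<integral>\<^sup>+x. liminf (\<lambda>N. ennreal ((T N (h x))\<^sup>2)) \<partial>\<mu>)"
    by (intro nn_integral_cong lim_imp_Liminf[symmetric] tendsto_ennrealI tendsto_power T_lim) auto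
  also have "\<dots> \<le> liminf (\<lambda>N. \<integral>\<^sup>+x. ennreal ((T N (h x))\<^sup>2) \<partial>\<mu>)"
    by (rule nn_integral_liminf) measurable
  also have "\<dots> \<le> liminf (\<lambda>N. ?R + ennreal ((e N)\<^sup>2))"
    by (intro Liminf_mono always_eventually allI bound)
  also have "\<dots> = ?R + ennreal (0\<^sup>2)"
    by (intro lim_imp_Liminf tendsto_add tendsto_const tendsto_ennrealI tendsto_power e_lim) auto
  finally show ?thesis by simp
qed

section \<open>Suprema of derivative forms\<close>

text \<open>Cauchy-Schwarz after splitting |w| into two factors sqrt |w|. It shows that mixing
  gradients with signed weights of total mass at most 1 does not exceed a common bound on their
  lengths.\<close>

lemma weighted_sum_square_le:
  fixes w a :: "'a \<Rightarrow> real"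
  assumes "(\<Sum>m\<in>I. \<bar>w m\<bar>) \<le> 1"
  shows "(\<Sum>m\<in>I. w m * a m)\<^sup>2 \<le> (\<Sum>m\<in>I. \<bar>w m\<bar> * (a m)\<^sup>2)"
proof -
  have "\<bar>\<Sum>m\<in>I. w m * a m\<bar> \<le> (\<Sum>m\<in>I. \<bar>w m * a m\<bar>)" by (rule sum_abs)
  also have "\<dots> = (\<Sum>m\<in>I. sqrt \<bar>w m\<bar> * (sqrt \<bar>w m\<bar> * \<bar>a m\<bar>))"
    by (simp add: abs_mult mult.assoc[symmetric])
  finally have "\<bar>\<Sum>m\<in>I. w m * a m\<bar>\<^sup>2 \<le> (\<Sum>m\<in>I. sqrt \<bar>w m\<bar> * (sqrt \<bar>w m\<bar> * \<bar>a m\<bar>))\<^sup>2"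
    by (rule power_mono) simp
  also have "\<dots> \<le> (\<Sum>m\<in>I. (sqrt \<bar>w m\<bar>)\<^sup>2) * (\<Sum>m\<in>I. (sqrt \<bar>w m\<bar> * \<bar>a m\<bar>)\<^sup>2)"
    by (rule Cauchy_Schwarz_ineq_sum)
  also have "\<dots> \<le> 1 * (\<Sum>m\<in>I. (sqrt \<bar>w m\<bar> * \<bar>a m\<bar>)\<^sup>2)"
    using assms by (intro mult_right_mono sum_nonneg) auto
  finally show ?thesis by (simp add: power_mult_distrib)
qed

text \<open>The witness is built from $L = \<beta>^{-1} \ln (\mathrm{avg}_m \cosh (\<beta> f_m))$, which lies between
  $\max |f_m| - o(1)$ and $\max |f_m|$ and whose gradient is, up to signs, a sub-convex combination of
  the gradients of the $f_m$.  The outer map $L / (1 + L/N)$ makes it bounded.\<close>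

lemma soft_max_exists:
  fixes f :: "nat \<Rightarrow> (nat \<Rightarrow> real) \<Rightarrow> real"
  assumes hp: "\<And>m. has_partials n G (f m) (D m)" and cont: "\<And>m. continuous_on G (f m)"
    and contD: "\<And>m i. i < n \<Longrightarrow> continuous_on G (D m i)"
    and F: "\<And>m x. x \<in> G \<Longrightarrow> \<bar>f m x\<bar> \<le> F x" and \<Phi>: "\<And>m x. x \<in> G \<Longrightarrow> (\<Sum>i<n. (D m i x)\<^sup>2) \<le> (\<Phi> x)\<^sup>2"
  obtains h E where
    "continuous_on G h" "has_partials n G h E" "\<And>i. i < n \<Longrightarrow> continuous_on G (E i)"
    "\<And>x. x \<in> G \<Longrightarrow> 0 \<le> h x" "\<And>x. x \<in> G \<Longrightarrow> h x \<le> real (Suc N)" "\<And>x. x \<in> G \<Longrightarrow> h x \<le> F x"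
    "\<And>x m. x \<in> G \<Longrightarrow> m \<le> N \<Longrightarrow>
        (\<bar>f m x\<bar> - 2 / real (Suc N)) / (1 + F x / real (Suc N)) \<le> h x"
    "\<And>x. x \<in> G \<Longrightarrow> (\<Sum>i<n. (E i x)\<^sup>2) \<le> (\<Phi> x)\<^sup>2"
proof -
  define K where "K = real (Suc N)"
  have K: "K \<ge> 1" by (simp add: K_def)
  \<comment> \<open>The lower bound for L loses ln (2K) / \<beta> \<le> 2K / K^2 = 2/K, where the
    factor K comes from averaging and 2 from cosh t \<ge> exp |t| / 2.\<close>
  define \<beta> where "\<beta> = K\<^sup>2"
  have \<beta>: "\<beta> \<ge> 1" using K by (simp add: \<beta>_def)
  define Z where "Z x = (\<Sum>m\<le>N. cosh (\<beta> * f m x))" for x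
  define L where "L z = ln (z / K) / \<beta>" for z
  define T where "T z = L z / (1 + L z / K)" for z
  define T' where "T' z = 1 / (1 + L z / K)\<^sup>2 / (z * \<beta>)" for z
  \<comment> \<open>Since cosh is at least 1, the average is at least 1 and its logarithm
    nonnegative.\<close>
  have ZK: "Z x \<ge> K" for x
  proof -
    have "(\<Sum>m\<le>N. 1) \<le> Z x" unfolding Z_def by (intro sum_mono cosh_real_ge_1)
    then show ?thesis by (simp add: K_def)
  qed
  have L0: "L z \<ge> 0" if "z \<ge> K" for z
    unfolding L_def using that K \<beta> by (intro divide_nonneg_nonneg ln_ge_zero) auto
  have dT: "(T has_real_derivative T' z) (at z)" if z: "z \<in> Z ` G" for z
  proof -
    have zK: "z \<ge> K" using z ZK by auto
    have dL: "(L has_real_derivative 1 / (z * \<beta>)) (at z)"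
      unfolding L_def[abs_def] using zK K \<beta> by (auto intro!: derivative_eq_intros simp: field_simps)
    have pos: "1 + L z / K > 0" using L0[OF zK] K by (intro add_pos_nonneg) auto
    have "((\<lambda>t. t / (1 + t / K)) has_real_derivative 1 / (1 + L z / K)\<^sup>2) (at (L z))"
      using pos K by (auto intro!: derivative_eq_intros simp: power2_eq_square field_simps)
    from DERIV_chain2[OF this dL] show ?thesis
      unfolding T_def[abs_def] T'_def by simp
  qed
  have "has_partials n G (\<lambda>x. cosh (\<beta> * f m x)) (\<lambda>i x. (sinh (\<beta> * f m x) * \<beta>) * D m i x)" for m
    by (rule has_partials_chain[OF hp, where T' = "\<lambda>t. sinh (\<beta> * t) * \<beta>"])
       (auto intro!: derivative_eq_intros)
  then have hpZ: "has_partials n G Z (\<lambda>i x. \<Sum>m\<le>N. (sinh (\<beta> * f m x) * \<beta>) * D m i x)"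
    unfolding Z_def[abs_def] by (intro has_partials_sum)
  define h where "h x = T (Z x)" for x
  define E where "E i x = T' (Z x) * (\<Sum>m\<le>N. (sinh (\<beta> * f m x) * \<beta>) * D m i x)" for i x
  have hpE: "has_partials n G h E"
    unfolding h_def[abs_def] E_def[abs_def] by (rule has_partials_chain[OF hpZ dT])
  have contZ: "continuous_on G Z"
    unfolding Z_def[abs_def] by (intro continuous_intros cont)
  have ne: "Z x \<noteq> 0" "Z x / K \<noteq> 0" "1 + L (Z x) / K \<noteq> 0" for x
  proof -
    show "Z x \<noteq> 0" "Z x / K \<noteq> 0" using ZK[of x] K by auto
    have "0 \<le> L (Z x) / K" using L0[OF ZK, of x] K by auto
    then show "1 + L (Z x) / K \<noteq> 0" by linarith
  qed
  have contL: "continuous_on G (\<lambda>x. L (Z x))"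
    unfolding L_def using ne \<beta> K by (intro continuous_intros contZ) auto
  have conth: "continuous_on G h"
    unfolding h_def[abs_def] T_def using ne K by (intro continuous_intros contL) auto
  have contE: "continuous_on G (E i)" if "i < n" for i
    unfolding E_def[abs_def] T'_def using ne K \<beta>
    by (intro continuous_intros contL contZ cont contD that) auto
  have Lle: "L (Z x) \<le> F x" if x: "x \<in> G" for x
  proof -
    have "cosh (\<beta> * f m x) \<le> exp (\<beta> * F x)" for m
    proof -
      have "cosh (\<beta> * f m x) \<le> exp \<bar>\<beta> * f m x\<bar>"
        by (auto simp: cosh_field_def abs_if)
      also have "\<dots> \<le> exp (\<beta> * F x)" using F[OF x, of m] \<beta> by (simp add: abs_mult)
      finally show ?thesis .
    qed
    then have "Z x \<le> (\<Sum>m\<le>N. exp (\<beta> * F x))" unfolding Z_def by (intro sum_mono)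
    then have "Z x / K \<le> exp (\<beta> * F x)" using K by (simp add: K_def field_simps)
    then have "ln (Z x / K) \<le> ln (exp (\<beta> * F x))" using ZK[of x] K by (intro ln_mono) auto
    then have "ln (Z x / K) \<le> \<beta> * F x" by simp
    then show ?thesis unfolding L_def using \<beta> by (simp add: divide_le_eq mult.commute)
  qed
  have Lge: "\<bar>f m x\<bar> - 2 / K \<le> L (Z x)" if m: "m \<le> N" for m x
  proof -
    have "exp \<bar>\<beta> * f m x\<bar> / 2 \<le> cosh (\<beta> * f m x)"
      by (auto simp: cosh_field_def abs_if)
    also have "\<dots> \<le> Z x"
      unfolding Z_def using m by (intro member_le_sum) auto
    finally have "exp \<bar>\<beta> * f m x\<bar> / (2 * K) \<le> Z x / K"
      using K by (simp add: field_simps)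
    then have "ln (exp \<bar>\<beta> * f m x\<bar> / (2 * K)) \<le> ln (Z x / K)"
      using K by (intro ln_mono) auto
    moreover have "ln (exp \<bar>\<beta> * f m x\<bar> / (2 * K)) = \<beta> * \<bar>f m x\<bar> - ln (2 * K)"
      using K \<beta> by (simp add: ln_div abs_mult)
    moreover have "ln (2 * K) \<le> 2 * K" using ln_le_minus_one[of "2 * K"] K by linarith
    ultimately have "\<beta> * \<bar>f m x\<bar> - 2 * K \<le> ln (Z x / K)" by linarith
    then have "(\<beta> * \<bar>f m x\<bar> - 2 * K) / \<beta> \<le> L (Z x)"
      unfolding L_def using \<beta> by (intro divide_right_mono) auto
    moreover have "(\<beta> * \<bar>f m x\<bar> - 2 * K) / \<beta> = \<bar>f m x\<bar> - 2 / K"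
      using K \<beta> by (simp add: diff_divide_distrib) (simp add: \<beta>_def power2_eq_square)
    ultimately show ?thesis by simp
  qed
  have h0: "0 \<le> h x" and hK: "h x \<le> K" and hL: "h x \<le> L (Z x)"
    and hge: "L (Z x) \<le> F x \<Longrightarrow> L (Z x) / (1 + F x / K) \<le> h x" for x
  proof -
    have l: "0 \<le> L (Z x)" by (rule L0[OF ZK])
    have den: "1 + L (Z x) / K \<ge> 1" using l K by simp
    show "0 \<le> h x" unfolding h_def T_def using l den by simp
    have "L (Z x) \<le> K * (1 + L (Z x) / K)" using K by (simp add: algebra_simps)
    then show "h x \<le> K" unfolding h_def T_def using den by (simp add: pos_divide_le_eq)
    have "L (Z x) * 1 \<le> L (Z x) * (1 + L (Z x) / K)" using l den by (intro mult_left_mono)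
    then show "h x \<le> L (Z x)" unfolding h_def T_def using den by (simp add: pos_divide_le_eq)
    assume "L (Z x) \<le> F x"
    then show "L (Z x) / (1 + F x / K) \<le> h x"
      unfolding h_def T_def using l den K
      by (intro divide_left_mono add_left_mono divide_right_mono mult_pos_pos add_pos_nonneg) auto
  qed
  have gradE: "(\<Sum>i<n. (E i x)\<^sup>2) \<le> (\<Phi> x)\<^sup>2" if x: "x \<in> G" for x
  proof -
    \<comment> \<open>The factor \<beta> cancels between the logarithm and the inner derivative. The
      outer derivative is at most 1 and |sinh| \<le> cosh, so the weights have total mass at most Z
      / Z = 1.\<close>
    define w where "w m = 1 / (1 + L (Z x) / K)\<^sup>2 * (sinh (\<beta> * f m x) / Z x)" for m
    have Ew: "E i x = (\<Sum>m\<le>N. w m * D m i x)" for i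
      unfolding E_def sum_distrib_left using \<beta> ne[of x]
      by (intro sum.cong refl) (simp add: T'_def w_def)
    have "1 + L (Z x) / K \<ge> 1" using L0[OF ZK] K by simp
    then have kap: "1 / (1 + L (Z x) / K)\<^sup>2 \<le> 1" by (simp add: divide_le_eq_1)
    have wle: "\<bar>w m\<bar> \<le> cosh (\<beta> * f m x) / Z x" for m
    proof -
      have "\<bar>w m\<bar> = 1 / (1 + L (Z x) / K)\<^sup>2 * (\<bar>sinh (\<beta> * f m x)\<bar> / Z x)"
        unfolding w_def abs_mult using ZK[of x] K by (simp add: abs_divide)
      also have "\<dots> \<le> 1 * (cosh (\<beta> * f m x) / Z x)"
      proof (intro mult_mono kap divide_right_mono)
        show "\<bar>sinh (\<beta> * f m x)\<bar> \<le> cosh (\<beta> * f m x)"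
          by (auto simp: sinh_field_def cosh_field_def abs_le_iff field_simps)
      qed (use ZK[of x] K in auto)
      finally show ?thesis by simp
    qed
    have wsum: "(\<Sum>m\<le>N. \<bar>w m\<bar>) \<le> 1"
    proof -
      have "(\<Sum>m\<le>N. \<bar>w m\<bar>) \<le> (\<Sum>m\<le>N. cosh (\<beta> * f m x) / Z x)" by (intro sum_mono wle)
      also have "\<dots> = Z x / Z x" unfolding sum_divide_distrib[symmetric] by (simp only: Z_def)
      finally show ?thesis using ne(1)[of x] by simp
    qed
    have "(\<Sum>i<n. (E i x)\<^sup>2) \<le> (\<Sum>i<n. \<Sum>m\<le>N. \<bar>w m\<bar> * (D m i x)\<^sup>2)"
      unfolding Ew by (intro sum_mono weighted_sum_square_le wsum)
    also have "\<dots> = (\<Sum>m\<le>N. \<bar>w m\<bar> * (\<Sum>i<n. (D m i x)\<^sup>2))"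
      by (subst sum.swap) (simp add: sum_distrib_left)
    also have "\<dots> \<le> (\<Sum>m\<le>N. \<bar>w m\<bar> * (\<Phi> x)\<^sup>2)"
      using \<Phi>[OF x] by (intro sum_mono mult_left_mono) auto
    also have "\<dots> = (\<Sum>m\<le>N. \<bar>w m\<bar>) * (\<Phi> x)\<^sup>2" by (simp add: sum_distrib_right)
    also have "\<dots> \<le> 1 * (\<Phi> x)\<^sup>2" using wsum by (intro mult_right_mono) auto
    finally show ?thesis by simp
  qed
  show thesis
  proof (rule that[OF conth hpE contE h0])
    fix x assume x: "x \<in> G"
    show "h x \<le> real (Suc N)" using hK[of x] by (simp add: K_def)
    show "h x \<le> F x" using hL[of x] Lle[OF x] by linarith
    fix m assume m: "m \<le> N"
    have "0 \<le> F x" using F[OF x, of 0] by linarith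
    then have "(\<bar>f m x\<bar> - 2 / K) / (1 + F x / K) \<le> L (Z x) / (1 + F x / K)"
      using K by (intro divide_right_mono Lge m) auto
    also have "\<dots> \<le> h x" by (rule hge[OF Lle[OF x]])
    finally show "(\<bar>f m x\<bar> - 2 / real (Suc N)) / (1 + F x / real (Suc N)) \<le> h x"
      by (simp add: K_def)
  qed (use gradE in auto)
qed

text \<open>Rational vectors suffice for the suprema below; countability makes them measurable.\<close>

definition rat_ball :: "nat \<Rightarrow> (nat \<Rightarrow> real) set" where
  "rat_ball n = {u. (\<forall>i. u i \<in> \<rat>) \<and> (\<forall>i\<ge>n. u i = 0) \<and> (\<Sum>i<n. (u i)\<^sup>2) \<le> 1}"

text \<open>Tuples are padded by zero vectors, and \<open>case_nat\<close> prepends a vector just as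
  \<open>Cons\<close> prepends an index to a multi-index. One slot can thus be split off the form
  and the tuple together.\<close>

primrec rat_tuples :: "nat \<Rightarrow> nat \<Rightarrow> (nat \<Rightarrow> nat \<Rightarrow> real) set" where
  "rat_tuples n 0 = {\<lambda>_ _. 0}"
| "rat_tuples n (Suc k) = (\<lambda>(u, v). case_nat u v) ` (rat_ball n \<times> rat_tuples n k)"

lemma countable_rat_ball: "countable (rat_ball n)"
proof (rule countable_subset)
  show "rat_ball n \<subseteq> (\<lambda>l i. if i < length l then l ! i else 0) ` lists \<rat>"
  proof
    fix u assume u: "u \<in> rat_ball n"
    show "u \<in> (\<lambda>l i. if i < length l then l ! i else 0) ` lists \<rat>"
      by (rule image_eqI[of _ _ "map u [0..<n]"]) (use u in \<open>auto simp: rat_ball_def fun_eq_iff\<close>)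
  qed
  show "countable ((\<lambda>l i. if i < length l then l ! i else 0) ` lists (\<rat> :: real set))"
    by (intro countable_image countable_lists countable_rat)
qed

lemma countable_rat_tuples: "countable (rat_tuples n k)"
  by (induction k) (auto intro!: countable_image countable_SIGMA countable_rat_ball)

lemma rat_tuples_nonempty: "rat_tuples n k \<noteq> {}"
proof (induction k)
  case (Suc k)
  have "(\<lambda>_. 0) \<in> rat_ball n" by (simp add: rat_ball_def)
  with Suc show ?case by auto
qed simp

lemma rat_tuples_mem: "v \<in> rat_tuples n k \<Longrightarrow> j < k \<Longrightarrow> v j \<in> rat_ball n"
proof (induction k arbitrary: v j)
  case (Suc k)
  then show ?case by (cases j) auto
qed simp

text \<open>The pairing with w over the unit ball is maximal at t = w / |w|, with value |w|.
  Rounding the coordinates of t towards 0 to multiples of 1/K gives a rational point that stays in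
  the ball, and costs at most W / K, where W is the sum of the |w i|.\<close>

lemma sum_squares_le_from_rat_ball:
  fixes w :: "nat \<Rightarrow> real"
  assumes \<Phi>: "\<And>u. u \<in> rat_ball n \<Longrightarrow> (\<Sum>i<n. u i * w i) \<le> \<Phi>"
  shows "(\<Sum>i<n. (w i)\<^sup>2) \<le> \<Phi>\<^sup>2"
proof -
  have "\<Phi> \<ge> 0" using \<Phi>[of "\<lambda>_. 0"] by (simp add: rat_ball_def)
  define s where "s = sqrt (\<Sum>i<n. (w i)\<^sup>2)"
  have s2: "s\<^sup>2 = (\<Sum>i<n. (w i)\<^sup>2)" unfolding s_def by (simp add: sum_nonneg)
  have "s \<ge> 0" by (simp add: s_def sum_nonneg)
  have "s \<le> \<Phi>"
  proof (cases "s = 0")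
    case False
    with \<open>s \<ge> 0\<close> have s: "s > 0" by simp
    show ?thesis
    proof (rule field_le_epsilon)
      fix e :: real assume e: "e > 0"
      define W where "W = (\<Sum>i<n. \<bar>w i\<bar>)"
      have W: "W \<ge> 0" by (simp add: W_def sum_nonneg)
      obtain K where K: "W / e < real K" using reals_Archimedean2 by blast
      have Kpos: "real K > 0" using K W e by (meson divide_nonneg_pos le_less_trans)
      define t where "t i = w i / s" for i
      define u where "u i = (if i < n then sgn (t i) * (real_of_int \<lfloor>real K * \<bar>t i\<bar>\<rfloor> / real K) else 0)" for i
      have fl: "0 \<le> real_of_int \<lfloor>real K * \<bar>t i\<bar>\<rfloor> / real K" "real_of_int \<lfloor>real K * \<bar>t i\<bar>\<rfloor> / real K \<le> \<bar>t i\<bar>"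
        "\<bar>t i\<bar> - 1 / real K \<le> real_of_int \<lfloor>real K * \<bar>t i\<bar>\<rfloor> / real K" for i
      proof -
        have a: "real_of_int \<lfloor>real K * \<bar>t i\<bar>\<rfloor> \<le> real K * \<bar>t i\<bar>" by linarith
        have b: "real K * \<bar>t i\<bar> - 1 \<le> real_of_int \<lfloor>real K * \<bar>t i\<bar>\<rfloor>" by linarith
        show "0 \<le> real_of_int \<lfloor>real K * \<bar>t i\<bar>\<rfloor> / real K" by simp
        show "real_of_int \<lfloor>real K * \<bar>t i\<bar>\<rfloor> / real K \<le> \<bar>t i\<bar>"
          using a Kpos by (simp add: pos_divide_le_eq mult.commute)
        have "(real K * \<bar>t i\<bar> - 1) / real K \<le> real_of_int \<lfloor>real K * \<bar>t i\<bar>\<rfloor> / real K"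
          using b Kpos by (intro divide_right_mono) auto
        then show "\<bar>t i\<bar> - 1 / real K \<le> real_of_int \<lfloor>real K * \<bar>t i\<bar>\<rfloor> / real K"
          using Kpos by (simp add: diff_divide_distrib)
      qed
      have "u \<in> rat_ball n"
      proof -
        have "u i \<in> \<rat>" for i unfolding u_def by (auto simp: sgn_if)
        moreover have "(\<Sum>i<n. (u i)\<^sup>2) \<le> 1"
        proof -
          have "(\<Sum>i<n. (u i)\<^sup>2) \<le> (\<Sum>i<n. (t i)\<^sup>2)"
          proof (rule sum_mono)
            fix i assume "i \<in> {..<n}"
            then have "\<bar>u i\<bar> \<le> \<bar>t i\<bar>"
              using fl(1,2)[of i] by (auto simp: u_def abs_mult sgn_if)
            then show "(u i)\<^sup>2 \<le> (t i)\<^sup>2" by (simp add: abs_le_square_iff)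
          qed
          also have "\<dots> = s\<^sup>2 / s\<^sup>2" unfolding t_def by (simp add: power_divide sum_divide_distrib[symmetric] s2)
          finally show ?thesis using s by simp
        qed
        ultimately show ?thesis by (simp add: rat_ball_def u_def)
      qed
      have "s = (\<Sum>i<n. \<bar>t i\<bar> * \<bar>w i\<bar>)"
      proof -
        have "(\<Sum>i<n. \<bar>t i\<bar> * \<bar>w i\<bar>) = (\<Sum>i<n. (w i)\<^sup>2) / s"
          using s by (simp add: t_def abs_mult power2_eq_square sum_divide_distrib)
        moreover have "(\<Sum>i<n. (w i)\<^sup>2) / s = s"
          unfolding s2[symmetric] using s by (simp add: power2_eq_square)
        ultimately show ?thesis by simp
      qed
      also have "\<dots> \<le> (\<Sum>i<n. u i * w i + \<bar>w i\<bar> / real K)"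
      proof (rule sum_mono)
        fix i assume i: "i \<in> {..<n}"
        have "(\<bar>t i\<bar> - 1 / real K) * \<bar>w i\<bar> \<le> real_of_int \<lfloor>real K * \<bar>t i\<bar>\<rfloor> / real K * \<bar>w i\<bar>"
          by (intro mult_right_mono fl) auto
        also have "\<dots> = u i * w i"
          using i s by (auto simp: u_def t_def sgn_if abs_if zero_less_divide_iff divide_less_0_iff)
        finally show "\<bar>t i\<bar> * \<bar>w i\<bar> \<le> u i * w i + \<bar>w i\<bar> / real K" by (simp add: algebra_simps)
      qed
      also have "\<dots> = (\<Sum>i<n. u i * w i) + W / real K"
        by (simp add: sum.distrib W_def sum_divide_distrib)
      also have "\<dots> \<le> \<Phi> + e"
      proof (rule add_mono[OF \<Phi>[OF \<open>u \<in> rat_ball n\<close>]])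
        show "W / real K \<le> e" using K Kpos e by (simp add: field_simps)
      qed
      finally show "s \<le> \<Phi> + e" .
    qed
  qed (use \<open>\<Phi> \<ge> 0\<close> in simp)
  then show ?thesis using \<open>s \<ge> 0\<close> power_mono[of s \<Phi> 2] by (simp add: s2)
qed

section \<open>Multilinear forms and their norms\<close>

lemma sum_multi_indices_Suc:
  "(\<Sum>is\<in>multi_indices n (Suc k). F is) = (\<Sum>i<n. \<Sum>is\<in>multi_indices n k. F (i # is))"
proof -
  have "(\<Sum>is\<in>multi_indices n (Suc k). F is)
      = (\<Sum>p\<in>{..<n} \<times> multi_indices n k. F (case p of (i, is) \<Rightarrow> i # is))"
    unfolding multi_indices_Suc by (subst sum.reindex) (auto simp: inj_on_def)
  then show ?thesis by (simp add: sum.cartesian_product split_def)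
qed

text \<open>Induction over the slots: Cauchy-Schwarz in the first index removes the vector in slot 0
  and leaves one form of order k for each value of that index.\<close>

lemma multilinear_form_le_HS:
  fixes a :: "nat list \<Rightarrow> real"
  assumes "\<And>j. j < k \<Longrightarrow> (\<Sum>i<n. (v j i)\<^sup>2) \<le> 1"
  shows "(\<Sum>is\<in>multi_indices n k. a is * (\<Prod>j<k. v j (is ! j)))\<^sup>2 \<le> (\<Sum>is\<in>multi_indices n k. (a is)\<^sup>2)"
  using assms
proof (induction k arbitrary: a v)
  case 0
  have "multi_indices n 0 = {[]}" by (auto simp: multi_indices_def)
  then show ?case by simp
next
  case (Suc k)
  let ?S = "\<lambda>i. \<Sum>is\<in>multi_indices n k. a (i # is) * (\<Prod>j<k. v (Suc j) (is ! j))"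
  have "(\<Sum>is\<in>multi_indices n (Suc k). a is * (\<Prod>j<Suc k. v j (is ! j))) = (\<Sum>i<n. v 0 i * ?S i)"
    unfolding sum_multi_indices_Suc prod.lessThan_Suc_shift
    by (simp add: sum_distrib_left mult_ac)
  also have "\<dots>\<^sup>2 \<le> (\<Sum>i<n. (v 0 i)\<^sup>2) * (\<Sum>i<n. (?S i)\<^sup>2)"
    by (rule Cauchy_Schwarz_ineq_sum)
  also have "\<dots> \<le> 1 * (\<Sum>i<n. (?S i)\<^sup>2)"
    using Suc.prems[of 0] by (intro mult_right_mono sum_nonneg) auto
  also have "\<dots> \<le> 1 * (\<Sum>i<n. \<Sum>is\<in>multi_indices n k. (a (i # is))\<^sup>2)"
    using Suc.prems by (intro mult_left_mono sum_mono Suc.IH) auto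
  finally show ?case unfolding sum_multi_indices_Suc by simp
qed

lemma hs_norm_sq: "(hs_norm n k f x)\<^sup>2 = (\<Sum>is\<in>multi_indices n k. (partials is f x)\<^sup>2)"
  by (simp add: hs_norm_def L2_set_def sum_nonneg)

lemma deriv_form_le_hs_norm:
  assumes "\<And>j. j < k \<Longrightarrow> (\<Sum>i<n. (v j i)\<^sup>2) \<le> 1"
  shows "\<bar>deriv_form n k f x v\<bar> \<le> hs_norm n k f x"
proof (rule power2_le_imp_le)
  show "\<bar>deriv_form n k f x v\<bar>\<^sup>2 \<le> (hs_norm n k f x)\<^sup>2"
    unfolding hs_norm_sq deriv_form_def power2_abs by (rule multilinear_form_le_HS[OF assms])
qed (simp add: hs_norm_def)

lemma deriv_form_scale:
  "deriv_form n k f x (\<lambda>j i. c j * w j i) = (\<Prod>j<k. c j) * deriv_form n k f x w"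
  unfolding deriv_form_def by (simp add: prod.distrib sum_distrib_left mult_ac)

lemma enorm_le_1_iff: "enorm n u \<le> 1 \<longleftrightarrow> (\<Sum>i<n. (u i)\<^sup>2) \<le> 1"
  by (simp add: enorm_def L2_set_def)

text \<open>\<open>op_norm\<close> takes signed values at unit vectors, whereas the recursion needs
  absolute values on the unit ball. Lengths factor out by multilinearity, and the Hilbert-Schmidt
  bound ensures that \<open>Sup\<close> is taken over a set bounded above.\<close>

lemma deriv_form_le_op_norm:
  assumes n: "n \<ge> 1" and d: "d \<ge> 1" and v: "\<And>j. j < d \<Longrightarrow> (\<Sum>i<n. (v j i)\<^sup>2) \<le> 1"
  shows "\<bar>deriv_form n d f x v\<bar> \<le> op_norm n d f x"
proof -
  let ?E = "topspace (Euclidean_space n)"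
  let ?U = "{deriv_form n d f x w | w. \<forall>j<d. w j \<in> ?E \<and> enorm n (w j) = 1}"
  have bdd: "bdd_above ?U"
  proof (rule bdd_aboveI)
    fix y assume "y \<in> ?U"
    then obtain w where w: "y = deriv_form n d f x w" "\<And>j. j < d \<Longrightarrow> enorm n (w j) = 1" by auto
    have "\<bar>y\<bar> \<le> hs_norm n d f x"
      unfolding w(1) by (rule deriv_form_le_hs_norm) (use w(2) in \<open>simp flip: enorm_le_1_iff\<close>)
    then show "y \<le> hs_norm n d f x" by linarith
  qed
  \<comment> \<open>A zero slot is replaced by the first basis vector, available since n \<ge> 1;
    its length factor 0 still makes the product correct.\<close>
  define w where "w j i = (if i \<ge> n then 0 else if enorm n (v j) = 0 then (if i = 0 then 1 else 0)
      else v j i / enorm n (v j))" for j i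
  have wE: "w j \<in> ?E" for j by (simp add: w_def topspace_Euclidean_space)
  have w1: "enorm n (w j) = 1" for j
  proof (cases "enorm n (v j) = 0")
    case True
    have "(\<Sum>i<n. (w j i)\<^sup>2) = (\<Sum>i<n. if i = 0 then 1 else 0)"
      using True by (intro sum.cong) (auto simp: w_def)
    then show ?thesis using n by (simp add: enorm_def L2_set_def)
  next
    case False
    have "(\<Sum>i<n. (w j i)\<^sup>2) = (\<Sum>i<n. (v j i)\<^sup>2) / (enorm n (v j))\<^sup>2"
      using False by (simp add: w_def power_divide sum_divide_distrib)
    also have "(\<Sum>i<n. (v j i)\<^sup>2) = (enorm n (v j))\<^sup>2"
      by (simp add: enorm_def L2_set_def sum_nonneg)
    finally show ?thesis using False by (simp add: enorm_def L2_set_def)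
  qed
  have vw: "v j i = enorm n (v j) * w j i" if "i < n" for i j
  proof (cases "enorm n (v j) = 0")
    case True
    then show ?thesis using that by (simp add: enorm_def L2_set_eq_0_iff)
  next
    case False
    then show ?thesis using that by (simp add: w_def)
  qed
  have form_eq: "deriv_form n d f x v = (\<Prod>j<d. enorm n (v j)) * deriv_form n d f x w"
    unfolding deriv_form_scale[symmetric] unfolding deriv_form_def
    by (intro sum.cong refl arg_cong2[of _ _ _ _ "(*)"] prod.cong)
       (auto simp: multi_indices_def subset_iff intro!: vw)
  have "(\<Prod>j<d. enorm n (v j)) \<le> 1" "0 \<le> (\<Prod>j<d. enorm n (v j))"
    using v by (auto intro!: prod_le_1 prod_nonneg simp flip: enorm_le_1_iff simp: enorm_def)
  then have "\<bar>deriv_form n d f x v\<bar> \<le> 1 * \<bar>deriv_form n d f x w\<bar>"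
    unfolding form_eq abs_mult by (intro mult_right_mono) auto
  moreover have "deriv_form n d f x w \<le> op_norm n d f x"
    unfolding op_norm_def using wE w1 by (intro cSup_upper bdd) auto
  moreover have "- deriv_form n d f x w \<le> op_norm n d f x"
  proof -
    \<comment> \<open>Flipping the sign of slot 0, present since d \<ge> 1, negates the
      form.\<close>
    let ?w' = "\<lambda>j i. (if j = 0 then -1 else 1) * w j i"
    have "deriv_form n d f x ?w' = (\<Prod>j<d. if j = 0 then -1 else 1) * deriv_form n d f x w"
      by (rule deriv_form_scale)
    also have "(\<Prod>j<d. if j = 0 then -1 else 1 :: real) = -1"
      using d by (simp add: prod.delta)
    finally have eq: "- deriv_form n d f x w = deriv_form n d f x ?w'" by simp
    have "?w' j \<in> ?E" for j using wE[of j] by (auto simp: topspace_Euclidean_space)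
    moreover have "enorm n (?w' j) = 1" for j using w1[of j] by (auto simp: enorm_def L2_set_def)
    ultimately show ?thesis
      unfolding op_norm_def eq by (intro cSup_upper bdd) auto
  qed
  ultimately show ?thesis by linarith
qed

lemma deriv_form_Suc:
  "deriv_form n (Suc k) f x (case_nat u v)
    = (\<Sum>i<n. u i * (\<Sum>is\<in>multi_indices n k. partials (i # is) f x * (\<Prod>j<k. v j (is ! j))))"
  unfolding deriv_form_def sum_multi_indices_Suc prod.lessThan_Suc_shift
  by (simp add: sum_distrib_left mult_ac)

lemma has_partials_partials:
  assumes "C_on n d G f" "k < d" "is \<in> multi_indices n k"
  shows "has_partials n G (partials is f) (\<lambda>i. partials (i # is) f)"
  using assms unfolding C_on_def has_partials_def
  by (auto simp: partial_def DERIV_deriv_iff_field_differentiable)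

lemma continuous_on_partials:
  "C_on n d G f \<Longrightarrow> k \<le> d \<Longrightarrow> is \<in> multi_indices n k \<Longrightarrow> continuous_on G (partials is f)"
  unfolding C_on_def by blast

lemma Cons_multi_indices: "i < n \<Longrightarrow> is \<in> multi_indices n k \<Longrightarrow> i # is \<in> multi_indices n (Suc k)"
  by (simp add: multi_indices_def)

lemma has_partials_deriv_form:
  assumes "C_on n d G f" "k < d"
  shows "has_partials n G (\<lambda>x. deriv_form n k f x v)
    (\<lambda>i x. \<Sum>is\<in>multi_indices n k. partials (i # is) f x * (\<Prod>j<k. v j (is ! j)))"
proof -
  have "has_partials n G (\<lambda>x. partials is f x * (\<Prod>j<k. v j (is ! j)))
      (\<lambda>i x. partials (i # is) f x * (\<Prod>j<k. v j (is ! j)))" if "is \<in> multi_indices n k" for "is"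
    using has_partials_mult[OF has_partials_partials[OF assms that] has_partials_const] by simp
  then show ?thesis unfolding deriv_form_def by (rule has_partials_sum)
qed

section \<open>Exponential moments\<close>

text \<open>Termwise integration of the exponential series. Moments are given only at the orders d
  2^j; interpolation yields 2 (2k)^k at every order k \<ge> 1, with no trace of d.\<close>

lemma exp_moment_bound:
  fixes Y :: "'a \<Rightarrow> real"
  assumes "prob_space M" and [measurable]: "Y \<in> borel_measurable M" and Y: "\<And>x. x \<in> space M \<Longrightarrow> 0 \<le> Y x"
    and d: "d \<ge> 1"
    and mom: "\<And>j. j \<ge> 1 \<Longrightarrow> (\<integral>\<^sup>+x. ennreal (Y x ^ (d * 2 ^ j)) \<partial>M) \<le> ennreal ((2 ^ j) ^ (d * 2 ^ j))"
  shows "(\<integral>\<^sup>+x. ennreal (exp (1 / (6 * exp 1) * Y x)) \<partial>M) \<le> 2"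
proof -
  interpret prob_space M by fact
  define c :: real where "c = 1 / (6 * exp 1)"
  have c: "c > 0" by (simp add: c_def)
  \<comment> \<open>j starts at 1, as do the given moments; rounding up to a power of 2 costs at
    most a factor 2.\<close>
  have pow2: "\<exists>j\<ge>1. k \<le> 2 ^ j \<and> 2 ^ j \<le> 2 * k" if "k \<ge> 1" for k :: nat
    using that
  proof (induction k rule: nat_induct_at_least)
    case base
    show ?case by (intro exI[of _ 1]) simp
  next
    case (Suc k)
    then obtain j where j: "j \<ge> 1" "k \<le> 2 ^ j" "2 ^ j \<le> 2 * k" by blast
    show ?case
    proof (cases "Suc k \<le> 2 ^ j")
      case True
      with j show ?thesis by (intro exI[of _ j]) auto
    next
      case False
      with j have "k = 2 ^ j" by simp
      with j Suc show ?thesis by (intro exI[of _ "Suc j"]) auto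
    qed
  qed
  have Yk: "(\<integral>\<^sup>+x. ennreal (Y x ^ k) \<partial>M) \<le> ennreal (2 * (2 * real k) ^ k)" if k: "k \<ge> 1" for k
  proof -
    obtain j where j: "j \<ge> 1" "k \<le> 2 ^ j" "2 ^ j \<le> 2 * k" using pow2[OF k] by blast
    let ?R = "2 ^ j :: real" and ?q = "d * 2 ^ j"
    have kq: "k \<le> ?q" using j(2) d by (metis mult_le_mono1 nat_mult_1 order_trans)
    have R: "?R > 0" "?R \<le> 2 * real k"
      using j(3) by (simp, metis of_nat_le_iff of_nat_mult of_nat_numeral of_nat_power)
    have "(\<integral>\<^sup>+x. ennreal (Y x ^ k) \<partial>M) \<le> (\<integral>\<^sup>+x. ennreal (?R ^ k) * (1 + ennreal (1 / ?R ^ ?q) * ennreal (Y x ^ ?q)) \<partial>M)"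
    proof (rule nn_integral_mono)
      fix x assume x: "x \<in> space M"
      define t where "t = Y x / ?R"
      have t: "t \<ge> 0" using Y[OF x] R by (simp add: t_def)
      \<comment> \<open>An elementary substitute for Hoelder's inequality. With t = Y / 2^j the
        second term integrates to at most 1, hence the leading factor 2 in the bound.\<close>
      have "t ^ k \<le> 1 + t ^ ?q"
      proof (cases "t \<le> 1")
        case True
        then have "t ^ k \<le> 1" using t by (simp add: power_le_one)
        moreover have "0 \<le> t ^ ?q" using t by simp
        ultimately show ?thesis by linarith
      next
        case False
        then have "t ^ k \<le> t ^ ?q" using kq by (intro power_increasing) auto
        then show ?thesis by simp
      qed
      then have "?R ^ k * t ^ k \<le> ?R ^ k * (1 + t ^ ?q)" by (intro mult_left_mono) auto
      moreover have "?R ^ k * t ^ k = Y x ^ k" using R by (simp add: t_def power_divide)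
      moreover have "t ^ ?q = 1 / ?R ^ ?q * Y x ^ ?q" unfolding t_def power_divide by simp
      ultimately have "Y x ^ k \<le> ?R ^ k * (1 + 1 / ?R ^ ?q * Y x ^ ?q)" by simp
      then have "ennreal (Y x ^ k) \<le> ennreal (?R ^ k * (1 + 1 / ?R ^ ?q * Y x ^ ?q))" by (rule ennreal_leI)
      also have "\<dots> = ennreal (?R ^ k) * (1 + ennreal (1 / ?R ^ ?q) * ennreal (Y x ^ ?q))"
      proof -
        have "ennreal (1 + 1 / ?R ^ ?q * Y x ^ ?q) = ennreal 1 + ennreal (1 / ?R ^ ?q * Y x ^ ?q)"
          using Y[OF x] by (intro ennreal_plus) auto
        also have "ennreal (1 / ?R ^ ?q * Y x ^ ?q) = ennreal (1 / ?R ^ ?q) * ennreal (Y x ^ ?q)"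
          using Y[OF x] by (intro ennreal_mult) auto
        finally show ?thesis using Y[OF x] by (subst ennreal_mult) auto
      qed
      finally show "ennreal (Y x ^ k) \<le> ennreal (?R ^ k) * (1 + ennreal (1 / ?R ^ ?q) * ennreal (Y x ^ ?q))" .
    qed
    also have "\<dots> = ennreal (?R ^ k) * (1 + ennreal (1 / ?R ^ ?q) * (\<integral>\<^sup>+x. ennreal (Y x ^ ?q) \<partial>M))"
      by (simp add: nn_integral_cmult nn_integral_add emeasure_space_1)
    also have "\<dots> \<le> ennreal (?R ^ k) * (1 + ennreal (1 / ?R ^ ?q) * ennreal (?R ^ ?q))"
      by (intro mult_left_mono add_left_mono mom j) auto
    also have "ennreal (1 / ?R ^ ?q) * ennreal (?R ^ ?q) = ennreal 1"
      by (subst ennreal_mult[symmetric]) auto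
    also have "ennreal (?R ^ k) * (1 + ennreal 1) = ennreal (2 * ?R ^ k)"
      by (simp add: ennreal_mult mult.commute)
    also have "\<dots> \<le> ennreal (2 * (2 * real k) ^ k)"
      using R by (intro ennreal_leI mult_left_mono power_mono) auto
    finally show ?thesis .
  qed
  \<comment> \<open>The term of order 0 is exactly 1 and not 2, so the total is 2 * (3/2) - 1 =
    2.\<close>
  define a :: "nat \<Rightarrow> real" where "a k = 2 * (1 / 3) ^ k - (if k = 0 then 1 else 0)" for k
  have a_nonneg: "0 \<le> a k" for k by (simp add: a_def)
  have term_le: "(\<integral>\<^sup>+x. ennreal ((c * Y x) ^ k / fact k) \<partial>M) \<le> ennreal (a k)" for k
  proof (cases "k = 0")
    case True
    then show ?thesis by (simp add: a_def emeasure_space_1)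
  next
    case False
    then have k: "k \<ge> 1" by simp
    have "(\<integral>\<^sup>+x. ennreal ((c * Y x) ^ k / fact k) \<partial>M) = (\<integral>\<^sup>+x. ennreal (c ^ k / fact k) * ennreal (Y x ^ k) \<partial>M)"
      using c Y by (intro nn_integral_cong) (simp add: ennreal_mult[symmetric] power_mult_distrib)
    also have "\<dots> = ennreal (c ^ k / fact k) * (\<integral>\<^sup>+x. ennreal (Y x ^ k) \<partial>M)"
      by (simp add: nn_integral_cmult)
    also have "\<dots> \<le> ennreal (c ^ k / fact k) * ennreal (2 * (2 * real k) ^ k)"
      by (intro mult_left_mono Yk k) auto
    also have "\<dots> = ennreal (2 * (2 * c) ^ k * (real k ^ k / fact k))"
    proof -
      have "c ^ k / fact k * (2 * (2 * real k) ^ k) = 2 * (2 * c) ^ k * (real k ^ k / fact k)"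
        by (simp add: power_mult_distrib)
      then show ?thesis using c by (subst ennreal_mult[symmetric]) auto
    qed
    also have "\<dots> \<le> ennreal (2 * (2 * c) ^ k * exp 1 ^ k)"
    proof (intro ennreal_leI mult_left_mono)
      \<comment> \<open>k^k / k! is a single term of the series for exp k.\<close>
      have ex: "(\<lambda>m. real k ^ m / fact m) sums exp (real k)"
        using exp_converges[of "real k"] by (simp add: divide_inverse_commute)
      have "real k ^ k / fact k = (\<Sum>m\<in>{k}. real k ^ m / fact m)" by simp
      also have "\<dots> \<le> (\<Sum>m. real k ^ m / fact m)"
        using ex by (intro sum_le_suminf) (auto simp: sums_iff)
      also have "\<dots> = exp (real k)" using ex by (simp add: sums_iff)
      also have "\<dots> = exp 1 ^ k" by (simp add: exp_of_nat_mult[symmetric])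
      finally show "real k ^ k / fact k \<le> exp 1 ^ k" .
    qed (use c in auto)
    also have "2 * (2 * c) ^ k * exp 1 ^ k = a k"
    proof -
      have "(2 * c) ^ k * exp 1 ^ k = (2 * c * exp 1) ^ k" by (simp only: power_mult_distrib)
      also have "2 * c * exp 1 = 1 / 3" by (simp add: c_def)
      finally show ?thesis using k by (simp add: a_def)
    qed
    finally show ?thesis .
  qed
  have "(\<integral>\<^sup>+x. ennreal (exp (c * Y x)) \<partial>M) = (\<integral>\<^sup>+x. (\<Sum>k. ennreal ((c * Y x) ^ k / fact k)) \<partial>M)"
  proof (rule nn_integral_cong)
    fix x assume x: "x \<in> space M"
    have s: "(\<lambda>k. (c * Y x) ^ k / fact k) sums exp (c * Y x)"
      using exp_converges[of "c * Y x"] by (simp add: divide_inverse_commute)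
    then have "(\<Sum>k. ennreal ((c * Y x) ^ k / fact k)) = ennreal (\<Sum>k. (c * Y x) ^ k / fact k)"
      using c Y[OF x] by (intro suminf_ennreal2) (auto simp: sums_iff)
    with s show "ennreal (exp (c * Y x)) = (\<Sum>k. ennreal ((c * Y x) ^ k / fact k))" by (simp add: sums_iff)
  qed
  also have "\<dots> = (\<Sum>k. \<integral>\<^sup>+x. ennreal ((c * Y x) ^ k / fact k) \<partial>M)"
    by (rule nn_integral_suminf) measurable
  also have "\<dots> \<le> (\<Sum>k. ennreal (a k))"
    by (intro suminf_le term_le) auto
  also have "\<dots> = ennreal 2"
  proof -
    have "(\<lambda>k. 2 * (1 / 3 :: real) ^ k) sums (2 * (1 / (1 - 1 / 3)))"
      by (intro sums_mult geometric_sums) simp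
    moreover have "(\<lambda>k. if k = 0 then 1 else 0 :: real) sums 1" using sums_single[of 0 "\<lambda>_. 1::real"] by simp
    ultimately have "a sums (2 * (1 / (1 - 1 / 3)) - 1)"
      unfolding a_def[abs_def] by (rule sums_diff)
    then have "a sums 2" by simp
    then show ?thesis by (simp add: suminf_ennreal2 a_nonneg sums_iff)
  qed
  finally show ?thesis by (simp add: c_def)
qed

section \<open>Moments of the derivatives\<close>

text \<open>The function F_k. It lies below both norms of the hypotheses, below
  \<open>hs_norm\<close> for the start at exponent 2 and below \<open>op_norm\<close> for the start
  at order d, and it equals |f| for k = 0.\<close>

definition sup_form :: "nat \<Rightarrow> nat \<Rightarrow> ((nat \<Rightarrow> real) \<Rightarrow> real) \<Rightarrow> (nat \<Rightarrow> real) \<Rightarrow> real" where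
  "sup_form n k f x = (SUP v\<in>rat_tuples n k. \<bar>deriv_form n k f x v\<bar>)"

lemma rat_tuples_norm: "v \<in> rat_tuples n k \<Longrightarrow> j < k \<Longrightarrow> (\<Sum>i<n. (v j i)\<^sup>2) \<le> 1"
  using rat_tuples_mem by (fastforce simp: rat_ball_def)

lemma bdd_above_sup_form: "bdd_above ((\<lambda>v. \<bar>deriv_form n k f x v\<bar>) ` rat_tuples n k)"
  by (rule bdd_aboveI2[where M = "hs_norm n k f x"]) (intro deriv_form_le_hs_norm rat_tuples_norm)

lemma deriv_form_le_sup_form: "v \<in> rat_tuples n k \<Longrightarrow> \<bar>deriv_form n k f x v\<bar> \<le> sup_form n k f x"
  unfolding sup_form_def by (rule cSUP_upper[OF _ bdd_above_sup_form])

lemma sup_form_nonneg: "0 \<le> sup_form n k f x"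
proof -
  obtain v where "v \<in> rat_tuples n k" using rat_tuples_nonempty by blast
  from deriv_form_le_sup_form[OF this, of f x] show ?thesis by linarith
qed

lemma sup_form_le_hs_norm: "sup_form n k f x \<le> hs_norm n k f x"
  unfolding sup_form_def
  by (intro cSUP_least rat_tuples_nonempty deriv_form_le_hs_norm rat_tuples_norm)

lemma sup_form_le_op_norm: "n \<ge> 1 \<Longrightarrow> d \<ge> 1 \<Longrightarrow> sup_form n d f x \<le> op_norm n d f x"
  unfolding sup_form_def
  by (intro cSUP_least rat_tuples_nonempty deriv_form_le_op_norm rat_tuples_norm)

lemma sup_form_0: "sup_form n 0 f x = \<bar>f x\<bar>"
proof -
  have "multi_indices n 0 = {[]}" by (auto simp: multi_indices_def)
  then show ?thesis by (simp add: sup_form_def deriv_form_def)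
qed

lemma continuous_on_deriv_form:
  "C_on n d G f \<Longrightarrow> k \<le> d \<Longrightarrow> continuous_on G (\<lambda>x. deriv_form n k f x v)"
  unfolding deriv_form_def by (intro continuous_intros continuous_on_partials)

lemma borel_measurable_sup_form:
  assumes "borel_prob_on G \<mu>" "C_on n d G f" "k \<le> d"
  shows "sup_form n k f \<in> borel_measurable \<mu>"
  unfolding sup_form_def[abs_def]
proof (rule borel_measurable_cSUP[OF countable_rat_tuples _ bdd_above_sup_form])
  fix v
  have "(\<lambda>x. deriv_form n k f x v) \<in> borel_measurable \<mu>"
    by (intro borel_measurable_continuous_on_prob[OF assms(1)] continuous_on_deriv_form[OF assms(2,3)])
  then show "(\<lambda>x. \<bar>deriv_form n k f x v\<bar>) \<in> borel_measurable \<mu>" by measurable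
qed

text \<open>Pairing the gradient of a form with u gives the form of the next order at the tuple (u,
  v), so duality over rational vectors bounds the length of the gradient. This makes F_(k+1) an
  upper gradient for each form below F_k.\<close>

lemma gradient_deriv_form_le:
  assumes v: "v \<in> rat_tuples n k"
  shows "(\<Sum>i<n. (\<Sum>is\<in>multi_indices n k. partials (i # is) f x * (\<Prod>j<k. v j (is ! j)))\<^sup>2)
    \<le> (sup_form n (Suc k) f x)\<^sup>2"
proof (rule sum_squares_le_from_rat_ball)
  fix u assume "u \<in> rat_ball n"
  with v have "case_nat u v \<in> rat_tuples n (Suc k)" by force
  from deriv_form_le_sup_form[OF this, of f x]
  show "(\<Sum>i<n. u i * (\<Sum>is\<in>multi_indices n k. partials (i # is) f x * (\<Prod>j<k. v j (is ! j))))
      \<le> sup_form n (Suc k) f x"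
    unfolding deriv_form_Suc by linarith
qed

text \<open>Passes from order k + 1 to order k, with \<open>Suc m\<close> in the role of d - k. For
  each surrogate an inner induction on j doubles the exponent; the resulting bounds are uniform in
  N, so the limit inherits them.\<close>

lemma sup_form_moment_step:
  assumes G: "openin (Euclidean_space n) G" and \<mu>: "borel_prob_on G \<mu>"
    and P: "Poincare_ineq n G \<mu> (\<sigma>\<^sup>2)" and \<sigma>: "\<sigma> > 0"
    and f: "C_on n d G f" and k: "k < d"
    and hs: "(\<integral>\<^sup>+x. ennreal ((hs_norm n k f x)\<^sup>2) \<partial>\<mu>) \<le> ennreal ((\<sigma>\<^sup>2) ^ Suc m)"
    and next_order: "\<And>j. j \<ge> 1 \<Longrightarrow> (\<integral>\<^sup>+x. ennreal (sup_form n (Suc k) f x ^ 2 ^ j) \<partial>\<mu>)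
      \<le> ennreal (((\<sigma> * 2 ^ j) ^ m) ^ 2 ^ j)"
    and j: "j \<ge> 1"
  shows "(\<integral>\<^sup>+x. ennreal (sup_form n k f x ^ 2 ^ j) \<partial>\<mu>) \<le> ennreal (((\<sigma> * 2 ^ j) ^ Suc m) ^ 2 ^ j)"
proof -
  interpret prob_space \<mu> using \<mu> by (simp add: borel_prob_on_def)
  have sp: "space \<mu> = G" using \<mu> by (simp add: borel_prob_on_def)
  let ?F = "sup_form n k f" and ?\<Phi> = "sup_form n (Suc k) f"
  define v where "v = from_nat_into (rat_tuples n k)"
  have v: "v i \<in> rat_tuples n k" for i
    unfolding v_def by (rule from_nat_into[OF rat_tuples_nonempty])
  have v_range: "range v = rat_tuples n k"
    unfolding v_def by (rule range_from_nat_into[OF rat_tuples_nonempty countable_rat_tuples])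
  have \<Phi>_meas: "?\<Phi> \<in> borel_measurable \<mu>"
    using k by (intro borel_measurable_sup_form[OF \<mu> f]) simp
  have "\<exists>h. h \<in> borel_measurable \<mu> \<and> (\<forall>x\<in>G. 0 \<le> h x) \<and> (\<forall>x\<in>G. h x \<le> ?F x)
      \<and> (\<forall>x\<in>G. \<forall>m\<le>N. (\<bar>deriv_form n k f x (v m)\<bar> - 2 / real (Suc N)) / (1 + ?F x / real (Suc N)) \<le> h x)
      \<and> (\<integral>\<^sup>+x. ennreal (h x ^ 2 ^ j) \<partial>\<mu>) \<le> ennreal (((\<sigma> * 2 ^ j) ^ Suc m) ^ 2 ^ j)" for N
  proof -
    have form_cont: "continuous_on G (\<lambda>x. deriv_form n k f x (v m))" for m
      using k by (intro continuous_on_deriv_form[OF f]) simp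
    have grad_cont: "continuous_on G (\<lambda>x. \<Sum>is\<in>multi_indices n k. partials (i # is) f x * (\<Prod>j<k. v m j (is ! j)))"
      if "i < n" for m i
      using k that by (intro continuous_intros continuous_on_partials[OF f, of "Suc k"] Cons_multi_indices) auto
    obtain h E where h: "continuous_on G h" "has_partials n G h E" "\<And>i. i < n \<Longrightarrow> continuous_on G (E i)"
      "\<And>x. x \<in> G \<Longrightarrow> 0 \<le> h x" "\<And>x. x \<in> G \<Longrightarrow> h x \<le> real (Suc N)" "\<And>x. x \<in> G \<Longrightarrow> h x \<le> ?F x"
      "\<And>x m. x \<in> G \<Longrightarrow> m \<le> N \<Longrightarrow>
          (\<bar>deriv_form n k f x (v m)\<bar> - 2 / real (Suc N)) / (1 + ?F x / real (Suc N)) \<le> h x"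
      "\<And>x. x \<in> G \<Longrightarrow> (\<Sum>i<n. (E i x)\<^sup>2) \<le> (?\<Phi> x)\<^sup>2"
      by (rule soft_max_exists[where f = "\<lambda>m x. deriv_form n k f x (v m)" and N = N,
            OF has_partials_deriv_form[OF f k] form_cont grad_cont deriv_form_le_sup_form[OF v]
              gradient_deriv_form_le[OF v]]) (assumption, rule that)
    have meas [measurable]: "h \<in> borel_measurable \<mu>" by (rule borel_measurable_continuous_on_prob[OF \<mu> h(1)])
    have int: "integrable \<mu> (\<lambda>x. h x ^ p)" for p
      using h(4,5) sp by (intro integrable_const_bound[of _ "real (Suc N) ^ p"]) (auto intro!: AE_I2 power_mono simp del: of_nat_Suc)
    have nn: "(\<integral>\<^sup>+x. ennreal (h x ^ p) \<partial>\<mu>) = ennreal (\<integral>x. h x ^ p \<partial>\<mu>)" for p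
      using h(4) sp by (intro nn_integral_eq_integral int) (auto intro!: AE_I2)
    have "(\<integral>x. h x ^ 2 ^ j \<partial>\<mu>) \<le> ((\<sigma> * 2 ^ j) ^ Suc m) ^ 2 ^ j"
      using j
    proof (induction j rule: nat_induct_at_least)
      \<comment> \<open>Exponent 2: the surrogate lies below the Hilbert-Schmidt norm, and
        \<sigma>^(m+1) is increased to (2 \<sigma>)^(m+1).\<close>
      case base
      have "ennreal (\<integral>x. h x ^ 2 \<partial>\<mu>) \<le> (\<integral>\<^sup>+x. ennreal ((hs_norm n k f x)\<^sup>2) \<partial>\<mu>)"
        unfolding nn[symmetric] using h(4) sp order_trans[OF h(6) sup_form_le_hs_norm]
        by (intro nn_integral_mono ennreal_leI power_mono) auto
      also note hs
      finally have "(\<integral>x. h x ^ 2 \<partial>\<mu>) \<le> (\<sigma>\<^sup>2) ^ Suc m"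
        by (subst (asm) ennreal_le_iff) auto
      also have "\<dots> = (\<sigma> ^ Suc m)\<^sup>2" by (simp only: power_mult[symmetric] mult.commute)
      also have "\<dots> \<le> ((\<sigma> * 2 ^ 1) ^ Suc m)\<^sup>2"
        using \<sigma> by (intro power_mono) auto
      finally show ?case by simp
    next
      case (Suc j)
      let ?q = "2 ^ j :: nat" and ?A = "(\<sigma> * 2 ^ Suc j) ^ Suc m" and ?b = "(\<sigma> * 2 ^ Suc j) ^ m"
      let ?s = "\<sigma> * 2 ^ Suc j"
      have "(\<integral>x. h x ^ (2 * ?q) \<partial>\<mu>) \<le> ?A ^ (2 * ?q)"
      proof (rule moment_step[where q = ?q and A = ?A and h = h and \<phi> = ?\<Phi> and b = ?b
            and A0 = "(\<sigma> * 2 ^ j) ^ Suc m", OF G \<mu> P \<sigma> h(1-5) \<Phi>_meas h(8)])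
        show "(\<integral>\<^sup>+x. ennreal (?\<Phi> x ^ (2 * ?q)) \<partial>\<mu>) \<le> ennreal (?b ^ (2 * ?q))"
          using next_order[of "Suc j"] by simp
        \<comment> \<open>The old bound is A / 2^(m+1) \<le> A/2, and \<sigma> q b = (s/2) s^m =
          A/2. The two squares add up to at most A^2 / 2.\<close>
        have "\<sigma> * 2 ^ j = ?s * (1 / 2)" by simp
        then have "((\<sigma> * 2 ^ j) ^ Suc m)\<^sup>2 = (?s ^ Suc m)\<^sup>2 * ((1 / 2) ^ Suc m)\<^sup>2"
          by (simp only: power_mult_distrib)
        also have "\<dots> \<le> (?s ^ Suc m)\<^sup>2 * (1 / 2)\<^sup>2"
          using power_decreasing[of 1 "Suc m" "1 / 2 :: real"]
          by (intro mult_left_mono power_mono) auto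
        finally have "((\<sigma> * 2 ^ j) ^ Suc m)\<^sup>2 \<le> ?A\<^sup>2 / 4" by (simp add: power2_eq_square)
        moreover have "\<sigma>\<^sup>2 * (real ?q)\<^sup>2 * ?b\<^sup>2 = (?s / 2 * ?b)\<^sup>2"
          by (simp add: power_mult_distrib)
        moreover have "(?s / 2 * ?b)\<^sup>2 = ?A\<^sup>2 / 4" by (simp add: power2_eq_square)
        moreover have "0 \<le> ?A\<^sup>2" by simp
        ultimately show "((\<sigma> * 2 ^ j) ^ Suc m)\<^sup>2 + \<sigma>\<^sup>2 * (real ?q)\<^sup>2 * ?b\<^sup>2 \<le> ?A\<^sup>2" by linarith
        show "(\<integral>x. h x ^ ?q \<partial>\<mu>) \<le> ((\<sigma> * 2 ^ j) ^ Suc m) ^ ?q" by (rule Suc.IH)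
      qed (use \<sigma> in auto)
      then show ?case by simp
    qed
    then have "(\<integral>\<^sup>+x. ennreal (h x ^ 2 ^ j) \<partial>\<mu>) \<le> ennreal (((\<sigma> * 2 ^ j) ^ Suc m) ^ 2 ^ j)"
      unfolding nn by (rule ennreal_leI)
    with meas h(4,6,7) show ?thesis by (intro exI[of _ h]) blast
  qed
  then obtain h where h: "\<And>N. h N \<in> borel_measurable \<mu>" "\<And>N x. x \<in> G \<Longrightarrow> 0 \<le> h N x"
      "\<And>N x. x \<in> G \<Longrightarrow> h N x \<le> ?F x"
      "\<And>N x m. x \<in> G \<Longrightarrow> m \<le> N \<Longrightarrow>
        (\<bar>deriv_form n k f x (v m)\<bar> - 2 / real (Suc N)) / (1 + ?F x / real (Suc N)) \<le> h N x"
      "\<And>N. (\<integral>\<^sup>+x. ennreal (h N x ^ 2 ^ j) \<partial>\<mu>) \<le> ennreal (((\<sigma> * 2 ^ j) ^ Suc m) ^ 2 ^ j)"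
    by metis
  have lim: "(\<lambda>N. h N x) \<longlonglongrightarrow> ?F x" if x: "x \<in> G" for x
  proof (rule order_tendstoI)
    \<comment> \<open>Some enumerated form \<open>v m\<close> already exceeds a; the surrogates take
      it into account from N = m on, and their losses tend to 0.\<close>
    fix a assume "a < ?F x"
    then obtain w where w: "w \<in> rat_tuples n k" "a < \<bar>deriv_form n k f x w\<bar>"
      unfolding sup_form_def
      by (subst (asm) less_cSUP_iff[OF rat_tuples_nonempty bdd_above_sup_form]) blast
    then obtain m where m: "w = v m" using v_range by blast
    have inv: "(\<lambda>N. 1 / real (Suc N)) \<longlonglongrightarrow> 0" by (rule LIMSEQ_Suc[OF lim_1_over_n])
    have "(\<lambda>N. (\<bar>deriv_form n k f x (v m)\<bar> - 2 * (1 / real (Suc N))) / (1 + ?F x * (1 / real (Suc N))))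
        \<longlonglongrightarrow> (\<bar>deriv_form n k f x (v m)\<bar> - 2 * 0) / (1 + ?F x * 0)"
      by (intro tendsto_intros inv) simp
    then have "(\<lambda>N. (\<bar>deriv_form n k f x (v m)\<bar> - 2 / real (Suc N)) / (1 + ?F x / real (Suc N)))
        \<longlonglongrightarrow> \<bar>deriv_form n k f x (v m)\<bar>" by simp
    from order_tendstoD(1)[OF this w(2)[unfolded m]] eventually_ge_at_top[of m]
    show "\<forall>\<^sub>F N in sequentially. a < h N x"
      by eventually_elim (use h(4)[OF x] in \<open>meson less_le_trans\<close>)
  next
    fix a assume "?F x < a"
    then show "\<forall>\<^sub>F N in sequentially. h N x < a"
      using h(3)[OF x] by (intro always_eventually allI) (meson le_less_trans)
  qed
  have "(\<integral>\<^sup>+x. ennreal (?F x ^ 2 ^ j) \<partial>\<mu>) = (\<integral>\<^sup>+x. liminf (\<lambda>N. ennreal (h N x ^ 2 ^ j)) \<partial>\<mu>)"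
    using lim sp
    by (intro nn_integral_cong lim_imp_Liminf[symmetric] tendsto_ennrealI tendsto_power) auto
  \<comment> \<open>Fatou's lemma, since F_k itself is not known to have the moment in
    advance.\<close>
  also have "\<dots> \<le> liminf (\<lambda>N. \<integral>\<^sup>+x. ennreal (h N x ^ 2 ^ j) \<partial>\<mu>)"
    using h(1) by (intro nn_integral_liminf) measurable
  also have "\<dots> \<le> liminf (\<lambda>N::nat. ennreal (((\<sigma> * 2 ^ j) ^ Suc m) ^ 2 ^ j))"
    by (intro Liminf_mono always_eventually allI h(5))
  also have "\<dots> = ennreal (((\<sigma> * 2 ^ j) ^ Suc m) ^ 2 ^ j)" by (simp add: Liminf_const)
  finally show ?thesis .
qed

text \<open>The partial derivatives of order k < d are centred and C^1. Applying the Poincare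
  inequality to each and summing over the multi-indices produces the Hilbert-Schmidt norm of order k
  + 1, at the price of one factor \<sigma>^2.\<close>

lemma hs_norm_L2_bound:
  assumes G: "openin (Euclidean_space n) G" and \<mu>: "borel_prob_on G \<mu>"
    and P: "Poincare_ineq n G \<mu> (\<sigma>\<^sup>2)" and \<sigma>: "\<sigma> > 0" and f: "C_on n d G f"
    and mean: "\<And>k is. k < d \<Longrightarrow> is \<in> multi_indices n k \<Longrightarrow> has_bochner_integral \<mu> (partials is f) 0"
    and top: "(\<integral>\<^sup>+x. ennreal ((hs_norm n d f x)\<^sup>2) \<partial>\<mu>) \<le> 1"
  shows "k + m = d \<Longrightarrow> (\<integral>\<^sup>+x. ennreal ((hs_norm n k f x)\<^sup>2) \<partial>\<mu>) \<le> ennreal ((\<sigma>\<^sup>2) ^ m)"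
proof (induction m arbitrary: k)
  case 0
  with top show ?case by simp
next
  case (Suc m)
  then have k: "k < d" by simp
  have meas: "partials is f \<in> borel_measurable \<mu>" if "is \<in> multi_indices n l" "l \<le> d" for l "is"
    by (intro borel_measurable_continuous_on_prob[OF \<mu>] continuous_on_partials[OF f that(2,1)])
  have "(\<integral>\<^sup>+x. ennreal ((hs_norm n k f x)\<^sup>2) \<partial>\<mu>)
      = (\<integral>\<^sup>+x. (\<Sum>is\<in>multi_indices n k. ennreal ((partials is f x)\<^sup>2)) \<partial>\<mu>)"
    unfolding hs_norm_sq by (simp add: sum_ennreal)
  also have "\<dots> = (\<Sum>is\<in>multi_indices n k. \<integral>\<^sup>+x. ennreal ((partials is f x)\<^sup>2) \<partial>\<mu>)"
    using meas k by (intro nn_integral_sum) (auto intro!: measurable_compose[OF _ measurable_ennreal] borel_measurable_power)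
  also have "\<dots> \<le> (\<Sum>is\<in>multi_indices n k.
      ennreal (\<sigma>\<^sup>2) * (\<integral>\<^sup>+x. ennreal (\<Sum>i<n. (partials (i # is) f x)\<^sup>2) \<partial>\<mu>))"
    using k \<sigma>
    by (intro sum_mono Poincare_ineq_mean_zero[OF G \<mu> P] has_partials_partials[OF f k] mean
          continuous_on_partials[OF f, of k] continuous_on_partials[OF f, of "Suc k"] Cons_multi_indices) auto
  also have "\<dots> = ennreal (\<sigma>\<^sup>2) * (\<integral>\<^sup>+x. (\<Sum>is\<in>multi_indices n k. ennreal (\<Sum>i<n. (partials (i # is) f x)\<^sup>2)) \<partial>\<mu>)"
  proof -
    have "(\<lambda>x. ennreal (\<Sum>i<n. (partials (i # is) f x)\<^sup>2)) \<in> borel_measurable \<mu>"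
      if "is \<in> multi_indices n k" for "is"
      using that k
      by (intro measurable_compose[OF _ measurable_ennreal] borel_measurable_sum borel_measurable_power
            meas[of _ "Suc k"] Cons_multi_indices) auto
    then show ?thesis by (simp add: sum_distrib_left[symmetric] nn_integral_sum)
  qed
  also have "(\<lambda>x. \<Sum>is\<in>multi_indices n k. ennreal (\<Sum>i<n. (partials (i # is) f x)\<^sup>2))
      = (\<lambda>x. ennreal ((hs_norm n (Suc k) f x)\<^sup>2))"
    unfolding hs_norm_sq sum_multi_indices_Suc
    by (subst sum.swap) (simp add: sum_ennreal sum_nonneg)
  also have "ennreal (\<sigma>\<^sup>2) * (\<integral>\<^sup>+x. ennreal ((hs_norm n (Suc k) f x)\<^sup>2) \<partial>\<mu>) \<le> ennreal (\<sigma>\<^sup>2) * ennreal ((\<sigma>\<^sup>2) ^ m)"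
    using Suc by (intro mult_left_mono Suc.IH) auto
  also have "\<dots> = ennreal ((\<sigma>\<^sup>2) ^ Suc m)" by (simp add: ennreal_mult)
  finally show ?case .
qed

theorem theorem1p2:
  shows "\<exists>c::real. c > 0 \<and>
    (\<forall>(n::nat) (d::nat) (G :: (nat \<Rightarrow> real) set) (\<mu> :: (nat \<Rightarrow> real) measure)
       (\<sigma>::real) (f :: (nat \<Rightarrow> real) \<Rightarrow> real).
       n \<ge> 1 \<and> d \<ge> 1 \<and>
       openin (Euclidean_space n) G \<and> borel_prob_on G \<mu> \<and>
       \<sigma> > 0 \<and> Poincare_ineq n G \<mu> (\<sigma>\<^sup>2) \<and>
       C_on n d G f \<and>
       has_bochner_integral \<mu> f 0 \<and>
       (\<forall>k\<in>{1..<d}. \<forall>is\<in>multi_indices n k. has_bochner_integral \<mu> (partials is f) 0) \<and>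
       L2_norm \<mu> (hs_norm n d f) \<le> 1 \<and>
       Linf_norm \<mu> (op_norm n d f) \<le> 1
       \<longrightarrow> (\<integral>\<^sup>+x. ennreal (exp (c / \<sigma> * root d \<bar>f x\<bar>)) \<partial>\<mu>) \<le> 2)"
proof (intro exI[of _ "1 / (6 * exp 1) :: real"] conjI allI impI)
  fix n d :: nat and G \<mu> and \<sigma> :: real and f :: "(nat \<Rightarrow> real) \<Rightarrow> real"
  assume "n \<ge> 1 \<and> d \<ge> 1 \<and>
       openin (Euclidean_space n) G \<and> borel_prob_on G \<mu> \<and>
       \<sigma> > 0 \<and> Poincare_ineq n G \<mu> (\<sigma>\<^sup>2) \<and>
       C_on n d G f \<and>
       has_bochner_integral \<mu> f 0 \<and>
       (\<forall>k\<in>{1..<d}. \<forall>is\<in>multi_indices n k. has_bochner_integral \<mu> (partials is f) 0) \<and>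
       L2_norm \<mu> (hs_norm n d f) \<le> 1 \<and>
       Linf_norm \<mu> (op_norm n d f) \<le> 1"
  then have n: "n \<ge> 1" and d: "d \<ge> 1" and G: "openin (Euclidean_space n) G" and \<mu>: "borel_prob_on G \<mu>"
    and \<sigma>: "\<sigma> > 0" and P: "Poincare_ineq n G \<mu> (\<sigma>\<^sup>2)" and f: "C_on n d G f"
    and mean0: "has_bochner_integral \<mu> f 0"
    and mean1: "\<forall>k\<in>{1..<d}. \<forall>is\<in>multi_indices n k. has_bochner_integral \<mu> (partials is f) 0"
    and L2: "L2_norm \<mu> (hs_norm n d f) \<le> 1" and Linf: "Linf_norm \<mu> (op_norm n d f) \<le> 1"
    by auto
  interpret prob_space \<mu> using \<mu> by (simp add: borel_prob_on_def)
  have mean: "has_bochner_integral \<mu> (partials is f) 0" if "k < d" "is \<in> multi_indices n k" for k "is"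
  proof (cases "k = 0")
    case True
    with that mean0 show ?thesis by (simp add: multi_indices_def)
  qed (use that mean1 in auto)
  have top: "(\<integral>\<^sup>+x. ennreal ((hs_norm n d f x)\<^sup>2) \<partial>\<mu>) \<le> 1"
  proof -
    let ?I = "\<integral>\<^sup>+x. ennreal ((hs_norm n d f x)\<^sup>2) \<partial>\<mu>"
    have fin: "?I \<noteq> \<infinity>" using L2 by (auto simp: L2_norm_def Let_def top_unique)
    then have "enn2real ?I \<le> 1" using L2 by (simp add: L2_norm_def Let_def)
    then have "ennreal (enn2real ?I) \<le> ennreal 1" by (rule ennreal_leI)
    then show ?thesis using fin by (simp add: less_top)
  qed
  have hs: "(\<integral>\<^sup>+x. ennreal ((hs_norm n k f x)\<^sup>2) \<partial>\<mu>) \<le> ennreal ((\<sigma>\<^sup>2) ^ m)" if "k + m = d" for k m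
    by (rule hs_norm_L2_bound[OF G \<mu> P \<sigma> f mean top that])
  have op: "AE x in \<mu>. sup_form n d f x \<le> 1"
  proof -
    have "AE x in \<mu>. ennreal \<bar>op_norm n d f x\<bar> \<le> esssup \<mu> (\<lambda>x. ennreal \<bar>op_norm n d f x\<bar>)"
      by (rule esssup_AE)
    then show ?thesis
    proof eventually_elim
      case (elim x)
      from this Linf[unfolded Linf_norm_def] have "ennreal \<bar>op_norm n d f x\<bar> \<le> 1" by (rule order_trans)
      then have "\<bar>op_norm n d f x\<bar> \<le> 1" by simp
      with sup_form_le_op_norm[OF n d, of f x] show ?case by linarith
    qed
  qed
  \<comment> \<open>Induction on m = d - k, starting from order d, where the bound is 1 for every
    exponent because F_d \<le> 1 almost everywhere.\<close>
  have sup_mom: "(\<integral>\<^sup>+x. ennreal (sup_form n k f x ^ 2 ^ j) \<partial>\<mu>) \<le> ennreal (((\<sigma> * 2 ^ j) ^ m) ^ 2 ^ j)"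
    if "k + m = d" "j \<ge> 1" for k m j
    using that
  proof (induction m arbitrary: k j)
    case 0
    then have "(\<integral>\<^sup>+x. ennreal (sup_form n k f x ^ 2 ^ j) \<partial>\<mu>) \<le> (\<integral>\<^sup>+x. 1 \<partial>\<mu>)"
      using op by (intro nn_integral_mono_AE) (auto elim!: eventually_mono intro!: power_le_one sup_form_nonneg)
    then show ?case by (simp add: emeasure_space_1)
  next
    case (Suc m)
    then show ?case
      by (intro sup_form_moment_step[OF G \<mu> P \<sigma> f _ hs Suc.IH]) auto
  qed
  define Y where "Y x = root d \<bar>f x\<bar> / \<sigma>" for x
  have f_meas [measurable]: "f \<in> borel_measurable \<mu>"
    by (rule borel_measurable_continuous_on_prob[OF \<mu> C_on_continuous[OF f]])
  have "(\<integral>\<^sup>+x. ennreal (exp (1 / (6 * exp 1) * Y x)) \<partial>\<mu>) \<le> 2"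
  proof (rule exp_moment_bound[OF prob_space_axioms _ _ d])
    show "Y \<in> borel_measurable \<mu>"
    proof -
      have "continuous_on UNIV (root d)" by (intro continuous_intros)
      then have [measurable]: "root d \<in> borel_measurable borel" by (rule borel_measurable_continuous_onI)
      show ?thesis unfolding Y_def[abs_def] by measurable
    qed
    show "0 \<le> Y x" for x using \<sigma> d by (simp add: Y_def real_root_ge_zero)
    fix j :: nat assume j: "j \<ge> 1"
    have "(\<integral>\<^sup>+x. ennreal (Y x ^ (d * 2 ^ j)) \<partial>\<mu>)
        = (\<integral>\<^sup>+x. ennreal (1 / \<sigma> ^ (d * 2 ^ j)) * ennreal (sup_form n 0 f x ^ 2 ^ j) \<partial>\<mu>)"
    proof (rule nn_integral_cong)
      fix x
      \<comment> \<open>A power of order d 2^j undoes the root of order d, so the bound for k = 0 at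
        exponent 2^j applies; the powers of \<sigma> then cancel.\<close>
      have "Y x ^ (d * 2 ^ j) = \<bar>f x\<bar> ^ 2 ^ j / \<sigma> ^ (d * 2 ^ j)"
        using d by (simp add: Y_def power_divide power_mult)
      then show "ennreal (Y x ^ (d * 2 ^ j)) = ennreal (1 / \<sigma> ^ (d * 2 ^ j)) * ennreal (sup_form n 0 f x ^ 2 ^ j)"
        using \<sigma> by (simp add: sup_form_0 ennreal_mult[symmetric])
    qed
    also have "\<dots> = ennreal (1 / \<sigma> ^ (d * 2 ^ j)) * (\<integral>\<^sup>+x. ennreal (sup_form n 0 f x ^ 2 ^ j) \<partial>\<mu>)"
      by (intro nn_integral_cmult) (simp add: sup_form_0)
    also have "\<dots> \<le> ennreal (1 / \<sigma> ^ (d * 2 ^ j)) * ennreal (((\<sigma> * 2 ^ j) ^ d) ^ 2 ^ j)"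
      by (intro mult_left_mono sup_mom j) auto
    also have "\<dots> = ennreal ((2 ^ j) ^ (d * 2 ^ j))"
      using \<sigma> by (simp add: ennreal_mult[symmetric] power_mult[symmetric] power_mult_distrib)
    finally show "(\<integral>\<^sup>+x. ennreal (Y x ^ (d * 2 ^ j)) \<partial>\<mu>) \<le> ennreal ((2 ^ j) ^ (d * 2 ^ j))" .
  qed
  then show "(\<integral>\<^sup>+x. ennreal (exp (1 / (6 * exp 1) / \<sigma> * root d \<bar>f x\<bar>)) \<partial>\<mu>) \<le> 2"
    by (simp add: Y_def)
qed simp

end
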